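(* Let $d\ge 2$, let $\omega\subset\mathbb R^{d-1}$ be a bounded Lipschitz set, and let $\Omega_\varepsilon=\omega\times(0,\varepsilon)$ for $\varepsilon>0$. Let $s_\varepsilon\in(0,\frac12)$ with $s_\varepsilon\to s_0\in[0,\frac12)$ as $\varepsilon\to0$. Then the $\Gamma$-limit as $\varepsilon\to 0$, with respect to the weak dimension-reduction convergence, of the functionals $$F_\varepsilon(u)=\frac1{\varepsilon^2}\lfloor u\rfloor^2_{s_\varepsilon}(\Omega_\varepsilon),\qquad u\in H^{s_\varepsilon}(\Omega_\varepsilon),$$ is the functional defined on $L^2(\omega)$ by the squared $H^{\frac12+s_0}$-seminorm on $\omega$, that is (since $d-1+2(\frac12+s_0)=d+2s_0$), $$F_0(u)=\int_\omega\int_\omega\frac{|u(x')-u(y')|^2}{|x'-y'|^{d+2s_0}}\,dx'\,dy'\in[0,+\infty],\qquad u\in L^2(\omega).$$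
   Context: "Bounded Lipschitz set" means a bounded open set with Lipschitz boundary. Points of $\mathbb R^d$ are written $x=(x',x_d)$ with $x'\in\mathbb R^{d-1}$. For measurable $A\subset\mathbb R^d$ and $s\in(0,1)$, the squared seminorm is $\lfloor u\rfloor_s^2(A)=\int_A\int_A\frac{|u(x)-u(y)|^2}{|x-y|^{d+2s}}\,dx\,dy$. Weak dimension-reduction convergence: given $u_\varepsilon\in H^{s_\varepsilon}(\Omega_\varepsilon)$, let $v_\varepsilon:\omega\times(0,1)\to\mathbb R$, $v_\varepsilon(x',x_d)=u_\varepsilon(x',\varepsilon x_d)$. One says $u_\varepsilon\to u$, with $u\in L^2(\omega)$, if $v_\varepsilon\rightharpoonup v$ weakly in $L^2(\omega\times(0,1))$, where $v(x',x_d)=u(x')$. $\Gamma$-convergence with respect to this convergence means: for every $u\in L^2(\omega)$, (1) $\liminf_{\varepsilon\to0}F_\varepsilon(u_\varepsilon)\ge F_0(u)$ whenever $u_\varepsilon\to u$; (2) there exist $u_\varepsilon\to u$ with $\limsup_{\varepsilon\to0}F_\varepsilon(u_\varepsilon)\le F_0(u)$. *)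

theory Defs
  imports "HOL-Analysis.Analysis"
begin

text \<open>
  Points of the \<open>d\<close>-dimensional space are pairs \<open>(x', x_d) :: (real ^ 'n) \<times> real\<close> with
  \<open>d = CARD('n) + 1\<close>; hence \<open>d \<ge> 2\<close> holds automatically, and the product norm is the
  Euclidean one. Elements of \<open>L\<^sup>2\<close> and \<open>H\<^sup>s\<close> are represented by Lebesgue measurable functions whose
  values outside the domain are irrelevant.
\<close>

text \<open>Near each boundary point the set is, after a rotation taking \<open>e\<close> to the last coordinate
  direction, the strict epigraph of a Lipschitz function defined on the hyperplane orthogonal to
  \<open>e\<close>. In dimension one the hyperplane is \<open>{0}\<close>, and the set is locally a half-line.\<close>

definition lipschitz_boundary :: "'a::euclidean_space set \<Rightarrow> bool" where
  "lipschitz_boundary U \<longleftrightarrow>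
     (\<forall>p\<in>frontier U. \<exists>r>0. \<exists>e. norm e = 1 \<and>
        (\<exists>g L. L-lipschitz_on {z. z \<bullet> e = 0} g \<and>
           U \<inter> ball p r = {x \<in> ball p r. g (x - (x \<bullet> e) *\<^sub>R e) < x \<bullet> e}))"

definition bounded_lipschitz_set :: "'a::euclidean_space set \<Rightarrow> bool" where
  "bounded_lipschitz_set U \<longleftrightarrow> bounded U \<and> open U \<and> lipschitz_boundary U"

definition L2_space :: "'a::euclidean_space set \<Rightarrow> ('a \<Rightarrow> real) set" where
  "L2_space A = {u. u \<in> borel_measurable (lebesgue_on A) \<and>
                    integrable (lebesgue_on A) (\<lambda>x. (u x)\<^sup>2)}"

text \<open>On the diagonal \<open>x = y\<close>, a null set, the integrand is \<open>0 / 0 = 0\<close>.\<close>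

definition seminorm_sq :: "real \<Rightarrow> 'a::euclidean_space set \<Rightarrow> ('a \<Rightarrow> real) \<Rightarrow> ennreal" where
  "seminorm_sq s A u =
     (\<integral>\<^sup>+x\<in>A. (\<integral>\<^sup>+y\<in>A. ennreal (\<bar>u x - u y\<bar>\<^sup>2 / norm (x - y) powr (real DIM('a) + 2 * s))
        \<partial>lebesgue) \<partial>lebesgue)"

text \<open>On \<open>\<omega>\<close>, of dimension \<open>d - 1\<close>, the seminorm of order \<open>1/2 + s0\<close> has kernel exponent
  \<open>d - 1 + 2 (1/2 + s0) = d + 2 s0\<close>.\<close>

lemma seminorm_sq_half_plus:
  fixes u :: "real ^ 'n::finite \<Rightarrow> real"
  shows "seminorm_sq (1/2 + s0) \<omega> u =
     (\<integral>\<^sup>+x\<in>\<omega>. (\<integral>\<^sup>+y\<in>\<omega>. ennreal (\<bar>u x - u y\<bar>\<^sup>2 /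
         norm (x - y) powr (real DIM((real ^ 'n) \<times> real) + 2 * s0)) \<partial>lebesgue) \<partial>lebesgue)"
proof -
  have "real DIM(real ^ 'n) + 2 * (1/2 + s0) = real DIM((real ^ 'n) \<times> real) + 2 * s0"
    by simp
  then show ?thesis
    unfolding seminorm_sq_def by (simp only:)
qed

definition H_space :: "real \<Rightarrow> 'a::euclidean_space set \<Rightarrow> ('a \<Rightarrow> real) set" where
  "H_space s A = {u \<in> L2_space A. seminorm_sq s A u < \<infinity>}"

text \<open>Weak convergence, tested against \<open>L\<^sup>2\<close> itself by the Riesz identification of its dual.\<close>

definition weak_conv_L2 ::
  "'a::euclidean_space set \<Rightarrow> ('i \<Rightarrow> 'a \<Rightarrow> real) \<Rightarrow> ('a \<Rightarrow> real) \<Rightarrow> 'i filter \<Rightarrow> bool" where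
  "weak_conv_L2 A v v0 F \<longleftrightarrow>
     (\<forall>\<^sub>F i in F. v i \<in> L2_space A) \<and> v0 \<in> L2_space A \<and>
     (\<forall>\<phi>\<in>L2_space A.
        ((\<lambda>i. \<integral>x. v i x * \<phi> x \<partial>lebesgue_on A) \<longlongrightarrow> (\<integral>x. v0 x * \<phi> x \<partial>lebesgue_on A)) F)"

definition dimred_conv ::
  "(real ^ 'n::finite) set \<Rightarrow> (real \<Rightarrow> (real ^ 'n) \<times> real \<Rightarrow> real) \<Rightarrow> (real ^ 'n \<Rightarrow> real) \<Rightarrow> bool"
where
  "dimred_conv \<omega> u u0 \<longleftrightarrow>
     weak_conv_L2 (\<omega> \<times> {0<..<1}) (\<lambda>\<epsilon> (x', xd). u \<epsilon> (x', \<epsilon> * xd)) (\<lambda>(x', xd). u0 x')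
       (at_right 0)"

text \<open>\<open>\<Gamma>\<close>-convergence of functionals \<open>F \<epsilon>\<close> with domains \<open>D \<epsilon>\<close> to \<open>F0\<close> with domain \<open>X\<close>, for a
  convergence \<open>conv\<close> of families indexed by \<open>\<epsilon> > 0\<close> (only their values at \<open>\<epsilon> > 0\<close> matter).\<close>

definition gamma_limit ::
  "(real \<Rightarrow> 'f set) \<Rightarrow> (real \<Rightarrow> 'f \<Rightarrow> ennreal) \<Rightarrow> ((real \<Rightarrow> 'f) \<Rightarrow> 'g \<Rightarrow> bool) \<Rightarrow>
   'g set \<Rightarrow> ('g \<Rightarrow> ennreal) \<Rightarrow> bool"
where
  "gamma_limit D F conv X F0 \<longleftrightarrow>
     (\<forall>u\<in>X.
        (\<forall>v. (\<forall>\<epsilon>>0. v \<epsilon> \<in> D \<epsilon>) \<and> conv v u \<longrightarrow>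
             Liminf (at_right 0) (\<lambda>\<epsilon>. F \<epsilon> (v \<epsilon>)) \<ge> F0 u) \<and>
        (\<exists>v. (\<forall>\<epsilon>>0. v \<epsilon> \<in> D \<epsilon>) \<and> conv v u \<and>
             Limsup (at_right 0) (\<lambda>\<epsilon>. F \<epsilon> (v \<epsilon>)) \<le> F0 u))"

end

theory Submission
  imports Defs
begin

text \<open>
  After rescaling the thin variable, \<open>F\<^sub>\<epsilon>\<close> becomes a double integral over \<open>\<omega> \<times> (0,1)\<close> whose kernel
  converges to \<open>\<bar>x' - y'\<bar>\<close> to the power \<open>-(d + 2 s0)\<close>, uniformly away from the diagonal
  \<open>x' = y'\<close>. Truncated near the diagonal, it is a bounded nonnegative quadratic form, hence weakly
  lower semicontinuous; letting the truncation vanish gives the lower bound.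

  For the upper bound, functions of \<open>x'\<close> alone that are Lipschitz on \<open>\<omega>\<close> have energies converging
  as \<open>\<epsilon> \<rightarrow> 0\<close> by dominated convergence, so a diagonal argument reduces everything to the density in
  energy of Lipschitz functions. (A general \<open>u\<close> of finite energy need not serve as its own recovery
  sequence: \<open>s\<^sub>\<epsilon>\<close> may exceed \<open>s0\<close>.) The Lipschitz boundary enters only here, through interior balls:
  every ball of small radius \<open>r\<close> centred in \<open>\<omega>\<close> contains a ball of comparable radius inside \<open>\<omega>\<close>.
  Averaging \<open>u\<close> over \<open>\<omega>\<close> with a normalised tent of radius \<open>r\<close> then gives a Lipschitz function whose
  distance to \<open>u\<close> in energy is at most a constant times the energy of \<open>u\<close> carried by pairs at
  distance less than \<open>2r\<close>, which tends to \<open>0\<close>.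
\<close>

text \<open>Write n = d - 1 for the dimension of the base and e for the exponent of the kernel. The
  estimates rest on the window n < e < n + 2. Its upper end, from order below 1/2, makes |x - y|^(2
  - e) integrable near the diagonal, so that Lipschitz functions have finite energy; its lower end,
  from s0 \<ge> 0, makes |x - y|^(-e) integrable at infinity. The error of an average at scale r is
  estimated by splitting the pairs at distance r, and the two kernel integrals then scale as r^(n +
  2 - e) and r^(n - e). Against the size and the variation of the weights all powers of r cancel, so
  smallness comes from the energy of close pairs alone. This is why explicit bounds on the weights
  are carried along, with constants fixed before r. In the lower bound the obstacle is that weak
  convergence only accepts test functions in L2. The natural test function is the gradient of the
  quadratic form at the limit, and truncation of the kernel is what places it in L2.\<close>

text \<open>Indexed by the exponent of the kernel rather than by the order: a cylinder and its base
  differ in dimension but are compared at the same exponent.\<close>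

definition energy :: "real \<Rightarrow> 'a::euclidean_space set \<Rightarrow> ('a \<Rightarrow> real) \<Rightarrow> ennreal" where
  "energy e S u =
     (\<integral>\<^sup>+x. \<integral>\<^sup>+y. ennreal ((u x - u y)\<^sup>2 / norm (x - y) powr e) \<partial>lebesgue_on S \<partial>lebesgue_on S)"

lemma nn_integral_lebesgue_on:
  assumes "S \<in> sets lebesgue"
  shows "(\<integral>\<^sup>+x. f x \<partial>lebesgue_on S) = (\<integral>\<^sup>+x\<in>S. f x \<partial>lebesgue)"
  using assms by (simp add: nn_integral_restrict_space)

lemma iterated_eq_energy:
  fixes u :: "'a::euclidean_space \<Rightarrow> real"
  assumes "S \<in> sets lebesgue"
  shows "(\<integral>\<^sup>+x\<in>S. (\<integral>\<^sup>+y\<in>S. ennreal (\<bar>u x - u y\<bar>\<^sup>2 / norm (x - y) powr e) \<partial>lebesgue) \<partial>lebesgue)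
           = energy e S u"
  by (simp add: energy_def nn_integral_lebesgue_on assms)

lemma measurable_ident_lebesgue_on [measurable]: "(\<lambda>x. x) \<in> borel_measurable (lebesgue_on S)"
  by (rule measurable_restrict_space1, rule measurable_completion) simp

lemma measurable_fst_lebesgue_on [measurable]: "fst \<in> borel_measurable (lebesgue_on S \<Otimes>\<^sub>M N)"
  using measurable_compose[OF measurable_fst measurable_ident_lebesgue_on] by simp

lemma measurable_snd_lebesgue_on [measurable]: "snd \<in> borel_measurable (N \<Otimes>\<^sub>M lebesgue_on S)"
  using measurable_compose[OF measurable_snd measurable_ident_lebesgue_on] by simp

lemma finite_measure_lebesgue_on:
  fixes S :: "'a::euclidean_space set"
  assumes "bounded S" "S \<in> sets lebesgue"
  shows "finite_measure (lebesgue_on S)"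
proof (rule finite_measureI)
  note fmeasurableD2[OF bounded_set_imp_lmeasurable[OF assms]]
  then show "emeasure (lebesgue_on S) (space (lebesgue_on S)) \<noteq> \<infinity>"
    using assms by (simp add: emeasure_restrict_space del: emeasure_completion)
qed

lemma emeasure_lebesgue_on_le:
  fixes S :: "'a::euclidean_space set"
  assumes "S \<in> sets lebesgue" "B \<in> sets borel"
  shows "(\<integral>\<^sup>+y. c * indicator B y \<partial>lebesgue_on S) \<le> c * emeasure lborel B"
proof -
  have "(\<integral>\<^sup>+y. c * indicator B y \<partial>lebesgue_on S) \<le> (\<integral>\<^sup>+y. c * indicator B y \<partial>lebesgue)"
    unfolding nn_integral_lebesgue_on[OF assms(1)]
    by (intro nn_integral_mono) (auto simp: indicator_def)
  also have "\<dots> = c * emeasure lborel B"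
    using assms by (simp add: nn_integral_cmult_indicator nn_integral_completion)
  finally show ?thesis .
qed

subsection \<open>Integrals of powers of the distance\<close>

text \<open>A series of constants on balls dominates \<open>f\<close>, and only volumes of balls
  remain to be computed; this takes the place of polar coordinates.\<close>

lemma dyadic_integral_le:
  fixes S :: "'a::euclidean_space set" and f :: "'a \<Rightarrow> ennreal"
  assumes S: "S \<in> sets lebesgue"
    and c: "\<And>k. 0 \<le> c k" and R: "\<And>k. 0 \<le> R k"
    and f: "\<And>y. f y \<noteq> 0 \<Longrightarrow> \<exists>k. f y \<le> ennreal (c k) \<and> norm (x - y) < R k"
    and sums: "(\<lambda>k. c k * (unit_ball_vol (real DIM('a)) * R k ^ DIM('a))) sums C"
  shows "(\<integral>\<^sup>+y. f y \<partial>lebesgue_on S) \<le> ennreal C"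
proof -
  have "f y \<le> (\<Sum>k. ennreal (c k) * indicator (ball x (R k)) y)" for y
  proof (cases "f y = 0")
    case False
    then obtain k where k: "f y \<le> ennreal (c k)" "norm (x - y) < R k" using f by blast
    then have "f y \<le> ennreal (c k) * indicator (ball x (R k)) y"
      by (auto simp: dist_norm)
    also have "\<dots> \<le> (\<Sum>k. ennreal (c k) * indicator (ball x (R k)) y)"
      using sum_le_suminf[of "\<lambda>k. ennreal (c k) * indicator (ball x (R k)) y" "{k}"]
      by (simp only: summableI finite.intros sum.insert empty_iff sum.empty zero_le simp_thms add_0_right
          finite.emptyI not_False_eq_True)
    finally show ?thesis .
  qed simp
  then have "(\<integral>\<^sup>+y. f y \<partial>lebesgue_on S)
      \<le> (\<integral>\<^sup>+y. (\<Sum>k. ennreal (c k) * indicator (ball x (R k)) y) \<partial>lebesgue_on S)"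
    by (intro nn_integral_mono) auto
  also have "\<dots> = (\<Sum>k. \<integral>\<^sup>+y. ennreal (c k) * indicator (ball x (R k)) y \<partial>lebesgue_on S)"
    by (intro nn_integral_suminf measurable_restrict_space1 measurable_completion)
      (auto intro!: borel_measurable_times_ennreal borel_measurable_indicator)
  also have "\<dots> \<le> (\<Sum>k. ennreal (c k * (unit_ball_vol (real DIM('a)) * R k ^ DIM('a))))"
  proof (intro suminf_le summableI)
    fix k
    show "(\<integral>\<^sup>+y. ennreal (c k) * indicator (ball x (R k)) y \<partial>lebesgue_on S)
      \<le> ennreal (c k * (unit_ball_vol (real DIM('a)) * R k ^ DIM('a)))"
      using emeasure_lebesgue_on_le[OF S, of "ball x (R k)" "ennreal (c k)"] c R
      by (simp add: emeasure_ball ennreal_mult)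
  qed
  also have "\<dots> = ennreal C"
    using sums c R by (intro suminf_ennreal_eq) (auto intro!: mult_nonneg_nonneg)
  finally show ?thesis .
qed

lemma dyadic_bracket:
  fixes t r :: real
  assumes "0 < t" "t < r"
  shows "\<exists>k. r / 2 ^ Suc k \<le> t \<and> t < r / 2 ^ k"
proof -
  obtain n where "(1/2::real) ^ n < t / r"
    using real_arch_pow_inv[of "t / r" "1/2"] assms by auto
  then have ex: "\<exists>n. r / 2 ^ n \<le> t"
    using assms by (intro exI[of _ n]) (simp add: field_simps power_divide)
  define m where "m = (LEAST n. r / 2 ^ n \<le> t)"
  have m: "r / 2 ^ m \<le> t" unfolding m_def using LeastI_ex[OF ex] .
  then obtain k where k: "m = Suc k" using assms by (cases m) auto
  have "\<not> r / 2 ^ k \<le> t" using not_less_Least[of k "\<lambda>n. r / 2 ^ n \<le> t"] k m_def by auto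
  then show ?thesis using m k by auto
qed

lemma dyadic_bracket':
  fixes t r :: real
  assumes "0 < r" "r \<le> t"
  shows "\<exists>k. r * 2 ^ k \<le> t \<and> t < r * 2 ^ Suc k"
proof -
  obtain n where "t / r < (2::real) ^ n"
    using real_arch_pow[of 2 "t / r"] by auto
  then have ex: "\<exists>n. t < r * 2 ^ n"
    using assms by (intro exI[of _ n]) (simp add: field_simps)
  define m where "m = (LEAST n. t < r * 2 ^ n)"
  have m: "t < r * 2 ^ m" unfolding m_def using LeastI_ex[OF ex] .
  then obtain k where k: "m = Suc k" using assms by (cases m) auto
  have "\<not> t < r * 2 ^ k" using not_less_Least[of k "\<lambda>n. t < r * 2 ^ n"] k m_def by auto
  then show ?thesis using m k by (intro exI[of _ k]) auto
qed

text \<open>On the shell between \<open>r / 2 ^ Suc k\<close> and \<open>r / 2 ^ k\<close> the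
  integrand is at most its value at the inner radius and the volume at most that of the outer ball.
  The products form a geometric series of ratio \<open>2 powr (a - n)\<close>, below 1 since
  \<open>a < n\<close>. One \<open>C\<close> serves all \<open>S\<close>, \<open>x\<close> and
  \<open>r\<close>.\<close>

lemma integral_powr_near:
  fixes a :: real
  assumes a: "0 \<le> a" "a < real DIM('a)"
  shows "\<exists>C\<ge>0. \<forall>(S::'a::euclidean_space set) x r. S \<in> sets lebesgue \<longrightarrow> 0 < r \<longrightarrow>
     (\<integral>\<^sup>+y. ennreal (norm (x - y) powr - a) * indicator (ball x r) y \<partial>lebesgue_on S)
       \<le> ennreal (C * r powr (real DIM('a) - a))"
proof -
  define n where "n = real DIM('a)"
  define V where "V = unit_ball_vol (real DIM('a))"
  have V: "0 \<le> V" unfolding V_def by simp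
  define q where "q = 2 powr (a - n)"
  have q: "0 \<le> q" "q < 1" using a powr_less_one[of 2 "a - n"] unfolding q_def n_def by auto
  define C where "C = V * 2 powr a / (1 - q)"
  have "(\<integral>\<^sup>+y. ennreal (norm (x - y) powr - a) * indicator (ball x r) y \<partial>lebesgue_on S)
       \<le> ennreal (C * r powr (n - a))"
    if S: "S \<in> sets lebesgue" and r: "0 < r" for S :: "'a set" and x r
  proof (rule dyadic_integral_le[OF S, where c = "\<lambda>k. (r / 2 ^ Suc k) powr - a" and R = "\<lambda>k. r / 2 ^ k"
      and x = x])
    fix y assume "ennreal (norm (x - y) powr - a) * indicator (ball x r) y \<noteq> 0"
    \<comment> \<open>\<open>0 powr - a = 0\<close>, so a nonzero integrand excludes
      \<open>y = x\<close> and the point lies in some shell.\<close>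
    then have *: "0 < norm (x - y)" "norm (x - y) < r" 
      by (auto simp: dist_norm split: split_indicator_asm)
    then obtain k where k: "r / 2 ^ Suc k \<le> norm (x - y)" "norm (x - y) < r / 2 ^ k"
      using dyadic_bracket by blast
    have "norm (x - y) powr - a \<le> (r / 2 ^ Suc k) powr - a"
      using k(1) a r by (intro powr_mono2') auto
    then show "\<exists>k. ennreal (norm (x - y) powr - a) * indicator (ball x r) y
        \<le> ennreal ((r / 2 ^ Suc k) powr - a) \<and> norm (x - y) < r / 2 ^ k"
      using k(2) by (intro exI[of _ k]) (auto split: split_indicator intro!: ennreal_leI)
  next
    have "(r / 2 ^ Suc k) powr - a * (V * (r / 2 ^ k) ^ DIM('a))
       = (V * 2 powr a * r powr (n - a)) * q ^ k" for k
    proof -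
      have "(r / 2 ^ k) ^ DIM('a) = (r * 2 powr - real k) powr n"
        using r unfolding n_def by (simp add: powr_realpow powr_minus field_simps)
      then have "(r / 2 ^ k) ^ DIM('a) = r powr n * 2 powr (- k * n)"
        using r by (simp add: powr_mult powr_powr)
      moreover have "(r / 2 ^ Suc k) powr - a = (r * 2 powr - (real k + 1)) powr - a"
        by (simp add: powr_realpow powr_add powr_minus field_simps powr_diff)
      then have "(r / 2 ^ Suc k) powr - a = r powr - a * 2 powr (real k * a + a)"
        using r by (simp add: powr_mult powr_powr algebra_simps)
      moreover have "2 powr (real k * a + a) * 2 powr (- k * n) = 2 powr a * q ^ k"
      proof -
        have "q ^ k = 2 powr ((a - n) * k)"
          unfolding q_def by (simp add: powr_powr flip: powr_realpow)
        then show ?thesis by (simp add: algebra_simps flip: powr_add)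
      qed
      moreover have "r powr - a * r powr n = r powr (n - a)"
        by (simp flip: powr_add)
      ultimately have "(r / 2 ^ Suc k) powr - a * (V * (r / 2 ^ k) ^ DIM('a)) = V * (r powr - a * r powr n) * (2 powr a * q ^ k)"
        by (smt (verit, best) mult.assoc mult.left_commute)
      then show ?thesis unfolding \<open>r powr - a * r powr n = r powr (n - a)\<close> by (simp only: mult_ac)
    qed
    then have "(\<lambda>k. (r / 2 ^ Suc k) powr - a * (V * (r / 2 ^ k) ^ DIM('a))) =
       (\<lambda>k. (V * 2 powr a * r powr (n - a)) * q ^ k)" by (intro ext)
    moreover have "(\<lambda>k. (V * 2 powr a * r powr (n - a)) * q ^ k) sums
       ((V * 2 powr a * r powr (n - a)) * (1 / (1 - q)))"
      using q by (intro sums_mult geometric_sums) auto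
    ultimately show "(\<lambda>k. (r / 2 ^ Suc k) powr - a * (unit_ball_vol (real DIM('a)) * (r / 2 ^ k) ^ DIM('a)))
       sums (C * r powr (n - a))"
      unfolding C_def V_def by (simp add: mult_ac)
  qed (use r in auto)
  moreover have "C \<ge> 0" unfolding C_def using V q by auto
  ultimately show ?thesis unfolding n_def by blast
qed

text \<open>The shells now double outward from radius \<open>r\<close>: the decay
  \<open>2 powr (- b)\<close> per step beats the volume growth \<open>2 powr n\<close>, and the
  series has ratio \<open>2 powr (n - b)\<close>.\<close>

lemma integral_powr_far:
  fixes b :: real
  assumes b: "real DIM('a) < b"
  shows "\<exists>C\<ge>0. \<forall>(S::'a::euclidean_space set) x r. S \<in> sets lebesgue \<longrightarrow> 0 < r \<longrightarrow>
     (\<integral>\<^sup>+y. ennreal (norm (x - y) powr - b) * indicator (- ball x r) y \<partial>lebesgue_on S)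
       \<le> ennreal (C * r powr (real DIM('a) - b))"
proof -
  define n where "n = real DIM('a)"
  define V where "V = unit_ball_vol (real DIM('a))"
  have V: "0 \<le> V" unfolding V_def by simp
  define q where "q = 2 powr (n - b)"
  have q: "0 \<le> q" "q < 1" using b powr_less_one[of 2 "n - b"] unfolding q_def n_def by auto
  define C where "C = V * 2 powr n / (1 - q)"
  have "(\<integral>\<^sup>+y. ennreal (norm (x - y) powr - b) * indicator (- ball x r) y \<partial>lebesgue_on S)
       \<le> ennreal (C * r powr (n - b))"
    if S: "S \<in> sets lebesgue" and r: "0 < r" for S :: "'a set" and x r
  proof (rule dyadic_integral_le[OF S, where c = "\<lambda>k. (r * 2 ^ k) powr - b" and R = "\<lambda>k. r * 2 ^ Suc k"
      and x = x])
    fix y assume "ennreal (norm (x - y) powr - b) * indicator (- ball x r) y \<noteq> 0"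
    then have *: "r \<le> norm (x - y)" 
      by (auto simp: dist_norm split: split_indicator_asm)
    then obtain k where k: "r * 2 ^ k \<le> norm (x - y)" "norm (x - y) < r * 2 ^ Suc k"
      using dyadic_bracket'[OF r] by blast
    have "norm (x - y) powr - b \<le> (r * 2 ^ k) powr - b"
      using k(1) b r by (intro powr_mono2') auto
    then show "\<exists>k. ennreal (norm (x - y) powr - b) * indicator (- ball x r) y
        \<le> ennreal ((r * 2 ^ k) powr - b) \<and> norm (x - y) < r * 2 ^ Suc k"
      using k(2) by (intro exI[of _ k]) (auto split: split_indicator intro!: ennreal_leI)
  next
    have "(r * 2 ^ k) powr - b * (V * (r * 2 ^ Suc k) ^ DIM('a))
       = (V * 2 powr n * r powr (n - b)) * q ^ k" for k
    proof -
      have "(r * 2 ^ Suc k) ^ DIM('a) = (r * 2 powr (real k + 1)) powr n"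
        using r unfolding n_def by (simp add: powr_realpow powr_add mult.commute)
      then have "(r * 2 ^ Suc k) ^ DIM('a) = r powr n * 2 powr (real k * n + n)"
        using r by (simp add: powr_mult powr_powr algebra_simps)
      moreover have "(r * 2 ^ k) powr - b = (r * 2 powr k) powr - b"
        by (simp add: powr_realpow)
      then have "(r * 2 ^ k) powr - b = r powr - b * 2 powr (- k * b)"
        using r by (simp add: powr_mult powr_powr)
      moreover have "2 powr (- k * b) * 2 powr (real k * n + n) = 2 powr n * q ^ k"
      proof -
        have "q ^ k = 2 powr ((n - b) * k)"
          unfolding q_def by (simp add: powr_powr flip: powr_realpow)
        then show ?thesis by (simp add: algebra_simps flip: powr_add)
      qed
      moreover have "r powr - b * r powr n = r powr (n - b)"
        by (simp flip: powr_add)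
      ultimately have "(r * 2 ^ k) powr - b * (V * (r * 2 ^ Suc k) ^ DIM('a)) = V * (r powr - b * r powr n) * (2 powr n * q ^ k)"
        by (smt (verit, best) mult.assoc mult.left_commute)
      then show ?thesis unfolding \<open>r powr - b * r powr n = r powr (n - b)\<close> by (simp only: mult_ac)
    qed
    then have "(\<lambda>k. (r * 2 ^ k) powr - b * (V * (r * 2 ^ Suc k) ^ DIM('a))) =
       (\<lambda>k. (V * 2 powr n * r powr (n - b)) * q ^ k)" by (intro ext)
    moreover have "(\<lambda>k. (V * 2 powr n * r powr (n - b)) * q ^ k) sums
       ((V * 2 powr n * r powr (n - b)) * (1 / (1 - q)))"
      using q by (intro sums_mult geometric_sums) auto
    ultimately show "(\<lambda>k. (r * 2 ^ k) powr - b * (unit_ball_vol (real DIM('a)) * (r * 2 ^ Suc k) ^ DIM('a)))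
       sums (C * r powr (n - b))"
      unfolding C_def V_def by (simp add: mult_ac)
  qed (use r in auto)
  moreover have "C \<ge> 0" unfolding C_def using V q by auto
  ultimately show ?thesis unfolding n_def by blast
qed

subsection \<open>Interior balls of Lipschitz sets\<close>

lemma norm_orthogonal_part_le:
  fixes e h :: "'a::euclidean_space"
  assumes "norm e = 1"
  shows "norm (h - (h \<bullet> e) *\<^sub>R e) \<le> norm h"
proof -
  have ee: "e \<bullet> e = 1" using assms by (simp add: dot_square_norm)
  have "(norm (h - (h \<bullet> e) *\<^sub>R e))\<^sup>2 = (norm h)\<^sup>2 - (h \<bullet> e)\<^sup>2"
    unfolding power2_norm_eq_inner using ee
    by (simp add: inner_diff_left inner_diff_right inner_commute power2_eq_square)
  also have "\<dots> \<le> (norm h)\<^sup>2" by simp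
  finally show ?thesis by (rule power2_le_imp_le) simp
qed

text \<open>Above a point of an epigraph lies the cone of slope \<open>L\<close> in direction \<open>e\<close>, which contains
  a ball of comparable size.\<close>

lemma interior_ball_near_frontier:
  fixes S :: "'a::euclidean_space set"
  assumes lip: "lipschitz_boundary S" and p: "p \<in> frontier S"
  shows "\<exists>c>0. \<exists>R>0. \<forall>x\<in>S \<inter> ball p R. \<forall>r. 0 < r \<longrightarrow> r \<le> R \<longrightarrow>
           (\<exists>z. ball z (c * r) \<subseteq> S \<inter> ball x r)"
proof -
  obtain R e g L where R: "R > 0" and e: "norm e = 1" and g: "L-lipschitz_on {z. z \<bullet> e = 0} g"
    and S: "S \<inter> ball p R = {x \<in> ball p R. g (x - (x \<bullet> e) *\<^sub>R e) < x \<bullet> e}"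
    using lip p unfolding lipschitz_boundary_def by blast
  have L: "0 \<le> L" using g lipschitz_on_nonneg by blast
  \<comment> \<open>The ball is centred at height \<open>r/2\<close> above \<open>x\<close>. A
    displacement of norm below \<open>c * r\<close> raises the graph by at most
    \<open>L * c * r\<close> and lowers the height by at most \<open>c * r\<close>; \<open>c\<close>
    is chosen so that these add up to exactly \<open>r/2\<close>.\<close>
  define c where "c = 1 / (2 * (L + 1))"
  have c: "0 < c" "c \<le> 1/2" "L * c + c = 1/2" unfolding c_def using L by (auto simp: field_simps)
  have ee: "e \<bullet> e = 1" using e by (simp add: dot_square_norm)
  \<comment> \<open>Both \<open>x\<close> within \<open>R/2\<close> of \<open>p\<close> and
    \<open>r \<le> R/2\<close> are imposed so that \<open>ball x r\<close> stays inside
    \<open>ball p R\<close>, where the epigraph description holds.\<close>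
  have "ball (x + (r/2) *\<^sub>R e) (c * r) \<subseteq> S \<inter> ball x r"
    if x: "x \<in> S" "x \<in> ball p (R/2)" and r: "0 < r" "r \<le> R/2" for x r
  proof
    fix y assume y: "y \<in> ball (x + (r/2) *\<^sub>R e) (c * r)"
    define h where "h = y - (x + (r/2) *\<^sub>R e)"
    have h: "norm h < c * r" using y by (simp add: h_def dist_norm norm_minus_commute)
    have y_eq: "y = x + (r/2) *\<^sub>R e + h" by (simp add: h_def)
    have "norm (y - x) \<le> r/2 + norm h"
      using norm_triangle_ineq[of "(r/2) *\<^sub>R e" h] e r by (simp add: y_eq)
    also have "\<dots> < r/2 + c * r" using h by simp
    also have "c * r \<le> 1/2 * r" using c(2) r by (intro mult_right_mono) auto
    then have "r/2 + c * r \<le> r" by simp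
    finally have yx: "y \<in> ball x r" by (simp add: dist_norm norm_minus_commute)
    then have yp: "y \<in> ball p R"
      using x(2) r dist_triangle[of p y x] by (auto simp: dist_commute)
    have he: "\<bar>h \<bullet> e\<bar> \<le> norm h" using Cauchy_Schwarz_ineq2[of h e] e by simp
    have "x \<in> S \<inter> ball p R" using x R by simp
    then have xp: "g (x - (x \<bullet> e) *\<^sub>R e) < x \<bullet> e" unfolding S by simp
    have "dist (g (y - (y \<bullet> e) *\<^sub>R e)) (g (x - (x \<bullet> e) *\<^sub>R e))
        \<le> L * dist (y - (y \<bullet> e) *\<^sub>R e) (x - (x \<bullet> e) *\<^sub>R e)"
      using lipschitz_onD[OF g, of "y - (y \<bullet> e) *\<^sub>R e" "x - (x \<bullet> e) *\<^sub>R e"] ee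
      by (simp add: inner_diff_left)
    also have "(y - (y \<bullet> e) *\<^sub>R e) - (x - (x \<bullet> e) *\<^sub>R e) = h - (h \<bullet> e) *\<^sub>R e"
      using ee by (simp add: y_eq inner_add_left algebra_simps)
    then have "dist (y - (y \<bullet> e) *\<^sub>R e) (x - (x \<bullet> e) *\<^sub>R e) \<le> norm h"
      using norm_orthogonal_part_le[OF e, of h] by (simp add: dist_norm)
    then have "L * dist (y - (y \<bullet> e) *\<^sub>R e) (x - (x \<bullet> e) *\<^sub>R e) \<le> L * (c * r)"
      using h L by (intro mult_left_mono) auto
    finally have "g (y - (y \<bullet> e) *\<^sub>R e) < x \<bullet> e + L * c * r"
      using xp by (simp add: dist_real_def)
    moreover have "y \<bullet> e > x \<bullet> e + r/2 - c * r"
      using he h ee by (simp add: y_eq inner_add_left)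
    moreover have "(L * c + c) * r = 1/2 * r" by (simp only: c(3))
    then have "L * c * r = r/2 - c * r" by (simp add: distrib_right)
    ultimately have "g (y - (y \<bullet> e) *\<^sub>R e) < y \<bullet> e" by linarith
    then have "y \<in> S \<inter> ball p R" unfolding S using yp by simp
    then show "y \<in> S \<inter> ball x r" using yx by simp
  qed
  then show ?thesis
    using c(1) R by (intro exI[of _ c] conjI exI[of _ "R/2"] ) (auto, blast)
qed

text \<open>The constants of \<open>interior_ball_near_frontier\<close> depend on the boundary
  point; compactness of the closure leaves finitely many of them, and their minima serve everywhere.
  Interior points contribute with ratio 1.\<close>

lemma bounded_lipschitz_set_interior_balls:
  fixes S :: "'a::euclidean_space set"
  assumes S: "bounded_lipschitz_set S"
  shows "\<exists>c>0. \<exists>R>0. \<forall>x\<in>S. \<forall>r. 0 < r \<longrightarrow> r \<le> R \<longrightarrow> (\<exists>z. ball z (c * r) \<subseteq> S \<inter> ball x r)"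
proof -
  have bd: "bounded S" "open S" "lipschitz_boundary S"
    using S by (auto simp: bounded_lipschitz_set_def)
  have "\<exists>c>0. \<exists>R>0. \<forall>x\<in>S \<inter> ball p R. \<forall>r. 0 < r \<longrightarrow> r \<le> R \<longrightarrow> (\<exists>z. ball z (c * r) \<subseteq> S \<inter> ball x r)"
    if "p \<in> closure S" for p
  proof (cases "p \<in> S")
    case True
    then obtain R where R: "R > 0" "ball p R \<subseteq> S" using bd(2) openE by blast
    have "ball x (1 * r) \<subseteq> S \<inter> ball x r" if "x \<in> ball p (R/2)" "r \<le> R/2" for x r
    proof -
      have "ball x r \<subseteq> ball p R"
      proof
        fix y assume "y \<in> ball x r"
        then show "y \<in> ball p R" using that dist_triangle[of p y x] by (simp add: dist_commute)
      qed
      then show ?thesis using R by auto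
    qed
    then show ?thesis using R(1)
      by (intro exI[of _ 1] conjI exI[of _ "R/2"] ) (auto, blast)
  next
    case False
    then have "p \<in> frontier S" using that bd(2) by (simp add: frontier_def interior_open)
    then show ?thesis using interior_ball_near_frontier[OF bd(3)] by blast
  qed
  then obtain c R where cR: "\<And>p. p \<in> closure S \<Longrightarrow> 0 < c p \<and> 0 < R p \<and>
      (\<forall>x\<in>S \<inter> ball p (R p). \<forall>r. 0 < r \<longrightarrow> r \<le> R p \<longrightarrow> (\<exists>z. ball z (c p * r) \<subseteq> S \<inter> ball x r))"
    by metis
  have comp: "compact (closure S)" using bd(1) by (simp add: compact_closure)
  have op: "\<And>p. p \<in> closure S \<Longrightarrow> open (ball p (R p))" by simp
  have cover: "closure S \<subseteq> (\<Union>p\<in>closure S. ball p (R p))"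
  proof
    fix p assume "p \<in> closure S"
    then show "p \<in> (\<Union>p\<in>closure S. ball p (R p))" using cR by (intro UN_I[of p]) auto
  qed
  obtain F where F: "F \<subseteq> closure S" "finite F" "closure S \<subseteq> (\<Union>p\<in>F. ball p (R p))"
    by (rule compactE_image[OF comp op cover])
  \<comment> \<open>\<open>insert 1\<close> keeps the minima meaningful when the cover
    \<open>F\<close> is empty, as it can be for empty \<open>S\<close>.\<close>
  define c' where "c' = Min (insert 1 (c ` F))"
  define R' where "R' = Min (insert 1 (R ` F))"
  have "c' > 0" "R' > 0" unfolding c'_def R'_def using F cR by auto
  moreover have "\<exists>z. ball z (c' * r) \<subseteq> S \<inter> ball x r" if x: "x \<in> S" and r: "0 < r" "r \<le> R'" for x r
  proof -
    obtain p where p: "p \<in> F" "x \<in> ball p (R p)" using F(3) x closure_subset by blast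
    have "R' \<le> R p" "c' \<le> c p" unfolding R'_def c'_def using F p by auto
    moreover have "p \<in> closure S" using p F by blast
    ultimately obtain z where "ball z (c p * r) \<subseteq> S \<inter> ball x r"
      using cR[of p] p r x by fastforce
    moreover have "ball z (c' * r) \<subseteq> ball z (c p * r)"
      using \<open>c' \<le> c p\<close> r by (intro subset_ball) simp
    ultimately show ?thesis by blast
  qed
  ultimately show ?thesis by blast
qed

subsection \<open>Mollification inside a set with interior balls\<close>

text \<open>Cauchy-Schwarz for \<open>sqrt \<bar>a\<bar>\<close> and
  \<open>sqrt \<bar>a\<bar> * \<bar>f\<bar>\<close>. For a probability weight this is Jensen's
  inequality; signed weights occur as differences of two such weights.\<close>

lemma weighted_Cauchy_Schwarz:
  fixes a f :: "'a \<Rightarrow> real"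
  assumes [measurable]: "a \<in> borel_measurable M" "f \<in> borel_measurable M"
    and int: "integrable M (\<lambda>x. a x * f x)"
  shows "ennreal ((\<integral>x. a x * f x \<partial>M)\<^sup>2)
     \<le> (\<integral>\<^sup>+x. ennreal \<bar>a x\<bar> \<partial>M) * (\<integral>\<^sup>+x. ennreal (\<bar>a x\<bar> * (f x)\<^sup>2) \<partial>M)"
proof -
  let ?g = "\<lambda>x. ennreal (sqrt \<bar>a x\<bar>)" and ?h = "\<lambda>x. ennreal (sqrt \<bar>a x\<bar> * \<bar>f x\<bar>)"
  have "ennreal \<bar>\<integral>x. a x * f x \<partial>M\<bar> \<le> (\<integral>\<^sup>+x. ennreal (norm (a x * f x)) \<partial>M)"
    using integral_norm_bound_ennreal[OF int] by simp
  also have "\<dots> = (\<integral>\<^sup>+x. ?g x * ?h x \<partial>M)"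
    by (intro nn_integral_cong) (simp add: abs_mult flip: ennreal_mult' mult.assoc)
  finally have "(ennreal \<bar>\<integral>x. a x * f x \<partial>M\<bar>)\<^sup>2 \<le> (\<integral>\<^sup>+x. ?g x * ?h x \<partial>M)\<^sup>2"
    by (rule power_mono) simp
  also have "\<dots> \<le> (\<integral>\<^sup>+x. (?g x)\<^sup>2 \<partial>M) * (\<integral>\<^sup>+x. (?h x)\<^sup>2 \<partial>M)"
    by (rule Cauchy_Schwarz_nn_integral) auto
  also have "\<dots> = (\<integral>\<^sup>+x. ennreal \<bar>a x\<bar> \<partial>M) * (\<integral>\<^sup>+x. ennreal (\<bar>a x\<bar> * (f x)\<^sup>2) \<partial>M)"
    by (simp add: ennreal_power power_mult_distrib)
  finally show ?thesis by (simp add: ennreal_power)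
qed

lemma integrable_of_square_integrable:
  fixes f :: "'a \<Rightarrow> real"
  assumes "finite_measure M" and [measurable]: "f \<in> borel_measurable M"
    and "integrable M (\<lambda>x. (f x)\<^sup>2)"
  shows "integrable M f"
proof -
  interpret finite_measure M by fact
  show ?thesis
  proof (rule Bochner_Integration.integrable_bound)
    show "integrable M (\<lambda>x. 1 + (f x)\<^sup>2)" using assms by auto
    have "\<bar>t\<bar> \<le> 1 + t\<^sup>2" for t :: real
      using zero_le_power2[of "\<bar>t\<bar> - 1/2"] unfolding power2_diff by (simp add: field_simps)
    then show "AE x in M. norm (f x) \<le> norm (1 + (f x)\<^sup>2)" by simp
  qed simp
qed

text \<open>\<open>density\<close> condenses what the interior balls provide; it concerns the radius
  \<open>r/2\<close> because the tent is at least 1/2 there. \<open>V\<close> is a parameter so that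
  the exported constant \<open>tent_mollifier.D\<close> takes only \<open>\<kappa>\<close> and
  \<open>V\<close> as arguments and can be fixed before \<open>r\<close>.\<close>

locale tent_mollifier =
  fixes S :: "'a::euclidean_space set" and r \<kappa> V :: real
  assumes V_def: "V = unit_ball_vol (real DIM('a))" and S_bounded: "bounded S" and S_sets [measurable]: "S \<in> sets lebesgue"
    and r_pos: "0 < r" and \<kappa>_pos: "0 < \<kappa>"
    and density: "\<And>x. x \<in> S \<Longrightarrow> \<kappa> * r ^ DIM('a) \<le> measure lebesgue (S \<inter> ball x (r/2))"
begin

abbreviation "M \<equiv> lebesgue_on S"

sublocale finite_measure M
  by (rule finite_measure_lebesgue_on[OF S_bounded S_sets])

sublocale pair: pair_sigma_finite M M ..

lemma V_nonneg [simp]: "0 \<le> V" by (simp add: V_def)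

definition tent :: "'a \<Rightarrow> 'a \<Rightarrow> real" where "tent x z = max 0 (1 - norm (x - z) / r)"
text \<open>Near the boundary part of the tent falls outside \<open>S\<close>, so its integral
  varies with \<open>x\<close>; dividing by it in \<open>weight\<close> makes averages reproduce
  constants.\<close>

definition mass :: "'a \<Rightarrow> real" where "mass x = (\<integral>z. tent x z \<partial>M)"
definition weight :: "'a \<Rightarrow> 'a \<Rightarrow> real" where "weight x z = tent x z / mass x"
definition mollify :: "('a \<Rightarrow> real) \<Rightarrow> 'a \<Rightarrow> real" where
  "mollify u x = (\<integral>z. weight x z * u z \<partial>M)"

lemma tent_measurable [measurable]: "tent x \<in> borel_measurable M"
  unfolding tent_def by measurable

lemma weight_measurable [measurable]: "weight x \<in> borel_measurable M"
  unfolding weight_def by measurable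

lemma tent_bounds: "0 \<le> tent x z" "tent x z \<le> 1"
  unfolding tent_def using r_pos by auto

lemma tent_eq_0: "r \<le> norm (x - z) \<Longrightarrow> tent x z = 0"
  unfolding tent_def using r_pos by auto

lemma integrable_bounded_times:
  assumes "integrable M f" and [measurable]: "g \<in> borel_measurable M" and "\<And>z. \<bar>g z\<bar> \<le> B"
  shows "integrable M (\<lambda>z. g z * f z :: real)"
proof (rule Bochner_Integration.integrable_bound)
  show "integrable M (\<lambda>z. B * f z)" using assms by simp
  have "\<bar>g z\<bar> * \<bar>f z\<bar> \<le> \<bar>B\<bar> * \<bar>f z\<bar>" for z using assms(3)[of z] by (intro mult_right_mono) auto
  then show "AE z in M. norm (g z * f z) \<le> norm (B * f z)" by (simp add: abs_mult)
qed (use assms in measurable)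

lemma integrable_tent: "integrable M (tent x)"
  using integrable_bounded_times[of "\<lambda>_. 1" "tent x" 1] tent_bounds[of x] by simp

lemma measure_ball_le: "measure lebesgue (S \<inter> ball x t) \<le> V * t ^ DIM('a)" if "0 \<le> t"
proof -
  have "measure lebesgue (S \<inter> ball x t) \<le> measure lebesgue (ball x t)"
    by (rule measure_mono_fmeasurable) (auto simp: S_sets)
  then show ?thesis using content_ball[OF that, of x] by (simp add: V_def)
qed

lemma integrable_indicator_ball: "integrable M (\<lambda>z. indicator (ball x t) z :: real)"
proof (rule integrable_const_bound[where B = 1])
  show "(\<lambda>z. indicator (ball x t) z :: real) \<in> borel_measurable M"
    by (rule measurable_restrict_space1, rule measurable_completion, rule borel_measurable_indicator) simp
qed simp

lemma mass_ge: "\<kappa> * r ^ DIM('a) / 2 \<le> mass x" if "x \<in> S"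
proof -
  have "\<kappa> * r ^ DIM('a) / 2 \<le> measure lebesgue (S \<inter> ball x (r/2)) / 2"
    using density[OF that] by simp
  also have "\<dots> = (\<integral>z. indicator (ball x (r/2)) z / 2 \<partial>M)"
    by (simp add: measure_restrict_space S_sets Int_commute)
  also have "\<dots> \<le> mass x" unfolding mass_def
  proof (rule integral_mono[OF _ integrable_tent])
    show "integrable M (\<lambda>z. indicator (ball x (r/2)) z / 2 :: real)"
      using integrable_indicator_ball by simp
    show "indicator (ball x (r/2)) z / 2 \<le> tent x z" for z
      using r_pos by (auto simp: tent_def dist_norm field_simps split: split_indicator)
  qed
  finally show ?thesis .
qed

lemma mass_pos: "0 < mass x" if "x \<in> S"
proof -
  have "0 < \<kappa> * r ^ DIM('a) / 2" using \<kappa>_pos r_pos by simp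
  then show ?thesis using mass_ge[OF that] by linarith
qed

lemma inverse_mass_le: "1 / mass x \<le> 2 / (\<kappa> * r ^ DIM('a))" if "x \<in> S"
  using mass_ge[OF that] mass_pos[OF that] \<kappa>_pos r_pos by (simp add: field_simps)

lemma tent_diff: "\<bar>tent x z - tent y z\<bar> \<le> norm (x - y) / r"
proof -
  have "\<bar>tent x z - tent y z\<bar> \<le> \<bar>norm (x - z) / r - norm (y - z) / r\<bar>"
    unfolding tent_def by linarith
  also have "\<dots> = \<bar>norm (x - z) - norm (y - z)\<bar> / r"
    using r_pos by (simp add: field_simps)
  also have "\<dots> \<le> norm (x - y) / r"
    using norm_triangle_ineq3[of "x - z" "y - z"] r_pos by (simp add: divide_right_mono)
  finally show ?thesis .
qed

text \<open>Both tents vanish outside the two balls of radius \<open>r\<close>, and they differ by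
  at most \<open>norm (x - y) / r\<close> elsewhere; each ball has volume at most
  \<open>V * r ^ DIM('a)\<close>.\<close>

lemma mass_diff: "\<bar>mass x - mass y\<bar> \<le> 2 * V * r ^ DIM('a) * (norm (x - y) / r)"
proof -
  let ?b = "\<lambda>z. norm (x - y) / r * (indicator (ball x r) z + indicator (ball y r) z)"
  note int = integrable_indicator_ball[of _ r]
  have "\<bar>mass x - mass y\<bar> = \<bar>\<integral>z. tent x z - tent y z \<partial>M\<bar>"
    unfolding mass_def by (simp add: integrable_tent)
  also have "\<dots> \<le> (\<integral>z. \<bar>tent x z - tent y z\<bar> \<partial>M)" by (rule integral_abs_bound)
  also have "\<dots> \<le> (\<integral>z. ?b z \<partial>M)"
  proof (rule integral_mono)
    have "norm (x - y) / r \<le> norm (x - y) * 2 / r" using r_pos by (simp add: divide_right_mono)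
    then show "\<bar>tent x z - tent y z\<bar> \<le> ?b z" for z
      using tent_diff[of x z y] tent_eq_0[of x z] tent_eq_0[of y z] r_pos
      by (auto simp: dist_norm split: split_indicator)
  qed (auto intro!: integrable_abs integrable_tent int Bochner_Integration.integrable_add)
  also have "\<dots> = norm (x - y) / r * (measure lebesgue (S \<inter> ball x r) + measure lebesgue (S \<inter> ball y r))"
    using int by (simp add: measure_restrict_space S_sets Int_commute)
  also have "\<dots> \<le> norm (x - y) / r * (V * r ^ DIM('a) + V * r ^ DIM('a))"
    using measure_ball_le r_pos by (intro mult_left_mono add_mono) auto
  finally show ?thesis by (simp add: algebra_simps)
qed

text \<open>The term \<open>2 / \<kappa>\<close> comes from the variation of the tent over one mass,
  \<open>8 * V / \<kappa>^2\<close> from the variation \<open>2 * V\<close> of the mass over two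
  masses, each inverse mass costing \<open>2 / \<kappa>\<close> up to powers of
  \<open>r\<close>.\<close>

definition D :: real where "D = 2 / \<kappa> + 8 * V / \<kappa>\<^sup>2"

lemma D_nonneg: "0 \<le> D" unfolding D_def using \<kappa>_pos by simp

lemma weight_diff:
  assumes x: "x \<in> S" and y: "y \<in> S"
  shows "\<bar>weight x z - weight y z\<bar> \<le> D * norm (x - y) / r ^ Suc DIM('a)"
proof -
  let ?d = "norm (x - y) / r"
  have mx: "0 < mass x" "0 < mass y" using mass_pos x y by auto
  \<comment> \<open>Quotient rule: first the tents are compared over a common mass, then the
    masses.\<close>
  have "weight x z - weight y z
      = (tent x z - tent y z) * (1 / mass x) + tent y z * (mass y - mass x) * (1 / mass x) * (1 / mass y)"
    unfolding weight_def using mx by (simp add: field_simps)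
  then have "\<bar>weight x z - weight y z\<bar>
      \<le> \<bar>tent x z - tent y z\<bar> * (1 / mass x) + tent y z * \<bar>mass y - mass x\<bar> * (1 / mass x) * (1 / mass y)"
    using abs_triangle_ineq[of "(tent x z - tent y z) * (1 / mass x)"
        "tent y z * (mass y - mass x) * (1 / mass x) * (1 / mass y)"] mx tent_bounds[of y z]
    by (simp add: abs_mult)
  also have "\<dots> \<le> ?d * (2 / (\<kappa> * r ^ DIM('a))) + 1 * (2 * V * r ^ DIM('a) * ?d) * (2 / (\<kappa> * r ^ DIM('a))) * (2 / (\<kappa> * r ^ DIM('a)))"
    using tent_diff[of x z y] mass_diff[of y x] inverse_mass_le[OF x] inverse_mass_le[OF y]
      tent_bounds[of y z] mx r_pos \<kappa>_pos norm_minus_commute[of x y]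
    by (intro add_mono mult_mono) (auto intro!: mult_nonneg_nonneg)
  also have "\<dots> = D * norm (x - y) / r ^ Suc DIM('a)"
    unfolding D_def using r_pos \<kappa>_pos by (simp add: field_simps power2_eq_square)
  finally show ?thesis .
qed

lemma weight_bounds:
  assumes "x \<in> S"
  shows "0 \<le> weight x z" "weight x z \<le> 2 / (\<kappa> * r ^ DIM('a))"
proof -
  show "0 \<le> weight x z" unfolding weight_def using tent_bounds mass_pos[OF assms] by simp
  have "weight x z \<le> 1 / mass x"
    unfolding weight_def using tent_bounds mass_pos[OF assms] by (simp add: divide_right_mono)
  then show "weight x z \<le> 2 / (\<kappa> * r ^ DIM('a))" using inverse_mass_le[OF assms] by linarith
qed

lemma weight_eq_0: "r \<le> norm (x - z) \<Longrightarrow> weight x z = 0"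
  unfolding weight_def by (simp add: tent_eq_0)

lemma integral_weight: "x \<in> S \<Longrightarrow> (\<integral>z. weight x z \<partial>M) = 1"
  unfolding weight_def using mass_pos[of x] by (simp add: mass_def[symmetric])

lemma integrable_weight_times:
  assumes "x \<in> S" "integrable M u"
  shows "integrable M (\<lambda>z. weight x z * u z)"
  using weight_bounds[OF assms(1)] 
  by (intro integrable_bounded_times[OF assms(2), where B = "2 / (\<kappa> * r ^ DIM('a))"]) (auto simp: abs_le_iff intro: order_trans[of _ 0])

lemma integrable_weight: "x \<in> S \<Longrightarrow> integrable M (weight x)"
  using integrable_weight_times[of x "\<lambda>_. 1"] by simp

text \<open>The difference of the weights is already linear in \<open>norm (x - y)\<close>. The
  resulting constant blows up as \<open>r\<close> tends to 0, but only its finiteness at fixed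
  \<open>r\<close> matters.\<close>

lemma mollify_lipschitz:
  assumes u: "integrable M u" and x: "x \<in> S" and y: "y \<in> S"
  shows "\<bar>mollify u x - mollify u y\<bar> \<le> (D / r ^ Suc DIM('a) * (\<integral>z. \<bar>u z\<bar> \<partial>M)) * norm (x - y)"
proof -
  have "\<bar>mollify u x - mollify u y\<bar> = \<bar>\<integral>z. weight x z * u z - weight y z * u z \<partial>M\<bar>"
    unfolding mollify_def using integrable_weight_times u x y by simp
  also have "\<dots> \<le> (\<integral>z. \<bar>weight x z * u z - weight y z * u z\<bar> \<partial>M)" by (rule integral_abs_bound)
  also have "\<dots> \<le> (\<integral>z. (D * norm (x - y) / r ^ Suc DIM('a)) * \<bar>u z\<bar> \<partial>M)"
  proof (rule integral_mono)
    show "\<bar>weight x z * u z - weight y z * u z\<bar> \<le> (D * norm (x - y) / r ^ Suc DIM('a)) * \<bar>u z\<bar>" for z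
      using mult_right_mono[OF weight_diff[OF x y, of z], of "\<bar>u z\<bar>"]
      by (simp add: abs_mult flip: left_diff_distrib)
  qed (use integrable_weight_times u x y in auto)
  finally show ?thesis by (simp add: algebra_simps)
qed

text \<open>The radius is \<open>2 * r\<close> rather than \<open>r\<close>: when
  \<open>norm (x - y) < r\<close>, the averages at \<open>x\<close> and at \<open>y\<close> both see
  only points within \<open>2 * r\<close> of \<open>x\<close>, so the same quantity also bounds
  their difference.\<close>

definition osc :: "('a \<Rightarrow> real) \<Rightarrow> 'a \<Rightarrow> ennreal" where
  "osc u x = (\<integral>\<^sup>+z. (if norm (x - z) < 2 * r then ennreal ((u z - u x)\<^sup>2) else 0) \<partial>M)"

lemma osc_measurable [measurable]:
  assumes [measurable]: "u \<in> borel_measurable M"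
  shows "osc u \<in> borel_measurable M"
  unfolding osc_def by measurable

text \<open>The weights have integral 1, so the error is the average of \<open>u z - u x\<close>.
  Cauchy-Schwarz with that weight, then the sup bound on the weight, leave
  \<open>osc\<close>.\<close>

lemma mollify_error:
  assumes u: "integrable M u" and x: "x \<in> S"
  shows "ennreal ((mollify u x - u x)\<^sup>2) \<le> ennreal (2 / (\<kappa> * r ^ DIM('a))) * osc u x"
proof -
  have [measurable]: "u \<in> borel_measurable M" using u by simp
  have int: "integrable M (\<lambda>z. weight x z * (u z - u x))"
    using u x by (intro integrable_weight_times) auto
  have "(\<integral>z. weight x z * (u z - u x) \<partial>M) = mollify u x - u x"
    unfolding mollify_def using integrable_weight_times[OF x u] integrable_weight[OF x] integral_weight[OF x]
    by (simp add: right_diff_distrib)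
  then have "ennreal ((mollify u x - u x)\<^sup>2)
      \<le> (\<integral>\<^sup>+z. ennreal \<bar>weight x z\<bar> \<partial>M) * (\<integral>\<^sup>+z. ennreal (\<bar>weight x z\<bar> * (u z - u x)\<^sup>2) \<partial>M)"
    using weighted_Cauchy_Schwarz[OF _ _ int] by simp
  also have "(\<integral>\<^sup>+z. ennreal \<bar>weight x z\<bar> \<partial>M) = 1"
    using weight_bounds[OF x] integral_weight[OF x] integrable_weight[OF x]
    by (simp add: nn_integral_eq_integral)
  also have "1 * (\<integral>\<^sup>+z. ennreal (\<bar>weight x z\<bar> * (u z - u x)\<^sup>2) \<partial>M)
      \<le> (\<integral>\<^sup>+z. ennreal (2 / (\<kappa> * r ^ DIM('a))) * (if norm (x - z) < 2 * r then ennreal ((u z - u x)\<^sup>2) else 0) \<partial>M)"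
    unfolding mult_1
  proof (rule nn_integral_mono)
    fix z
    show "ennreal (\<bar>weight x z\<bar> * (u z - u x)\<^sup>2)
       \<le> ennreal (2 / (\<kappa> * r ^ DIM('a))) * (if norm (x - z) < 2 * r then ennreal ((u z - u x)\<^sup>2) else 0)"
      using mult_right_mono[OF weight_bounds(2)[OF x, of z], of "(u z - u x)\<^sup>2"]
        weight_bounds(1)[OF x, of z] weight_eq_0[of x z] r_pos \<kappa>_pos
      by (auto intro!: ennreal_leI simp flip: ennreal_mult)
  qed
  also have "\<dots> = ennreal (2 / (\<kappa> * r ^ DIM('a))) * osc u x"
    unfolding osc_def by (rule nn_integral_cmult) measurable
  finally show ?thesis .
qed

text \<open>Both weights have integral 1, so \<open>u x\<close> may be subtracted from
  \<open>u\<close> inside the difference of averages. The signed weight \<open>?a\<close> is at most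
  \<open>?B\<close> in size and lives on the ball of radius \<open>2 * r\<close>; Cauchy-Schwarz
  thus gives \<open>?B\<close> squared times the volume of that ball.\<close>

lemma mollify_diff:
  assumes u: "integrable M u" and x: "x \<in> S" and y: "y \<in> S" and xy: "norm (x - y) < r"
  shows "ennreal ((mollify u x - mollify u y)\<^sup>2)
     \<le> ennreal (D\<^sup>2 * V * 2 ^ DIM('a) / r ^ (DIM('a) + 2) * (norm (x - y))\<^sup>2) * osc u x"
proof -
  have [measurable]: "u \<in> borel_measurable M" using u by simp
  let ?a = "\<lambda>z. weight x z - weight y z" and ?B = "D * norm (x - y) / r ^ Suc DIM('a)"
  have B: "0 \<le> ?B" using D_nonneg r_pos by simp
  have a: "\<bar>?a z\<bar> \<le> ?B" "2 * r \<le> norm (x - z) \<Longrightarrow> ?a z = 0" for z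
  proof -
    show "\<bar>?a z\<bar> \<le> ?B" by (rule weight_diff[OF x y])
    assume "2 * r \<le> norm (x - z)"
    moreover have "norm (x - z) \<le> norm (x - y) + norm (y - z)"
      using norm_triangle_ineq[of "x - y" "y - z"] by simp
    ultimately show "?a z = 0" using weight_eq_0[of x z] weight_eq_0[of y z] xy r_pos by simp
  qed
  have i: "integrable M (\<lambda>z. weight t z * (u z - u x))" if "t \<in> S" for t
    using u that by (intro integrable_weight_times) auto
  have int: "integrable M (\<lambda>z. ?a z * (u z - u x))"
    using i[OF x] i[OF y] by (simp add: left_diff_distrib)
  have eq: "(\<integral>z. weight t z * (u z - u x) \<partial>M) = mollify u t - u x" if "t \<in> S" for t
    unfolding mollify_def using integrable_weight_times[OF that u] integrable_weight[OF that] integral_weight[OF that]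
    by (simp add: right_diff_distrib)
  have "(\<integral>z. ?a z * (u z - u x) \<partial>M) = mollify u x - mollify u y"
    using eq[OF x] eq[OF y] i[OF x] i[OF y] by (simp add: left_diff_distrib)
  then have "ennreal ((mollify u x - mollify u y)\<^sup>2)
      \<le> (\<integral>\<^sup>+z. ennreal \<bar>?a z\<bar> \<partial>M) * (\<integral>\<^sup>+z. ennreal (\<bar>?a z\<bar> * (u z - u x)\<^sup>2) \<partial>M)"
    using weighted_Cauchy_Schwarz[OF _ _ int] by simp
  also have "(\<integral>\<^sup>+z. ennreal \<bar>?a z\<bar> \<partial>M) \<le> (\<integral>\<^sup>+z. ennreal ?B * indicator (ball x (2 * r)) z \<partial>M)"
    using a by (intro nn_integral_mono) (auto simp: dist_norm split: split_indicator intro!: ennreal_leI)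
  also have "\<dots> \<le> ennreal ?B * emeasure lborel (ball x (2 * r))"
    by (rule emeasure_lebesgue_on_le) (auto simp: S_sets)
  also have "\<dots> = ennreal (?B * (V * (2 * r) ^ DIM('a)))"
    using r_pos B by (subst ennreal_mult) (auto simp: emeasure_ball V_def)
  also have "(\<integral>\<^sup>+z. ennreal (\<bar>?a z\<bar> * (u z - u x)\<^sup>2) \<partial>M)
      \<le> (\<integral>\<^sup>+z. ennreal ?B * (if norm (x - z) < 2 * r then ennreal ((u z - u x)\<^sup>2) else 0) \<partial>M)"
  proof (rule nn_integral_mono)
    fix z
    show "ennreal (\<bar>?a z\<bar> * (u z - u x)\<^sup>2)
       \<le> ennreal ?B * (if norm (x - z) < 2 * r then ennreal ((u z - u x)\<^sup>2) else 0)"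
      using mult_right_mono[OF a(1)[of z], of "(u z - u x)\<^sup>2"] a(2)[of z] B
      by (cases "norm (x - z) < 2 * r") (auto intro!: ennreal_leI simp flip: ennreal_mult)
  qed
  also have "\<dots> = ennreal ?B * osc u x"
    unfolding osc_def by (rule nn_integral_cmult) measurable
  finally have "ennreal ((mollify u x - mollify u y)\<^sup>2)
     \<le> ennreal (?B * (V * (2 * r) ^ DIM('a))) * (ennreal ?B * osc u x)" by (simp add: mult_mono)
  also have "\<dots> = ennreal (?B * (V * (2 * r) ^ DIM('a)) * ?B) * osc u x"
    using B by (subst (2) ennreal_mult'') (simp_all add: mult.assoc)
  also have "?B * (V * (2 * r) ^ DIM('a)) * ?B = D\<^sup>2 * V * 2 ^ DIM('a) / r ^ (DIM('a) + 2) * (norm (x - y))\<^sup>2"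
    using r_pos by (simp add: field_simps power2_eq_square power_mult_distrib)
  finally show ?thesis .
qed

end

section \<open>Energy of the mollification error\<close>

lemma square_diff_le: "((a::real) - b)\<^sup>2 \<le> 2 * a\<^sup>2 + 2 * b\<^sup>2"
  using zero_le_power2[of "a + b"] by (simp add: power2_eq_square algebra_simps)

definition near_energy :: "real \<Rightarrow> real \<Rightarrow> 'a::euclidean_space set \<Rightarrow> ('a \<Rightarrow> real) \<Rightarrow> ennreal" where
  "near_energy e t S u = (\<integral>\<^sup>+x. \<integral>\<^sup>+y.
     (if norm (x - y) < t then ennreal ((u x - u y)\<^sup>2 / norm (x - y) powr e) else 0)
       \<partial>lebesgue_on S \<partial>lebesgue_on S)"

context tent_mollifier
begin

text \<open>At positive distances below \<open>2 * r\<close> the kernel is at least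
  \<open>(2 * r) powr - e\<close>, so inserting it costs one factor
  \<open>(2 * r) powr e\<close>.\<close>

lemma osc_le_near_energy:
  assumes e: "0 \<le> e" and [measurable]: "u \<in> borel_measurable M"
  shows "(\<integral>\<^sup>+x. osc u x \<partial>M) \<le> ennreal ((2 * r) powr e) * near_energy e (2 * r) S u"
proof -
  have pt: "(if norm (x - z) < 2 * r then ennreal ((u z - u x)\<^sup>2) else 0)
     \<le> ennreal ((2 * r) powr e) * (if norm (x - z) < 2 * r then ennreal ((u x - u z)\<^sup>2 / norm (x - z) powr e) else 0)"
    for x z
  proof (cases "norm (x - z) < 2 * r \<and> x \<noteq> z")
    case True
    then have N: "0 < norm (x - z) powr e" "norm (x - z) powr e \<le> (2 * r) powr e"
      using e by (auto intro: powr_mono2)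
    have "(u z - u x)\<^sup>2 = norm (x - z) powr e * ((u x - u z)\<^sup>2 / norm (x - z) powr e)"
      using N by (simp add: power2_commute)
    also have "\<dots> \<le> (2 * r) powr e * ((u x - u z)\<^sup>2 / norm (x - z) powr e)"
      using N by (intro mult_right_mono) auto
    finally show ?thesis using True by (auto intro!: ennreal_leI simp flip: ennreal_mult)
  qed auto
  have "(\<integral>\<^sup>+x. osc u x \<partial>M) \<le> (\<integral>\<^sup>+x. \<integral>\<^sup>+y. ennreal ((2 * r) powr e) *
      (if norm (x - y) < 2 * r then ennreal ((u x - u y)\<^sup>2 / norm (x - y) powr e) else 0) \<partial>M \<partial>M)"
    unfolding osc_def by (intro nn_integral_mono pt)
  also have "\<dots> = (\<integral>\<^sup>+x. ennreal ((2 * r) powr e) * (\<integral>\<^sup>+y.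
      (if norm (x - y) < 2 * r then ennreal ((u x - u y)\<^sup>2 / norm (x - y) powr e) else 0) \<partial>M) \<partial>M)"
    by (intro nn_integral_cong nn_integral_cmult) measurable
  also have "\<dots> = ennreal ((2 * r) powr e) * near_energy e (2 * r) S u"
    unfolding near_energy_def by (intro nn_integral_cmult) measurable
  finally show ?thesis .
qed

lemma mollify_L2_error:
  assumes e: "0 \<le> e" and u: "integrable M u"
  shows "(\<integral>\<^sup>+x. ennreal ((mollify u x - u x)\<^sup>2) \<partial>M)
     \<le> ennreal (2 / \<kappa> * 2 powr e * r powr (e - real DIM('a))) * near_energy e (2 * r) S u"
proof -
  have [measurable]: "u \<in> borel_measurable M" using u by simp
  have "(\<integral>\<^sup>+x. ennreal ((mollify u x - u x)\<^sup>2) \<partial>M) \<le> (\<integral>\<^sup>+x. ennreal (2 / (\<kappa> * r ^ DIM('a))) * osc u x \<partial>M)"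
    using mollify_error[OF u] by (intro nn_integral_mono) simp
  also have "\<dots> = ennreal (2 / (\<kappa> * r ^ DIM('a))) * (\<integral>\<^sup>+x. osc u x \<partial>M)"
    by (rule nn_integral_cmult) measurable
  also have "\<dots> \<le> ennreal (2 / (\<kappa> * r ^ DIM('a))) * (ennreal ((2 * r) powr e) * near_energy e (2 * r) S u)"
    by (intro mult_left_mono osc_le_near_energy e) auto
  also have "\<dots> = ennreal (2 / (\<kappa> * r ^ DIM('a)) * (2 * r) powr e) * near_energy e (2 * r) S u"
    using \<kappa>_pos r_pos by (subst ennreal_mult) (auto simp: mult.assoc)
  also have "2 / (\<kappa> * r ^ DIM('a)) * (2 * r) powr e = 2 / \<kappa> * 2 powr e * r powr (e - real DIM('a))"
    using r_pos by (simp add: powr_mult powr_diff powr_realpow)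
  finally show ?thesis .
qed

text \<open>Pairs are split at distance \<open>r\<close>. For close pairs the differences of
  \<open>mollify u\<close> and of \<open>u\<close> are estimated separately, and the squared
  distance gained from \<open>mollify_diff\<close> lowers the exponent to \<open>e - 2\<close>. For
  distant pairs the difference gives no gain, so the errors at the two points are bounded one by
  one, whence the symmetric sum of \<open>k\<close>.\<close>

lemma energy_mollify_error_pointwise:
  fixes e :: real
  assumes u: "integrable M u" and x: "x \<in> S" and y: "y \<in> S"
  defines "k \<equiv> (\<lambda>x y. osc u x * (ennreal (4 / (\<kappa> * r ^ DIM('a))) * (if norm (x - y) < r then 0 else ennreal (norm (x - y) powr - e))))"
  shows "ennreal (((mollify u x - u x) - (mollify u y - u y))\<^sup>2 / norm (x - y) powr e)
    \<le> osc u x * (ennreal (2 * D\<^sup>2 * V * 2 ^ DIM('a) / r ^ (DIM('a) + 2)) *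
          (if norm (x - y) < r then ennreal (norm (x - y) powr - (e - 2)) else 0))
      + 2 * (if norm (x - y) < 2 * r then ennreal ((u x - u y)\<^sup>2 / norm (x - y) powr e) else 0)
      + (k x y + k y x)"
proof -
  let ?m = "mollify u" and ?N = "norm (x - y)"
  let ?w = "\<lambda>x. ?m x - u x"
  have pw: "a / ?N powr e = ?N powr - e * a" for a by (simp add: powr_minus_divide)
  show ?thesis
  proof (cases "?N < r")
    case True
    define A where "A = D\<^sup>2 * V * 2 ^ DIM('a) / r ^ (DIM('a) + 2)"
    have A: "0 \<le> A" unfolding A_def using r_pos by simp
    have A2: "2 * D\<^sup>2 * V * 2 ^ DIM('a) / r ^ (DIM('a) + 2) = 2 * A" by (simp add: A_def)
    have "(?w x - ?w y)\<^sup>2 \<le> 2 * (?m x - ?m y)\<^sup>2 + 2 * (u x - u y)\<^sup>2"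
      using square_diff_le[of "?m x - ?m y" "u x - u y"] by (simp add: algebra_simps)
    then have "?N powr - e * (?w x - ?w y)\<^sup>2
        \<le> ?N powr - e * (2 * (?m x - ?m y)\<^sup>2 + 2 * (u x - u y)\<^sup>2)"
      by (intro mult_left_mono) auto
    then have "ennreal (?N powr - e * (?w x - ?w y)\<^sup>2)
        \<le> ennreal (2 * ?N powr - e * (?m x - ?m y)\<^sup>2 + 2 * ((u x - u y)\<^sup>2 / ?N powr e))"
      unfolding pw by (intro ennreal_leI) (simp add: algebra_simps)
    also have "\<dots> = ennreal (2 * ?N powr - e) * ennreal ((?m x - ?m y)\<^sup>2)
        + 2 * ennreal ((u x - u y)\<^sup>2 / ?N powr e)"
    proof -
      have "ennreal (2 * p * a + 2 * b) = ennreal (2 * p) * ennreal a + 2 * ennreal b"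
        if "0 \<le> p" "0 \<le> a" "0 \<le> b" for p a b :: real
        using that by (simp add: ennreal_plus ennreal_mult)
      from this[of "?N powr - e" "(?m x - ?m y)\<^sup>2" "(u x - u y)\<^sup>2 / ?N powr e"]
      show ?thesis by (simp only: powr_ge_zero zero_le_power2 divide_nonneg_nonneg simp_thms)
    qed
    finally have L: "ennreal (?N powr - e * (?w x - ?w y)\<^sup>2)
      \<le> ennreal (2 * ?N powr - e) * ennreal ((?m x - ?m y)\<^sup>2) + 2 * ennreal ((u x - u y)\<^sup>2 / ?N powr e)" .
    have h: "ennreal p * (ennreal q * h) = h * ennreal (p * q)" if "0 \<le> p" "0 \<le> q" for p q h
      using that by (simp add: ennreal_mult mult_ac)
    have "ennreal (2 * ?N powr - e) * ennreal ((?m x - ?m y)\<^sup>2)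
        \<le> ennreal (2 * ?N powr - e) * (ennreal (A * ?N\<^sup>2) * osc u x)"
      by (intro mult_left_mono mollify_diff[OF u x y True, folded A_def]) simp
    also have "\<dots> = osc u x * ennreal (2 * ?N powr - e * (A * ?N\<^sup>2))"
      by (rule h) (use A in auto)
    also have "2 * ?N powr - e * (A * ?N\<^sup>2) = 2 * A * ?N powr - (e - 2)"
      by (cases "?N = 0") (auto simp: powr_diff powr_minus field_simps powr_realpow)
    also have "ennreal (2 * A * ?N powr - (e - 2)) = ennreal (2 * A) * ennreal (?N powr - (e - 2))"
      using A by (intro ennreal_mult) auto
    finally have "ennreal (?N powr - e * (?w x - ?w y)\<^sup>2)
        \<le> osc u x * (ennreal (2 * A) * ennreal (?N powr - (e - 2))) + 2 * ennreal ((u x - u y)\<^sup>2 / ?N powr e)"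
      by (intro order_trans[OF L] add_right_mono)
    from add_increasing2[OF zero_le this, of "k x y + k y x"] show ?thesis
      unfolding pw A2 using True r_pos by (simp only: if_True) simp
  next
    case False
    then have N: "0 < ?N" "norm (y - x) = ?N" using r_pos by (auto simp: norm_minus_commute)
    define q where "q = 2 / (\<kappa> * r ^ DIM('a))"
    have q: "0 \<le> q" "4 / (\<kappa> * r ^ DIM('a)) = 2 * q" unfolding q_def using \<kappa>_pos r_pos by auto
    have eq: "ennreal (2 * p) * (ennreal q * h) = h * (ennreal (2 * q) * ennreal p)" if "0 \<le> p" for p h
      using that q(1) by (simp add: ennreal_mult mult_ac)
    have "?N powr - e * (?w x - ?w y)\<^sup>2 \<le> ?N powr - e * (2 * (?w x)\<^sup>2 + 2 * (?w y)\<^sup>2)"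
      by (intro mult_left_mono square_diff_le) auto
    then have "ennreal (?N powr - e * (?w x - ?w y)\<^sup>2)
        \<le> ennreal (2 * ?N powr - e * (?w x)\<^sup>2 + 2 * ?N powr - e * (?w y)\<^sup>2)"
      by (intro ennreal_leI) (simp add: algebra_simps)
    also have "\<dots> = ennreal (2 * ?N powr - e) * ennreal ((?w x)\<^sup>2) + ennreal (2 * ?N powr - e) * ennreal ((?w y)\<^sup>2)"
      by (simp add: ennreal_plus ennreal_mult)
    also have "\<dots> \<le> ennreal (2 * ?N powr - e) * (ennreal q * osc u x)
        + ennreal (2 * ?N powr - e) * (ennreal q * osc u y)"
      by (intro add_mono mult_left_mono mollify_error[folded q_def] u x y) auto
    also have "\<dots> = k x y + k y x"
      unfolding eq[OF powr_ge_zero] k_def q(2) N(2) using False by (simp only: if_False)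
    finally have "ennreal (?N powr - e * (?w x - ?w y)\<^sup>2) \<le> k x y + k y x" .
    then show ?thesis
      unfolding pw by (rule add_increasing[OF zero_le])
  qed
qed

text \<open>With n the dimension, integration in \<open>y\<close> turns the kernels into
  \<open>r^(n - e + 2)\<close> for close and \<open>r^(n - e)\<close> for distant pairs. The
  prefactors \<open>r^(-n - 2)\<close> and \<open>r^(-n)\<close>, together with the factor
  \<open>r^e\<close> of \<open>osc_le_near_energy\<close>, cancel these powers exactly; the final
  constant is free of \<open>r\<close>.\<close>

lemma energy_mollify_error:
  assumes e: "2 \<le> e" and u: "integrable M u"
    and near: "\<And>x. (\<integral>\<^sup>+y. ennreal (norm (x - y) powr - (e - 2)) * indicator (ball x r) y \<partial>M)
        \<le> ennreal (C1 * r powr (real DIM('a) - (e - 2)))"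
    and far: "\<And>x. (\<integral>\<^sup>+y. ennreal (norm (x - y) powr - e) * indicator (- ball x r) y \<partial>M)
        \<le> ennreal (C2 * r powr (real DIM('a) - e))"
    and C: "0 \<le> C1" "0 \<le> C2"
  shows "energy e S (\<lambda>x. mollify u x - u x)
    \<le> ennreal (2 * D\<^sup>2 * V * 2 ^ DIM('a) * C1 * 2 powr e + 2 + 8 * C2 * 2 powr e / \<kappa>) * near_energy e (2 * r) S u"
proof -
  have [measurable]: "u \<in> borel_measurable M" using u by simp
  let ?H = "near_energy e (2 * r) S u"
  let ?\<alpha> = "2 * D\<^sup>2 * V * 2 ^ DIM('a) / r ^ (DIM('a) + 2)" and ?\<beta> = "4 / (\<kappa> * r ^ DIM('a))"
  define A where "A = (\<lambda>x y. osc u x * (ennreal ?\<alpha> * (if norm (x - y) < r then ennreal (norm (x - y) powr - (e - 2)) else 0)))"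
  define B where "B = (\<lambda>x y. if norm (x - y) < 2 * r then ennreal ((u x - u y)\<^sup>2 / norm (x - y) powr e) else 0)"
  define k where "k = (\<lambda>x y. osc u x * (ennreal ?\<beta> * (if norm (x - y) < r then 0 else ennreal (norm (x - y) powr - e))))"
  have \<alpha>: "0 \<le> ?\<alpha>" and \<beta>: "0 \<le> ?\<beta>" using r_pos \<kappa>_pos by auto
  have [measurable]: "case_prod A \<in> borel_measurable (M \<Otimes>\<^sub>M M)" "case_prod k \<in> borel_measurable (M \<Otimes>\<^sub>M M)"
    "case_prod B \<in> borel_measurable (M \<Otimes>\<^sub>M M)"
    unfolding A_def k_def B_def by measurable
  have [measurable]: "A x \<in> borel_measurable M" "k x \<in> borel_measurable M" "B x \<in> borel_measurable M"
     "(\<lambda>y. k y x) \<in> borel_measurable M" for x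
    unfolding A_def k_def B_def by measurable
  have mf [measurable]: "(\<lambda>x. \<integral>\<^sup>+y. A x y \<partial>M) \<in> borel_measurable M" "(\<lambda>x. \<integral>\<^sup>+y. B x y \<partial>M) \<in> borel_measurable M"
    "(\<lambda>x. \<integral>\<^sup>+y. k x y \<partial>M) \<in> borel_measurable M" "(\<lambda>x. \<integral>\<^sup>+y. k y x \<partial>M) \<in> borel_measurable M"
    by measurable
  have osc: "(\<integral>\<^sup>+x. osc u x \<partial>M) \<le> ennreal ((2 * r) powr e) * ?H"
    using e by (intro osc_le_near_energy) auto
  have bound: "(\<integral>\<^sup>+x. (\<integral>\<^sup>+y. osc u x * (ennreal c * g x y) \<partial>M) \<partial>M) \<le> ennreal (c * b * (2 * r) powr e) * ?H"
    if c: "0 \<le> c" "0 \<le> b" and [measurable]: "\<And>x. g x \<in> borel_measurable M"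
      and g: "\<And>x. (\<integral>\<^sup>+y. g x y \<partial>M) \<le> ennreal b" for c b :: real and g
  proof -
    have "(\<integral>\<^sup>+x. (\<integral>\<^sup>+y. osc u x * (ennreal c * g x y) \<partial>M) \<partial>M) = (\<integral>\<^sup>+x. osc u x * (ennreal c * (\<integral>\<^sup>+y. g x y \<partial>M)) \<partial>M)"
      by (simp add: nn_integral_cmult)
    also have "\<dots> \<le> (\<integral>\<^sup>+x. ennreal (c * b) * osc u x \<partial>M)"
    proof (rule nn_integral_mono)
      fix x
      have "osc u x * (ennreal c * (\<integral>\<^sup>+y. g x y \<partial>M)) \<le> osc u x * (ennreal c * ennreal b)"
        by (intro mult_left_mono g) auto
      then show "osc u x * (ennreal c * (\<integral>\<^sup>+y. g x y \<partial>M)) \<le> ennreal (c * b) * osc u x"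
        using c by (simp add: ennreal_mult mult_ac)
    qed
    also have "\<dots> = ennreal (c * b) * (\<integral>\<^sup>+x. osc u x \<partial>M)" by (rule nn_integral_cmult) measurable
    also have "\<dots> \<le> ennreal (c * b) * (ennreal ((2 * r) powr e) * ?H)"
      by (intro mult_left_mono osc) auto
    also have "\<dots> = ennreal (c * b * (2 * r) powr e) * ?H"
      using c by (subst ennreal_mult) (auto simp: mult.assoc)
    finally show ?thesis .
  qed
  have "(\<integral>\<^sup>+x. (\<integral>\<^sup>+y. A x y \<partial>M) \<partial>M) \<le> ennreal (?\<alpha> * (C1 * r powr (real DIM('a) - (e - 2))) * (2 * r) powr e) * ?H"
    unfolding A_def
  proof (rule bound[OF \<alpha>])
    fix x
    show "(\<integral>\<^sup>+y. (if norm (x - y) < r then ennreal (norm (x - y) powr - (e - 2)) else 0) \<partial>M)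
       \<le> ennreal (C1 * r powr (real DIM('a) - (e - 2)))"
      using near[of x] by (rule order_trans[rotated]) (auto intro!: nn_integral_mono simp: dist_norm)
  qed (use C in auto)
  also have "?\<alpha> * (C1 * r powr (real DIM('a) - (e - 2))) * (2 * r) powr e = 2 * D\<^sup>2 * V * 2 ^ DIM('a) * C1 * 2 powr e"
    using r_pos by (simp add: powr_mult powr_diff powr_realpow power_add powr_add field_simps power2_eq_square)
  finally have IA: "(\<integral>\<^sup>+x. (\<integral>\<^sup>+y. A x y \<partial>M) \<partial>M) \<le> ennreal (2 * D\<^sup>2 * V * 2 ^ DIM('a) * C1 * 2 powr e) * ?H" .
  have "(\<integral>\<^sup>+x. (\<integral>\<^sup>+y. k x y \<partial>M) \<partial>M) \<le> ennreal (?\<beta> * (C2 * r powr (real DIM('a) - e)) * (2 * r) powr e) * ?H"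
    unfolding k_def
  proof (rule bound[OF \<beta>])
    fix x
    show "(\<integral>\<^sup>+y. (if norm (x - y) < r then 0 else ennreal (norm (x - y) powr - e)) \<partial>M)
       \<le> ennreal (C2 * r powr (real DIM('a) - e))"
      using far[of x] by (rule order_trans[rotated]) (auto intro!: nn_integral_mono simp: dist_norm)
  qed (use C in auto)
  also have "?\<beta> * (C2 * r powr (real DIM('a) - e)) * (2 * r) powr e = 4 * C2 * 2 powr e / \<kappa>"
    using r_pos by (simp add: powr_mult powr_diff powr_realpow field_simps)
  finally have Ik: "(\<integral>\<^sup>+x. (\<integral>\<^sup>+y. k x y \<partial>M) \<partial>M) \<le> ennreal (4 * C2 * 2 powr e / \<kappa>) * ?H" .
  \<comment> \<open>Exchanging the integrations, the error at \<open>y\<close> costs as much as the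
    error at \<open>x\<close>.\<close>
  have swap: "(\<integral>\<^sup>+x. (\<integral>\<^sup>+y. k y x \<partial>M) \<partial>M) = (\<integral>\<^sup>+x. (\<integral>\<^sup>+y. k x y \<partial>M) \<partial>M)"
    by (rule pair.Fubini') measurable
  have "energy e S (\<lambda>x. mollify u x - u x)
      \<le> (\<integral>\<^sup>+x. (\<integral>\<^sup>+y. A x y + 2 * B x y + (k x y + k y x) \<partial>M) \<partial>M)"
    unfolding energy_def
    by (intro nn_integral_mono)
      (use energy_mollify_error_pointwise[OF u] in \<open>auto simp: A_def B_def k_def space_restrict_space\<close>)
  also have "\<dots> = (\<integral>\<^sup>+x. (\<integral>\<^sup>+y. A x y \<partial>M) \<partial>M) + 2 * (\<integral>\<^sup>+x. (\<integral>\<^sup>+y. B x y \<partial>M) \<partial>M)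
      + ((\<integral>\<^sup>+x. (\<integral>\<^sup>+y. k x y \<partial>M) \<partial>M) + (\<integral>\<^sup>+x. (\<integral>\<^sup>+y. k y x \<partial>M) \<partial>M))"
    by (simp add: nn_integral_add nn_integral_cmult)
  also have "\<dots> \<le> ennreal (2 * D\<^sup>2 * V * 2 ^ DIM('a) * C1 * 2 powr e) * ?H + 2 * ?H
      + (ennreal (4 * C2 * 2 powr e / \<kappa>) * ?H + ennreal (4 * C2 * 2 powr e / \<kappa>) * ?H)"
    unfolding swap using IA Ik by (intro add_mono mult_left_mono) (auto simp: near_energy_def B_def)
  also have "\<dots> = ennreal (2 * D\<^sup>2 * V * 2 ^ DIM('a) * C1 * 2 powr e + 2 + 8 * C2 * 2 powr e / \<kappa>) * ?H"
  proof -
    have h: "ennreal a * h + 2 * h + (ennreal b * h + ennreal b * h) = ennreal (a + 2 + 2 * b) * h"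
      if "0 \<le> a" "0 \<le> b" for a b and h
    proof -
      have "ennreal (a + 2 + 2 * b) = ennreal (a + 2 + (b + b))" by simp
      also have "\<dots> = ennreal a + 2 + (ennreal b + ennreal b)"
        using that by (simp only: ennreal_plus add_nonneg_nonneg zero_le_numeral ennreal_numeral)
      finally show ?thesis by (simp only: distrib_right)
    qed
    have eq8: "8 * C2 * 2 powr e / \<kappa> = 2 * (4 * C2 * 2 powr e / \<kappa>)" by simp
    show ?thesis unfolding eq8 by (rule h) (use C \<kappa>_pos in auto)
  qed
  finally show ?thesis .
qed

end

subsection \<open>Density of Lipschitz functions\<close>

lemma eventually_inverse_Suc_less: "0 < a \<Longrightarrow> \<forall>\<^sub>F k in sequentially. 1 / real (Suc k) < a"
  using order_tendstoD(2)[OF LIMSEQ_inverse_real_of_nat, of a] by (simp only: inverse_eq_divide)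

text \<open>Dominated convergence with the full energy density as majorant: off the diagonal the
  truncated density is eventually 0, and on the diagonal the density itself is 0.\<close>

lemma near_energy_tendsto_0:
  fixes u :: "'a::euclidean_space \<Rightarrow> real"
  assumes S: "bounded S" "S \<in> sets lebesgue" and [measurable]: "u \<in> borel_measurable (lebesgue_on S)"
    and fin: "energy e S u < \<infinity>"
  shows "(\<lambda>k. near_energy e (1 / real (Suc k)) S u) \<longlonglongrightarrow> 0"
proof -
  let ?M = "lebesgue_on S"
  interpret finite_measure ?M by (rule finite_measure_lebesgue_on[OF S])
  define q where "q p = ennreal ((u (fst p) - u (snd p))\<^sup>2 / norm (fst p - snd p) powr e)" for p
  define g where "g k p = (if norm (fst p - snd p) < 1 / real (Suc k) then q p else 0)" for k p
  have [measurable]: "q \<in> borel_measurable (?M \<Otimes>\<^sub>M ?M)" unfolding q_def by measurable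
  have [measurable]: "g k \<in> borel_measurable (?M \<Otimes>\<^sub>M ?M)" for k unfolding g_def by measurable
  have "(\<lambda>k. \<integral>\<^sup>+p. g k p \<partial>(?M \<Otimes>\<^sub>M ?M)) \<longlonglongrightarrow> (\<integral>\<^sup>+p. 0 \<partial>(?M \<Otimes>\<^sub>M ?M))"
  proof (rule nn_integral_dominated_convergence[where w = q])
    show "AE p in ?M \<Otimes>\<^sub>M ?M. g k p \<le> q p" for k by (simp add: g_def)
    have "(\<integral>\<^sup>+p. q p \<partial>(?M \<Otimes>\<^sub>M ?M)) = energy e S u"
      by (subst nn_integral_fst[symmetric]) (auto simp: energy_def q_def)
    then show "(\<integral>\<^sup>+p. q p \<partial>(?M \<Otimes>\<^sub>M ?M)) < \<infinity>" using fin by simp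
    have "(\<lambda>k. g k p) \<longlonglongrightarrow> 0" for p
    proof (cases "norm (fst p - snd p) = 0")
      case True
      then show ?thesis by (simp add: g_def q_def)
    next
      case False
      have "\<forall>\<^sub>F k in sequentially. 1 / real (Suc k) < norm (fst p - snd p)"
        using False by (intro eventually_inverse_Suc_less) simp
      then have "\<forall>\<^sub>F k in sequentially. g k p = 0"
        by eventually_elim (simp add: g_def)
      then show ?thesis by (rule tendsto_eventually)
    qed
    then show "AE p in ?M \<Otimes>\<^sub>M ?M. (\<lambda>k. g k p) \<longlonglongrightarrow> 0" by simp
  qed simp_all
  moreover have "(\<integral>\<^sup>+p. g k p \<partial>(?M \<Otimes>\<^sub>M ?M)) = near_energy e (1 / real (Suc k)) S u" for k
  proof -
    have "(\<integral>\<^sup>+p. g k p \<partial>(?M \<Otimes>\<^sub>M ?M)) = (\<integral>\<^sup>+x. \<integral>\<^sup>+y. g k (x, y) \<partial>?M \<partial>?M)"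
      by (rule nn_integral_fst[symmetric]) measurable
    then show ?thesis unfolding near_energy_def g_def q_def fst_conv snd_conv .
  qed
  ultimately show ?thesis by simp
qed

text \<open>The two bounds on \<open>e\<close> by the dimension are those of
  \<open>integral_powr_far\<close> and \<open>integral_powr_near\<close>. As \<open>K1\<close> and
  \<open>K2\<close> do not involve the radius, it is chosen last, according to the energy of close
  pairs.\<close>

lemma lipschitz_dense_energy:
  fixes u :: "'a::euclidean_space \<Rightarrow> real"
  assumes S: "bounded_lipschitz_set S" and u: "u \<in> L2_space S" and fin: "energy e S u < \<infinity>"
    and e: "2 \<le> e" "real DIM('a) < e" "e < real DIM('a) + 2" and \<eta>: "0 < \<eta>"
  shows "\<exists>w L. L-lipschitz_on S w \<and> energy e S (\<lambda>x. w x - u x) \<le> ennreal \<eta> \<and>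
     (\<integral>\<^sup>+x. ennreal ((w x - u x)\<^sup>2) \<partial>lebesgue_on S) \<le> ennreal \<eta>"
proof -
  have bd: "bounded S" "open S" using S by (auto simp: bounded_lipschitz_set_def)
  then have Ss: "S \<in> sets lebesgue" by simp
  have [measurable]: "u \<in> borel_measurable (lebesgue_on S)" using u by (simp add: L2_space_def)
  have u2: "integrable (lebesgue_on S) (\<lambda>x. (u x)\<^sup>2)" using u by (simp add: L2_space_def)
  have ui: "integrable (lebesgue_on S) u"
    by (rule integrable_of_square_integrable[OF finite_measure_lebesgue_on[OF bd(1) Ss] _ u2]) measurable
  obtain c R where c: "0 < c" and R: "0 < R"
    and ib: "\<And>x r. x \<in> S \<Longrightarrow> 0 < r \<Longrightarrow> r \<le> R \<Longrightarrow> \<exists>z. ball z (c * r) \<subseteq> S \<inter> ball x r"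
    using bounded_lipschitz_set_interior_balls[OF S] by blast
  define V where "V = unit_ball_vol (real DIM('a))"
  have V: "0 < V" unfolding V_def by simp
  \<comment> \<open>Volume of an interior ball of radius \<open>c * (r/2)\<close>, with the factor
    \<open>r ^ DIM('a)\<close> taken out.\<close>
  define \<kappa> where "\<kappa> = V * (c / 2) ^ DIM('a)"
  have \<kappa>: "0 < \<kappa>" unfolding \<kappa>_def using V c by simp
  have tm: "tent_mollifier S r \<kappa> V" if r: "0 < r" "r / 2 \<le> R" for r
  proof
    show "\<kappa> * r ^ DIM('a) \<le> measure lebesgue (S \<inter> ball x (r/2))" if x: "x \<in> S" for x
    proof -
      obtain z where z: "ball z (c * (r/2)) \<subseteq> S \<inter> ball x (r/2)" using ib[OF x, of "r/2"] r by auto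
      have "\<kappa> * r ^ DIM('a) = measure lebesgue (ball z (c * (r/2)))"
        using content_ball[of "c * (r/2)" z] c r by (simp add: \<kappa>_def V_def power_mult_distrib power_divide)
      also have "\<dots> \<le> measure lebesgue (S \<inter> ball x (r/2))"
        using z bd by (intro measure_mono_fmeasurable)
          (auto intro!: bounded_set_imp_lmeasurable simp del: measure_completion)
      finally show ?thesis .
    qed
  qed (use bd Ss r \<kappa> in \<open>simp_all add: V_def\<close>)
  obtain C1 where C1: "0 \<le> C1" "\<And>x r. 0 < r \<Longrightarrow>
     (\<integral>\<^sup>+y. ennreal (norm (x - y) powr - (e - 2)) * indicator (ball x r) y \<partial>lebesgue_on S)
       \<le> ennreal (C1 * r powr (real DIM('a) - (e - 2)))"
    using integral_powr_near[where 'a = 'a, of "e - 2"] e Ss by auto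
  obtain C2 where C2: "0 \<le> C2" "\<And>x r. 0 < r \<Longrightarrow>
     (\<integral>\<^sup>+y. ennreal (norm (x - y) powr - e) * indicator (- ball x r) y \<partial>lebesgue_on S)
       \<le> ennreal (C2 * r powr (real DIM('a) - e))"
    using integral_powr_far[where 'a = 'a, of e] e Ss by auto
  define K1 where "K1 = 2 * (tent_mollifier.D \<kappa> V)\<^sup>2 * V * 2 ^ DIM('a) * C1 * 2 powr e + 2 + 8 * C2 * 2 powr e / \<kappa>"
  define K2 where "K2 = 2 / \<kappa> * 2 powr e"
  have K1: "0 < K1" unfolding K1_def using V C1(1) C2(1) \<kappa>
    by (intro add_nonneg_pos add_pos_nonneg mult_nonneg_nonneg divide_nonneg_pos) auto
  have K2: "0 < K2" unfolding K2_def using \<kappa> by simp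
  have lim: "(\<lambda>k. near_energy e (1 / real (Suc k)) S u) \<longlonglongrightarrow> 0"
    by (rule near_energy_tendsto_0[OF bd(1) Ss _ fin]) measurable
  have "\<forall>\<^sub>F k in sequentially. near_energy e (1 / real (Suc k)) S u < ennreal (\<eta> / (K1 + K2))"
    using \<eta> K1 K2 by (intro order_tendstoD(2)[OF lim]) simp
  moreover have "\<forall>\<^sub>F k in sequentially. 1 / real (Suc k) < R"
    by (rule eventually_inverse_Suc_less[OF R])
  ultimately have "\<forall>\<^sub>F k in sequentially. near_energy e (1 / real (Suc k)) S u < ennreal (\<eta> / (K1 + K2)) \<and> 1 / real (Suc k) < R"
    by (rule eventually_conj)
  from eventually_happens'[OF sequentially_bot this]
  obtain k where k: "near_energy e (1 / real (Suc k)) S u < ennreal (\<eta> / (K1 + K2))" "1 / real (Suc k) < R"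
    by (elim exE conjE)
  \<comment> \<open>Twice the radius is the threshold \<open>1 / real (Suc k)\<close> below which
    pairs are already known to carry little energy.\<close>
  define r where "r = 1 / real (Suc k) / 2"
  have r: "0 < r" "r / 2 \<le> R" "r \<le> 1" "2 * r = 1 / real (Suc k)"
    using k(2) R by (auto simp: r_def field_simps)
  interpret tent_mollifier S r \<kappa> V by (rule tm) (use r in auto)
  have small: "ennreal K * near_energy e (2 * r) S u \<le> ennreal \<eta>" if K: "0 \<le> K" "K \<le> K1 + K2" for K
  proof -
    have "ennreal K * near_energy e (2 * r) S u \<le> ennreal K * ennreal (\<eta> / (K1 + K2))"
      using k(1) by (intro mult_left_mono) (auto simp: r(4))
    also have "\<dots> = ennreal (K * (\<eta> / (K1 + K2)))" by (rule ennreal_mult[symmetric]) (use K \<eta> K1 K2 in auto)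
    also have "K * (\<eta> / (K1 + K2)) \<le> (K1 + K2) * (\<eta> / (K1 + K2))"
      using K \<eta> K1 K2 by (intro mult_right_mono) auto
    then have "ennreal (K * (\<eta> / (K1 + K2))) \<le> ennreal \<eta>"
      using K1 K2 by (intro ennreal_leI) simp
    finally show ?thesis .
  qed
  have "energy e S (\<lambda>x. mollify u x - u x) \<le> ennreal K1 * near_energy e (2 * r) S u"
    unfolding K1_def by (rule energy_mollify_error) (use e ui C1 C2 r in auto)
  also have "\<dots> \<le> ennreal \<eta>" using K1 K2 by (intro small) auto
  finally have 1: "energy e S (\<lambda>x. mollify u x - u x) \<le> ennreal \<eta>" .
  have "(\<integral>\<^sup>+x. ennreal ((mollify u x - u x)\<^sup>2) \<partial>lebesgue_on S)
      \<le> ennreal (K2 * r powr (e - real DIM('a))) * near_energy e (2 * r) S u"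
    unfolding K2_def by (rule mollify_L2_error) (use e ui in auto)
  also have "\<dots> \<le> ennreal \<eta>"
  proof (rule small)
    have "r powr (e - real DIM('a)) \<le> 1" using r e by (intro powr_le1) auto
    then show "K2 * r powr (e - real DIM('a)) \<le> K1 + K2"
      using mult_left_mono[of "r powr (e - real DIM('a))" 1 K2] K1 K2 by linarith
  qed (use K2 in simp)
  finally have 2: "(\<integral>\<^sup>+x. ennreal ((mollify u x - u x)\<^sup>2) \<partial>lebesgue_on S) \<le> ennreal \<eta>" .
  have "(D / r ^ Suc DIM('a) * (\<integral>z. \<bar>u z\<bar> \<partial>lebesgue_on S))-lipschitz_on S (mollify u)"
    using mollify_lipschitz[OF ui] D_nonneg r(1)
    by (intro lipschitz_onI) (auto simp: dist_norm intro!: mult_nonneg_nonneg divide_nonneg_nonneg)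
  with 1 2 show ?thesis by blast
qed

section \<open>Density of Lipschitz functions in L2\<close>

text \<open>The sup bound \<open>B\<close> is carried through the induction because the Lipschitz
  estimate of a product needs it.\<close>

lemma real_polynomial_function_lipschitz:
  fixes p :: "'a::euclidean_space \<Rightarrow> real"
  assumes "real_polynomial_function p" and S: "bounded S"
  shows "\<exists>L. L-lipschitz_on S p"
proof -
  have "\<exists>L\<ge>0. \<exists>B\<ge>0. \<forall>x\<in>S. \<bar>p x\<bar> \<le> B \<and> (\<forall>y\<in>S. \<bar>p x - p y\<bar> \<le> L * norm (x - y))"
    using assms(1)
  proof (induction p rule: real_polynomial_function.induct)
    case (linear f)
    obtain K where K: "0 \<le> K" "\<And>x. norm (f x) \<le> norm x * K"
      using bounded_linear.nonneg_bounded[OF linear] by blast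
    obtain A where A: "0 < A" "\<And>x. x \<in> S \<Longrightarrow> norm x \<le> A"
      using S unfolding bounded_pos by blast
    have "\<bar>f x\<bar> \<le> A * K" if "x \<in> S" for x
      using K(2)[of x] mult_right_mono[OF A(2)[OF that] K(1)] by simp
    moreover have "\<bar>f x - f y\<bar> \<le> K * norm (x - y)" for x y
      using K(2)[of "x - y"] by (simp add: linear_diff[OF bounded_linear.linear[OF linear]] mult.commute)
    ultimately show ?case using K(1) A(1) by (intro exI[of _ K] conjI exI[of _ "A * K"]) auto
  next
    case (const c)
    then show ?case by (intro exI[of _ 0] conjI exI[of _ "\<bar>c\<bar>"]) auto
  next
    case (add f g)
    obtain L B where f: "0 \<le> L" "0 \<le> B" "\<And>x. x \<in> S \<Longrightarrow> \<bar>f x\<bar> \<le> B"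
      "\<And>x y. x \<in> S \<Longrightarrow> y \<in> S \<Longrightarrow> \<bar>f x - f y\<bar> \<le> L * norm (x - y)"
      using add.IH(1) by auto
    obtain L' B' where g: "0 \<le> L'" "0 \<le> B'" "\<And>x. x \<in> S \<Longrightarrow> \<bar>g x\<bar> \<le> B'"
      "\<And>x y. x \<in> S \<Longrightarrow> y \<in> S \<Longrightarrow> \<bar>g x - g y\<bar> \<le> L' * norm (x - y)"
      using add.IH(2) by auto
    note * = f(1,2) g(1,2) f(3,4) g(3,4)
    have "\<bar>f x + g x\<bar> \<le> B + B'" if "x \<in> S" for x using *(5,7)[OF that] by linarith
    moreover have "\<bar>f x + g x - (f y + g y)\<bar> \<le> (L + L') * norm (x - y)" if "x \<in> S" "y \<in> S" for x y
      unfolding distrib_right using *(6,8)[OF that] by linarith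
    ultimately show ?case using * by (intro exI[of _ "L + L'"] conjI exI[of _ "B + B'"]) auto
  next
    case (mult f g)
    obtain L B where f: "0 \<le> L" "0 \<le> B" "\<And>x. x \<in> S \<Longrightarrow> \<bar>f x\<bar> \<le> B"
      "\<And>x y. x \<in> S \<Longrightarrow> y \<in> S \<Longrightarrow> \<bar>f x - f y\<bar> \<le> L * norm (x - y)"
      using mult.IH(1) by auto
    obtain L' B' where g: "0 \<le> L'" "0 \<le> B'" "\<And>x. x \<in> S \<Longrightarrow> \<bar>g x\<bar> \<le> B'"
      "\<And>x y. x \<in> S \<Longrightarrow> y \<in> S \<Longrightarrow> \<bar>g x - g y\<bar> \<le> L' * norm (x - y)"
      using mult.IH(2) by auto
    note * = f(1,2) g(1,2) f(3,4) g(3,4)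
    have "\<bar>f x * g x\<bar> \<le> B * B'" if "x \<in> S" for x
      unfolding abs_mult using *(5,7)[OF that] *(2) by (intro mult_mono) auto
    moreover have "\<bar>f x * g x - f y * g y\<bar> \<le> (L * B' + B * L') * norm (x - y)" if "x \<in> S" "y \<in> S" for x y
    proof -
      have "\<bar>f x * g x - f y * g y\<bar> = \<bar>(f x - f y) * g x + f y * (g x - g y)\<bar>" by (simp add: algebra_simps)
      also have "\<dots> \<le> \<bar>f x - f y\<bar> * \<bar>g x\<bar> + \<bar>f y\<bar> * \<bar>g x - g y\<bar>"
        by (metis abs_mult abs_triangle_ineq)
      also have "\<dots> \<le> (L * norm (x - y)) * B' + B * (L' * norm (x - y))"
        using *(5)[OF that(2)] *(6)[OF that] *(7)[OF that(1)] *(8)[OF that] *(1-4)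
        by (intro add_mono mult_mono) auto
      finally show ?thesis by (simp add: algebra_simps)
    qed
    ultimately show ?case using *(1-4)
      by (intro exI[of _ "L * B' + B * L'"] conjI exI[of _ "B * B'"]) auto
  qed
  then show ?thesis by (auto simp: lipschitz_on_def dist_norm)
qed

lemma nn_integral_square_sum_le:
  fixes f g :: "'a \<Rightarrow> real"
  assumes [measurable]: "f \<in> borel_measurable M" "g \<in> borel_measurable M"
    and f: "(\<integral>\<^sup>+x. ennreal ((f x)\<^sup>2) \<partial>M) \<le> ennreal a" and g: "(\<integral>\<^sup>+x. ennreal ((g x)\<^sup>2) \<partial>M) \<le> ennreal b"
    and ab: "0 \<le> a" "0 \<le> b"
  shows "(\<integral>\<^sup>+x. ennreal ((f x + g x)\<^sup>2) \<partial>M) \<le> ennreal (2 * a + 2 * b)"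
proof -
  have "(\<integral>\<^sup>+x. ennreal ((f x + g x)\<^sup>2) \<partial>M) \<le> (\<integral>\<^sup>+x. ennreal 2 * ennreal ((f x)\<^sup>2) + ennreal 2 * ennreal ((g x)\<^sup>2) \<partial>M)"
  proof (rule nn_integral_mono)
    fix x
    have "(f x + g x)\<^sup>2 \<le> 2 * (f x)\<^sup>2 + 2 * (g x)\<^sup>2"
      using square_diff_le[of "f x" "- g x"] by simp
    then have "ennreal ((f x + g x)\<^sup>2) \<le> ennreal (2 * (f x)\<^sup>2 + 2 * (g x)\<^sup>2)" by (rule ennreal_leI)
    also have "\<dots> = ennreal 2 * ennreal ((f x)\<^sup>2) + ennreal 2 * ennreal ((g x)\<^sup>2)"
      by (subst ennreal_plus) (simp_all add: ennreal_mult)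
    finally show "ennreal ((f x + g x)\<^sup>2) \<le> ennreal 2 * ennreal ((f x)\<^sup>2) + ennreal 2 * ennreal ((g x)\<^sup>2)" .
  qed
  also have "\<dots> = ennreal 2 * (\<integral>\<^sup>+x. ennreal ((f x)\<^sup>2) \<partial>M) + ennreal 2 * (\<integral>\<^sup>+x. ennreal ((g x)\<^sup>2) \<partial>M)"
    by (subst nn_integral_add) (auto simp: nn_integral_cmult)
  also have "\<dots> \<le> ennreal 2 * ennreal a + ennreal 2 * ennreal b"
    using f g by (intro add_mono mult_left_mono) auto
  also have "\<dots> = ennreal (2 * a + 2 * b)"
    using ab by (subst ennreal_plus) (simp_all add: ennreal_mult)
  finally show ?thesis .
qed

lemma lipschitz_on_measurable:
  fixes w :: "'a::euclidean_space \<Rightarrow> real"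
  assumes "L-lipschitz_on S w" "S \<in> sets lebesgue"
  shows "w \<in> borel_measurable (lebesgue_on S)"
  using continuous_imp_measurable_on_sets_lebesgue lipschitz_on_continuous_on assms by blast

text \<open>Covers the functions of infinite energy, for which approximation in L2 is all that is
  asked. \<open>u\<close> is clipped, the clipped function is approximated by clipped continuous
  ones, and these uniformly by polynomials, which are Lipschitz on bounded sets.\<close>

lemma lipschitz_dense_L2:
  fixes u :: "'a::euclidean_space \<Rightarrow> real"
  assumes S: "bounded S" "S \<in> sets lebesgue" and u: "u \<in> L2_space S" and \<eta>: "0 < \<eta>"
  shows "\<exists>w L. L-lipschitz_on S w \<and> (\<integral>\<^sup>+x. ennreal ((w x - u x)\<^sup>2) \<partial>lebesgue_on S) \<le> ennreal \<eta>"
proof -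
  let ?M = "lebesgue_on S"
  interpret finite_measure ?M by (rule finite_measure_lebesgue_on[OF S])
  have um [measurable]: "u \<in> borel_measurable ?M" and u2: "integrable ?M (\<lambda>x. (u x)\<^sup>2)"
    using u by (auto simp: L2_space_def)
  define m where "m = measure ?M (space ?M)"
  have m: "0 \<le> m" "emeasure ?M (space ?M) = ennreal m" unfolding m_def by (simp_all add: emeasure_eq_measure)
  \<comment> \<open>Clipping to \<open>[-N, N]\<close>. Applied to the continuous approximations as
    well, it supplies the constant majorant \<open>(2 * N)^2\<close>, integrable on a set of finite
    measure.\<close>
  define c where "c N t = max (- N) (min N t)" for N t :: real
  have c_meas [measurable]: "c N \<in> borel_measurable borel" for N unfolding c_def by measurable
  have c_cont: "continuous_on UNIV (c N)" for N unfolding c_def by (intro continuous_intros)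
  have c_diff: "\<bar>c N t - t\<bar> \<le> \<bar>t\<bar>" if "0 \<le> N" for N t using that by (auto simp: c_def)
  have "(\<lambda>k. \<integral>\<^sup>+x. ennreal ((c (real k) (u x) - u x)\<^sup>2) \<partial>?M) \<longlonglongrightarrow> (\<integral>\<^sup>+x. 0 \<partial>?M)"
  proof (rule nn_integral_dominated_convergence[where w = "\<lambda>x. ennreal ((u x)\<^sup>2)"])
    have "(c (real k) (u x) - u x)\<^sup>2 \<le> (u x)\<^sup>2" for k x
      using c_diff[of "real k" "u x"] by (simp add: abs_le_square_iff)
    then show "AE x in ?M. ennreal ((c (real k) (u x) - u x)\<^sup>2) \<le> ennreal ((u x)\<^sup>2)" for k
      by (auto intro: ennreal_leI)
    show "(\<integral>\<^sup>+x. ennreal ((u x)\<^sup>2) \<partial>?M) < \<infinity>"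
      using u2 by (simp add: integrable_iff_bounded)
    have "(\<lambda>k. ennreal ((c (real k) (u x) - u x)\<^sup>2)) \<longlonglongrightarrow> 0" for x
    proof (rule tendsto_eventually)
      obtain n where n: "\<bar>u x\<bar> \<le> real n" using real_arch_simple by blast
      show "\<forall>\<^sub>F k in sequentially. ennreal ((c (real k) (u x) - u x)\<^sup>2) = 0"
        using eventually_ge_at_top[of n]
      proof eventually_elim
        case (elim k)
        then have "\<bar>u x\<bar> \<le> real k" using n by linarith
        then show ?case by (simp add: c_def)
      qed
    qed
    then show "AE x in ?M. (\<lambda>k. ennreal ((c (real k) (u x) - u x)\<^sup>2)) \<longlonglongrightarrow> 0" by simp
  qed measurable
  then have "\<forall>\<^sub>F k in sequentially. (\<integral>\<^sup>+x. ennreal ((c (real k) (u x) - u x)\<^sup>2) \<partial>?M) < ennreal (\<eta> / 8)"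
    using \<eta> by (intro order_tendstoD(2)) auto
  from eventually_happens'[OF sequentially_bot this]
  obtain k where k: "(\<integral>\<^sup>+x. ennreal ((c (real k) (u x) - u x)\<^sup>2) \<partial>?M) < ennreal (\<eta> / 8)" by (elim exE)
  define N where "N = real k"
  have "u measurable_on S" using um S(2) by (simp add: measurable_on_iff_borel_measurable)
  then obtain Z g where Z: "negligible Z" and gc: "\<And>n. continuous_on UNIV (g n)"
    and gl: "\<And>x. x \<notin> Z \<Longrightarrow> (\<lambda>n. g n x) \<longlonglongrightarrow> (if x \<in> S then u x else 0)"
    unfolding measurable_on_def by blast
  have g_meas [measurable]: "g n \<in> borel_measurable ?M" for n
    using gc[of n] S(2) continuous_imp_measurable_on_sets_lebesgue continuous_on_subset by blast
  have "(\<lambda>n. \<integral>\<^sup>+x. ennreal ((c N (g n x) - c N (u x))\<^sup>2) \<partial>?M) \<longlonglongrightarrow> (\<integral>\<^sup>+x. 0 \<partial>?M)"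
  proof (rule nn_integral_dominated_convergence[where w = "\<lambda>x. ennreal ((2 * N)\<^sup>2)"])
    have "\<bar>c N a - c N b\<bar> \<le> \<bar>2 * N\<bar>" for a b unfolding c_def N_def by auto
    then have "(c N a - c N b)\<^sup>2 \<le> (2 * N)\<^sup>2" for a b by (simp add: abs_le_square_iff)
    then show "AE x in ?M. ennreal ((c N (g n x) - c N (u x))\<^sup>2) \<le> ennreal ((2 * N)\<^sup>2)" for n
      by (intro AE_I2 ennreal_leI)
    show "(\<integral>\<^sup>+x. ennreal ((2 * N)\<^sup>2) \<partial>?M) < \<infinity>"
      unfolding nn_integral_const m(2) by (subst ennreal_mult[symmetric]) (use m in auto)
    have "(\<lambda>n. ennreal ((c N (g n x) - c N (u x))\<^sup>2)) \<longlonglongrightarrow> 0" if "x \<in> S" "x \<notin> Z" for x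
    proof -
      have "(\<lambda>n. g n x) \<longlonglongrightarrow> u x" using gl[OF that(2)] that(1) by simp
      moreover have "isCont (c N) (u x)" using c_cont continuous_on_eq_continuous_at by blast
      ultimately have "(\<lambda>n. c N (g n x)) \<longlonglongrightarrow> c N (u x)" by (rule isCont_tendsto_compose[rotated])
      then have "(\<lambda>n. (c N (g n x) - c N (u x))\<^sup>2) \<longlonglongrightarrow> 0"
        by (auto intro!: tendsto_eq_intros)
      then have "(\<lambda>n. ennreal ((c N (g n x) - c N (u x))\<^sup>2)) \<longlonglongrightarrow> ennreal 0" by (rule tendsto_ennrealI)
      then show ?thesis by simp
    qed
    note conv = this
    have "AE x in lebesgue. x \<notin> Z"
      using Z by (simp add: negligible_iff_null_sets AE_not_in)
    then have "AE x in lebesgue. x \<in> S \<longrightarrow> (\<lambda>n. ennreal ((c N (g n x) - c N (u x))\<^sup>2)) \<longlonglongrightarrow> 0"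
      by eventually_elim (use conv in blast)
    moreover have "S \<inter> space lebesgue \<in> sets lebesgue" using S by simp
    ultimately show "AE x in ?M. (\<lambda>n. ennreal ((c N (g n x) - c N (u x))\<^sup>2)) \<longlonglongrightarrow> 0"
      by (simp only: AE_restrict_space_iff)
  qed measurable
  then have "\<forall>\<^sub>F n in sequentially. (\<integral>\<^sup>+x. ennreal ((c N (g n x) - c N (u x))\<^sup>2) \<partial>?M) < ennreal (\<eta> / 16)"
    using \<eta> by (intro order_tendstoD(2)) auto
  from eventually_happens'[OF sequentially_bot this]
  obtain n where n: "(\<integral>\<^sup>+x. ennreal ((c N (g n x) - c N (u x))\<^sup>2) \<partial>?M) < ennreal (\<eta> / 16)" by (elim exE)
  \<comment> \<open>A uniform error \<open>\<delta>\<close> costs \<open>\<delta>^2 * m\<close>, at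
    most \<open>\<eta> / 16\<close>, in the squared norm; \<open>m + 1\<close> guards against
    measure zero.\<close>
  define \<delta> where "\<delta> = sqrt (\<eta> / (16 * (m + 1)))"
  have \<delta>: "0 < \<delta>" unfolding \<delta>_def using \<eta> m by simp
  have "continuous_on (closure S) (\<lambda>x. c N (g n x))"
    using continuous_on_compose2[OF c_cont gc[of n]] continuous_on_subset by blast
  then obtain p where p: "real_polynomial_function p" "\<And>x. x \<in> closure S \<Longrightarrow> \<bar>c N (g n x) - p x\<bar> < \<delta>"
    using Stone_Weierstrass_real_polynomial_function[of "closure S" "\<lambda>x. c N (g n x)" \<delta>] S(1) \<delta>
    by (auto simp: compact_closure)
  obtain L where L: "L-lipschitz_on S p" using real_polynomial_function_lipschitz[OF p(1) S(1)] by blast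
  have [measurable]: "p \<in> borel_measurable ?M" by (rule lipschitz_on_measurable[OF L S(2)])
  have "(\<integral>\<^sup>+x. ennreal ((p x - c N (g n x))\<^sup>2) \<partial>?M) \<le> (\<integral>\<^sup>+x. ennreal (\<delta>\<^sup>2) \<partial>?M)"
  proof (rule nn_integral_mono)
    fix x assume "x \<in> space ?M"
    then have "x \<in> closure S" using closure_subset by (auto simp: space_restrict_space)
    then have "\<bar>p x - c N (g n x)\<bar> \<le> \<bar>\<delta>\<bar>" using p(2)[of x] \<delta> by simp
    then show "ennreal ((p x - c N (g n x))\<^sup>2) \<le> ennreal (\<delta>\<^sup>2)"
      by (intro ennreal_leI) (simp add: abs_le_square_iff)
  qed
  also have "\<dots> = ennreal (\<delta>\<^sup>2 * m)" unfolding nn_integral_const m(2) by (rule ennreal_mult[symmetric]) (use m in auto)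
  also have "\<dots> \<le> ennreal (\<eta> / 16)"
  proof (rule ennreal_leI)
    have "\<delta>\<^sup>2 * m = \<eta> / 16 * (m / (m + 1))" unfolding \<delta>_def using \<eta> m by simp
    also have "\<dots> \<le> \<eta> / 16 * 1" using \<eta> m by (intro mult_left_mono) auto
    finally show "\<delta>\<^sup>2 * m \<le> \<eta> / 16" by simp
  qed
  finally have p1: "(\<integral>\<^sup>+x. ennreal ((p x - c N (g n x))\<^sup>2) \<partial>?M) \<le> ennreal (\<eta> / 16)" .
  \<comment> \<open>Error budget in units of \<open>\<eta>\<close>:
    \<open>2 * (1/16 + 1/16) = 1/4\<close> for the two inner steps, then
    \<open>2 * (1/4 + 1/8) = 3/4\<close> in all.\<close>
  have p2: "(\<integral>\<^sup>+x. ennreal (((p x - c N (g n x)) + (c N (g n x) - c N (u x)))\<^sup>2) \<partial>?M) \<le> ennreal (2 * (\<eta> / 16) + 2 * (\<eta> / 16))"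
    by (rule nn_integral_square_sum_le) (use p1 n \<eta> in auto)
  have "(\<integral>\<^sup>+x. ennreal ((((p x - c N (g n x)) + (c N (g n x) - c N (u x))) + (c N (u x) - u x))\<^sup>2) \<partial>?M)
      \<le> ennreal (2 * (2 * (\<eta> / 16) + 2 * (\<eta> / 16)) + 2 * (\<eta> / 8))"
    by (rule nn_integral_square_sum_le) (use p2 k \<eta> in \<open>auto simp: N_def\<close>)
  also have "\<dots> \<le> ennreal \<eta>" by (rule ennreal_leI) (use \<eta> in simp)
  finally have "(\<integral>\<^sup>+x. ennreal ((p x - u x)\<^sup>2) \<partial>?M) \<le> ennreal \<eta>"
    by (simp only: diff_add_cancel add_diff_eq)
  with L show ?thesis by blast
qed

text \<open>Young's inequality; the gap between the two sides is \<open>(t * a - b)^2 / t\<close>. A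
  small \<open>t\<close> brings the coefficient of \<open>a\<close> near 1, as the limsup inequality
  demands, whereas \<open>square_diff_le\<close> would lose a factor 2.\<close>

lemma square_sum_le_weighted:
  fixes a b t :: real
  assumes "0 < t"
  shows "(a + b)\<^sup>2 \<le> (1 + t) * a\<^sup>2 + (1 + 1 / t) * b\<^sup>2"
proof -
  have "(1 + t) * a\<^sup>2 + (1 + 1 / t) * b\<^sup>2 - (a + b)\<^sup>2 = (t * a - b)\<^sup>2 / t"
    using assms by (simp add: field_simps power2_eq_square)
  then show ?thesis using assms by (smt (verit) divide_nonneg_pos zero_le_power2)
qed

lemma energy_le_weighted:
  fixes u w :: "'a::euclidean_space \<Rightarrow> real"
  assumes S: "bounded S" "S \<in> sets lebesgue"
    and [measurable]: "u \<in> borel_measurable (lebesgue_on S)" "w \<in> borel_measurable (lebesgue_on S)"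
    and t: "0 < t"
  shows "energy e S w \<le> ennreal (1 + t) * energy e S u + ennreal (1 + 1 / t) * energy e S (\<lambda>x. w x - u x)"
proof -
  let ?M = "lebesgue_on S"
  interpret finite_measure ?M by (rule finite_measure_lebesgue_on[OF S])
  define v where "v x = w x - u x" for x
  have [measurable]: "v \<in> borel_measurable ?M" unfolding v_def by measurable
  have pt: "ennreal ((w x - w y)\<^sup>2 / p) \<le> ennreal (1 + t) * ennreal ((u x - u y)\<^sup>2 / p) + ennreal (1 + 1 / t) * ennreal ((v x - v y)\<^sup>2 / p)"
    if p: "0 \<le> p" for x y p
  proof -
    have "(w x - w y)\<^sup>2 \<le> (1 + t) * (u x - u y)\<^sup>2 + (1 + 1 / t) * (v x - v y)\<^sup>2"
      using square_sum_le_weighted[OF t, of "u x - u y" "v x - v y"] by (simp add: v_def)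
    then have "(w x - w y)\<^sup>2 / p \<le> ((1 + t) * (u x - u y)\<^sup>2 + (1 + 1 / t) * (v x - v y)\<^sup>2) / p"
      using p by (rule divide_right_mono)
    also have "\<dots> = (1 + t) * ((u x - u y)\<^sup>2 / p) + (1 + 1 / t) * ((v x - v y)\<^sup>2 / p)"
      by (simp only: add_divide_distrib times_divide_eq_right)
    finally have "ennreal ((w x - w y)\<^sup>2 / p) \<le> ennreal ((1 + t) * ((u x - u y)\<^sup>2 / p) + (1 + 1 / t) * ((v x - v y)\<^sup>2 / p))"
      by (rule ennreal_leI)
    also have "\<dots> = ennreal (1 + t) * ennreal ((u x - u y)\<^sup>2 / p) + ennreal (1 + 1 / t) * ennreal ((v x - v y)\<^sup>2 / p)"
    proof -
      have "ennreal (\<alpha> * a + \<beta> * b) = ennreal \<alpha> * ennreal a + ennreal \<beta> * ennreal b"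
        if "0 \<le> \<alpha>" "0 \<le> \<beta>" "0 \<le> a" "0 \<le> b" for \<alpha> \<beta> a b
        using that by (simp add: ennreal_plus ennreal_mult)
      from this[of "1 + t" "1 + 1 / t" "(u x - u y)\<^sup>2 / p" "(v x - v y)\<^sup>2 / p"]
      show ?thesis using p t by (auto simp del: ennreal_plus)
    qed
    finally show ?thesis .
  qed
  have "energy e S w \<le> (\<integral>\<^sup>+x. \<integral>\<^sup>+y. ennreal (1 + t) * ennreal ((u x - u y)\<^sup>2 / norm (x - y) powr e)
      + ennreal (1 + 1 / t) * ennreal ((v x - v y)\<^sup>2 / norm (x - y) powr e) \<partial>?M \<partial>?M)"
    unfolding energy_def by (intro nn_integral_mono pt) simp
  also have "\<dots> = ennreal (1 + t) * energy e S u + ennreal (1 + 1 / t) * energy e S v"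
    unfolding energy_def by (simp add: nn_integral_add nn_integral_cmult)
  finally show ?thesis unfolding v_def .
qed

section \<open>Energies of Lipschitz functions and their dependence on the exponent\<close>

text \<open>One majorant for all exponents up to \<open>e1\<close>, as dominated convergence in the
  exponent requires: the Lipschitz bound leaves the power \<open>2 - e\<close> of the distance,
  which is at most the power \<open>2 - e1\<close> for distances up to 1 and at most 1 beyond.
  Integrability comes from \<open>e1 < real DIM('a) + 2\<close>.\<close>

lemma lipschitz_energy_dominated:
  fixes w :: "'a::euclidean_space \<Rightarrow> real"
  assumes S: "bounded S" "S \<in> sets lebesgue" and w: "L-lipschitz_on S w"
    and e1: "2 \<le> e1" "e1 < real DIM('a) + 2"
  shows "\<exists>g\<in>borel_measurable (lebesgue_on S \<Otimes>\<^sub>M lebesgue_on S).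
    (\<integral>\<^sup>+p. g p \<partial>(lebesgue_on S \<Otimes>\<^sub>M lebesgue_on S)) < \<infinity> \<and>
    (\<forall>e\<in>{2..e1}. \<forall>x\<in>S. \<forall>y\<in>S. ennreal ((w x - w y)\<^sup>2 / norm (x - y) powr e) \<le> g (x, y))"
proof -
  let ?M = "lebesgue_on S"
  interpret finite_measure ?M by (rule finite_measure_lebesgue_on[OF S])
  define h where "h x y = ennreal (norm (x - y) powr - (e1 - 2))" for x y :: 'a
  define g where "g p = ennreal (L\<^sup>2) * (h (fst p) (snd p) + 1)" for p
  have [measurable]: "g \<in> borel_measurable (?M \<Otimes>\<^sub>M ?M)" unfolding g_def h_def by measurable
  have [measurable]: "h x \<in> borel_measurable ?M" for x unfolding h_def by measurable
  obtain B where B: "0 < B" "\<And>x. x \<in> S \<Longrightarrow> norm x \<le> B" using S(1) unfolding bounded_pos by blast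
  obtain C where C: "0 \<le> C" "\<And>x r. 0 < r \<Longrightarrow>
     (\<integral>\<^sup>+y. ennreal (norm (x - y) powr - (e1 - 2)) * indicator (ball x r) y \<partial>?M)
       \<le> ennreal (C * r powr (real DIM('a) - (e1 - 2)))"
    using integral_powr_near[where 'a = 'a, of "e1 - 2"] e1 S(2) by auto
  \<comment> \<open>Exceeds the distance between any two points of \<open>S\<close>, so the ball of
    radius \<open>R\<close> about a point of \<open>S\<close> contains all of
    \<open>S\<close>.\<close>
  define R where "R = 2 * B + 1"
  define K where "K = C * R powr (real DIM('a) - (e1 - 2))"
  have "(\<integral>\<^sup>+y. h x y \<partial>?M) \<le> ennreal K" if "x \<in> S" for x
  proof -
    have "(\<integral>\<^sup>+y. h x y \<partial>?M) \<le> (\<integral>\<^sup>+y. ennreal (norm (x - y) powr - (e1 - 2)) * indicator (ball x R) y \<partial>?M)"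
    proof (rule nn_integral_mono)
      fix y assume "y \<in> space ?M"
      then have "norm (x - y) < R"
        using B(2)[OF that] B(2)[of y] norm_triangle_ineq4[of x y] by (simp add: R_def space_restrict_space)
      then show "h x y \<le> ennreal (norm (x - y) powr - (e1 - 2)) * indicator (ball x R) y"
        by (simp add: h_def dist_norm)
    qed
    also have "\<dots> \<le> ennreal K" unfolding K_def using B(1) by (intro C(2)) (simp add: R_def)
    finally show ?thesis .
  qed
  note hK = this
  have "(\<integral>\<^sup>+p. g p \<partial>(?M \<Otimes>\<^sub>M ?M)) = (\<integral>\<^sup>+x. \<integral>\<^sup>+y. g (x, y) \<partial>?M \<partial>?M)"
    by (rule nn_integral_fst[symmetric]) measurable
  also have "\<dots> \<le> (\<integral>\<^sup>+x. ennreal (L\<^sup>2) * (ennreal K + emeasure ?M (space ?M)) \<partial>?M)"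
  proof (rule nn_integral_mono)
    fix x assume "x \<in> space ?M"
    then have "x \<in> S" by (simp add: space_restrict_space)
    have "(\<integral>\<^sup>+y. g (x, y) \<partial>?M) = ennreal (L\<^sup>2) * ((\<integral>\<^sup>+y. h x y \<partial>?M) + emeasure ?M (space ?M))"
      unfolding g_def fst_conv snd_conv by (simp add: nn_integral_cmult nn_integral_add)
    also have "\<dots> \<le> ennreal (L\<^sup>2) * (ennreal K + emeasure ?M (space ?M))"
      by (intro mult_left_mono add_right_mono hK \<open>x \<in> S\<close>) simp
    finally show "(\<integral>\<^sup>+y. g (x, y) \<partial>?M) \<le> ennreal (L\<^sup>2) * (ennreal K + emeasure ?M (space ?M))" .
  qed
  also have "\<dots> < \<infinity>"
    by (simp add: emeasure_eq_measure ennreal_mult_less_top)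
  finally have fin: "(\<integral>\<^sup>+p. g p \<partial>(?M \<Otimes>\<^sub>M ?M)) < \<infinity>" .
  have "ennreal ((w x - w y)\<^sup>2 / norm (x - y) powr e) \<le> g (x, y)"
    if e: "e \<in> {2..e1}" and xy: "x \<in> S" "y \<in> S" for e x y
  proof (cases "x = y")
    case False
    define N where "N = norm (x - y)"
    have N: "0 < N" using False by (simp add: N_def)
    have "\<bar>w x - w y\<bar> \<le> L * N" using lipschitz_onD[OF w xy] by (simp add: N_def dist_norm)
    then have "\<bar>w x - w y\<bar> \<le> \<bar>L * N\<bar>" by linarith
    then have "(w x - w y)\<^sup>2 \<le> L\<^sup>2 * N\<^sup>2" by (simp add: abs_le_square_iff power_mult_distrib)
    then have "(w x - w y)\<^sup>2 / N powr e \<le> L\<^sup>2 * N\<^sup>2 / N powr e" by (rule divide_right_mono) simp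
    also have "\<dots> = L\<^sup>2 * N powr - (e - 2)"
      using N by (simp add: powr_minus_divide powr_diff powr_realpow)
    also have "N powr - (e - 2) \<le> N powr - (e1 - 2) + 1"
    proof (cases "N \<le> 1")
      case True
      then have "N powr - (e - 2) \<le> N powr - (e1 - 2)" using e N by (intro powr_mono') auto
      then show ?thesis by simp
    next
      case False
      then have "N powr - (e - 2) \<le> N powr 0" using e by (intro powr_mono) auto
      also have "N powr 0 = 1" using N by simp
      finally show ?thesis using powr_ge_zero[of N "- (e1 - 2)"] by linarith
    qed
    then have "L\<^sup>2 * N powr - (e - 2) \<le> L\<^sup>2 * (N powr - (e1 - 2) + 1)" by (rule mult_left_mono) simp
    finally have "ennreal ((w x - w y)\<^sup>2 / N powr e) \<le> ennreal (L\<^sup>2 * (N powr - (e1 - 2) + 1))" by (rule ennreal_leI)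
    also have "\<dots> = ennreal (L\<^sup>2) * (ennreal (N powr - (e1 - 2)) + ennreal 1)"
      by (subst ennreal_mult, simp, simp, subst ennreal_plus) simp_all
    finally show ?thesis unfolding g_def h_def N_def by simp
  qed simp
  with fin show ?thesis by (intro bexI[of _ g]) auto
qed

lemma energy_pair:
  fixes u :: "'a::euclidean_space \<Rightarrow> real"
  assumes S: "bounded S" "S \<in> sets lebesgue" and [measurable]: "u \<in> borel_measurable (lebesgue_on S)"
  shows "energy e S u = (\<integral>\<^sup>+p. ennreal ((u (fst p) - u (snd p))\<^sup>2 / norm (fst p - snd p) powr e)
            \<partial>(lebesgue_on S \<Otimes>\<^sub>M lebesgue_on S))"
proof -
  interpret finite_measure "lebesgue_on S" by (rule finite_measure_lebesgue_on[OF S])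
  have "(\<integral>\<^sup>+p. ennreal ((u (fst p) - u (snd p))\<^sup>2 / norm (fst p - snd p) powr e)
            \<partial>(lebesgue_on S \<Otimes>\<^sub>M lebesgue_on S)) =
     (\<integral>\<^sup>+x. \<integral>\<^sup>+y. ennreal ((u (fst (x, y)) - u (snd (x, y)))\<^sup>2 / norm (fst (x, y) - snd (x, y)) powr e)
       \<partial>lebesgue_on S \<partial>lebesgue_on S)"
    by (rule nn_integral_fst[symmetric]) measurable
  then show ?thesis unfolding energy_def fst_conv snd_conv by (rule sym)
qed

lemma energy_lipschitz_finite:
  fixes w :: "'a::euclidean_space \<Rightarrow> real"
  assumes S: "bounded S" "S \<in> sets lebesgue" and w: "L-lipschitz_on S w"
    and e: "2 \<le> e" "e < real DIM('a) + 2"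
  shows "energy e S w < \<infinity>"
proof -
  let ?M = "lebesgue_on S"
  interpret finite_measure ?M by (rule finite_measure_lebesgue_on[OF S])
  obtain g where g: "g \<in> borel_measurable (?M \<Otimes>\<^sub>M ?M)" "(\<integral>\<^sup>+p. g p \<partial>(?M \<Otimes>\<^sub>M ?M)) < \<infinity>"
     "\<And>e' x y. e' \<in> {2..e} \<Longrightarrow> x \<in> S \<Longrightarrow> y \<in> S \<Longrightarrow> ennreal ((w x - w y)\<^sup>2 / norm (x - y) powr e') \<le> g (x, y)"
    using lipschitz_energy_dominated[OF S w e] by blast
  have "energy e S w \<le> (\<integral>\<^sup>+p. g p \<partial>(?M \<Otimes>\<^sub>M ?M))"
    unfolding energy_pair[OF S lipschitz_on_measurable[OF w S(2)]]
    by (intro nn_integral_mono) (use e g(3)[of e] in \<open>auto simp: space_pair_measure space_restrict_space\<close>)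
  with g(2) show ?thesis by (rule order.strict_trans1[rotated])
qed

lemma energy_lipschitz_continuous_on:
  fixes w :: "'a::euclidean_space \<Rightarrow> real"
  assumes S: "bounded S" "S \<in> sets lebesgue" and w: "L-lipschitz_on S w"
    and e1: "2 \<le> e1" "e1 < real DIM('a) + 2"
  shows "continuous_on {2..e1} (\<lambda>e. energy e S w)"
proof -
  let ?M = "lebesgue_on S"
  interpret finite_measure ?M by (rule finite_measure_lebesgue_on[OF S])
  have wm [measurable]: "w \<in> borel_measurable ?M" by (rule lipschitz_on_measurable[OF w S(2)])
  obtain g where g [measurable]: "g \<in> borel_measurable (?M \<Otimes>\<^sub>M ?M)" and gi: "(\<integral>\<^sup>+p. g p \<partial>(?M \<Otimes>\<^sub>M ?M)) < \<infinity>"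
     and gb: "\<And>e' x y. e' \<in> {2..e1} \<Longrightarrow> x \<in> S \<Longrightarrow> y \<in> S \<Longrightarrow> ennreal ((w x - w y)\<^sup>2 / norm (x - y) powr e') \<le> g (x, y)"
    using lipschitz_energy_dominated[OF S w e1] by blast
  have "(\<lambda>n. energy (e n) S w) \<longlonglongrightarrow> energy a S w"
    if *: "a \<in> {2..e1}" "\<And>n. e n \<in> {2..e1}" "e \<longlonglongrightarrow> a" for e a
    unfolding energy_pair[OF S wm]
  proof (rule nn_integral_dominated_convergence[where w = g])
    show "AE p in ?M \<Otimes>\<^sub>M ?M. ennreal ((w (fst p) - w (snd p))\<^sup>2 / norm (fst p - snd p) powr e j) \<le> g p" for j
      using gb[OF *(2)] by (intro AE_I2) (auto simp: space_pair_measure space_restrict_space)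
    have "(\<lambda>i. ennreal ((w (fst p) - w (snd p))\<^sup>2 / norm (fst p - snd p) powr e i))
        \<longlonglongrightarrow> ennreal ((w (fst p) - w (snd p))\<^sup>2 / norm (fst p - snd p) powr a)" for p
    proof (cases "fst p = snd p")
      case False
      then have "norm (fst p - snd p) \<noteq> 0" by simp
      then show ?thesis using *(3)
        by (intro tendsto_ennrealI tendsto_divide tendsto_powr tendsto_const) auto
    qed simp
    then show "AE p in ?M \<Otimes>\<^sub>M ?M. (\<lambda>i. ennreal ((w (fst p) - w (snd p))\<^sup>2 / norm (fst p - snd p) powr e i))
        \<longlonglongrightarrow> ennreal ((w (fst p) - w (snd p))\<^sup>2 / norm (fst p - snd p) powr a)"
      by (intro AE_I2)
    show "(\<integral>\<^sup>+p. g p \<partial>(?M \<Otimes>\<^sub>M ?M)) < \<infinity>" by (rule gi)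
  qed measurable
  then show ?thesis unfolding continuous_on_sequentially o_def by blast
qed

text \<open>For infinite energy the last bound is void and density in L2 suffices; for finite
  energy, density in energy is combined with \<open>energy_le_weighted\<close>, whose leading
  constant can be taken close to 1.\<close>

lemma lipschitz_recovery_sequence:
  fixes u :: "'a::euclidean_space \<Rightarrow> real"
  assumes S: "bounded_lipschitz_set S" and u: "u \<in> L2_space S"
    and e: "2 \<le> e" "real DIM('a) < e" "e < real DIM('a) + 2"
  shows "\<exists>w. \<forall>k. (\<exists>L. L-lipschitz_on S (w k)) \<and>
     (\<integral>\<^sup>+x. ennreal ((w k x - u x)\<^sup>2) \<partial>lebesgue_on S) \<le> ennreal (1 / real (Suc k)) \<and>
     energy e S (w k) \<le> energy e S u + ennreal (1 / real (Suc k))"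
proof -
  have bd: "bounded S" "open S" using S by (auto simp: bounded_lipschitz_set_def)
  then have Ss: "S \<in> sets lebesgue" by simp
  have um: "u \<in> borel_measurable (lebesgue_on S)" using u by (simp add: L2_space_def)
  have "\<exists>w. (\<exists>L. L-lipschitz_on S w) \<and> (\<integral>\<^sup>+x. ennreal ((w x - u x)\<^sup>2) \<partial>lebesgue_on S) \<le> ennreal d \<and>
     energy e S w \<le> energy e S u + ennreal d" if d: "0 < d" for d
  proof (cases "energy e S u < \<infinity>")
    case False
    then have inf: "energy e S u = \<infinity>" by (simp add: less_top[symmetric])
    obtain w L where "L-lipschitz_on S w" "(\<integral>\<^sup>+x. ennreal ((w x - u x)\<^sup>2) \<partial>lebesgue_on S) \<le> ennreal d"
      using lipschitz_dense_L2[OF bd(1) Ss u d] by blast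
    then show ?thesis using inf by auto
  next
    case True
    then obtain E where E: "0 \<le> E" "energy e S u = ennreal E" by (cases "energy e S u") auto
    \<comment> \<open>\<open>t\<close> keeps the excess \<open>t * E\<close> of the weighted
      inequality at most \<open>d / 2\<close>, with \<open>E + 1\<close> to allow
      \<open>E = 0\<close>; afterwards \<open>\<eta>\<close> is chosen to keep
      \<open>(1 + 1 / t) * \<eta>\<close> at most \<open>d / 2\<close>.\<close>
    define t where "t = d / (2 * (E + 1))"
    have t: "0 < t" unfolding t_def using d E by simp
    have tE: "t * E \<le> d / 2"
    proof -
      have "t * E = d / 2 * (E / (E + 1))" unfolding t_def by simp
      also have "\<dots> \<le> d / 2 * 1" using E d by (intro mult_left_mono) auto
      finally show ?thesis by simp
    qed
    define \<eta> where "\<eta> = min d (d / (2 * (1 + 1 / t)))"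
    have \<eta>: "0 < \<eta>" unfolding \<eta>_def using d t by (simp add: add_pos_pos)
    obtain w L where w: "L-lipschitz_on S w" and we: "energy e S (\<lambda>x. w x - u x) \<le> ennreal \<eta>"
      and wl: "(\<integral>\<^sup>+x. ennreal ((w x - u x)\<^sup>2) \<partial>lebesgue_on S) \<le> ennreal \<eta>"
      using lipschitz_dense_energy[OF S u True e \<eta>] by blast
    have "energy e S w \<le> ennreal (1 + t) * energy e S u + ennreal (1 + 1 / t) * energy e S (\<lambda>x. w x - u x)"
      by (rule energy_le_weighted[OF bd(1) Ss um lipschitz_on_measurable[OF w Ss] t])
    also have "\<dots> \<le> ennreal (1 + t) * ennreal E + ennreal (1 + 1 / t) * ennreal \<eta>"
      unfolding E(2) by (intro add_left_mono mult_left_mono we) simp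
    also have "\<dots> = ennreal ((1 + t) * E + (1 + 1 / t) * \<eta>)"
    proof -
      have "ennreal (\<alpha> * a + \<beta> * b) = ennreal \<alpha> * ennreal a + ennreal \<beta> * ennreal b"
        if "0 \<le> \<alpha>" "0 \<le> \<beta>" "0 \<le> a" "0 \<le> b" for \<alpha> \<beta> a b
        using that by (simp add: ennreal_plus ennreal_mult)
      from this[of "1 + t" "1 + 1 / t" E \<eta>] show ?thesis using t E \<eta> by (auto simp del: ennreal_plus)
    qed
    also have "\<dots> \<le> ennreal (E + d)"
    proof (rule ennreal_leI)
      have "(1 + 1 / t) * \<eta> \<le> (1 + 1 / t) * (d / (2 * (1 + 1 / t)))"
        unfolding \<eta>_def using t by (intro mult_left_mono) auto
      also have "\<dots> = d / 2"
      proof -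
        have "s * (d / (2 * s)) = d / 2" if "0 < s" for s using that by simp
        moreover have "0 < 1 + 1 / t" using t by (simp add: add_pos_pos)
        ultimately show ?thesis by blast
      qed
      finally have \<eta>t: "(1 + 1 / t) * \<eta> \<le> d / 2" .
      have "(1 + t) * E \<le> E + d / 2" using tE by (simp add: distrib_right)
      then have "(1 + t) * E + (1 + 1 / t) * \<eta> \<le> (E + d / 2) + d / 2" using \<eta>t by (rule add_mono)
      also have "\<dots> = E + d" by simp
      finally show "(1 + t) * E + (1 + 1 / t) * \<eta> \<le> E + d" .
    qed
    also have "\<dots> = energy e S u + ennreal d" unfolding E(2) using E d by (intro ennreal_plus) auto
    finally have "energy e S w \<le> energy e S u + ennreal d" .
    moreover have "ennreal \<eta> \<le> ennreal d" unfolding \<eta>_def by (intro ennreal_leI) simp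
    ultimately show ?thesis using w wl by (meson order_trans)
  qed
  then have "\<exists>w. (\<exists>L. L-lipschitz_on S w) \<and>
     (\<integral>\<^sup>+x. ennreal ((w x - u x)\<^sup>2) \<partial>lebesgue_on S) \<le> ennreal (1 / real (Suc k)) \<and>
     energy e S w \<le> energy e S u + ennreal (1 / real (Suc k))" for k
    by simp
  then show ?thesis by (intro choice allI)
qed

subsection \<open>Cylinders\<close>

lemma emeasure_lborel_Times:
  assumes "A \<in> sets borel" "B \<in> sets borel"
  shows "emeasure lborel (A \<times> B :: ('a::euclidean_space \<times> 'b::euclidean_space) set) = emeasure lborel A * emeasure lborel B"
  using assms by (subst lborel_prod[symmetric]) (simp add: lborel.emeasure_pair_measure_Times)

text \<open>For completed measures Borel measurability does not suffice: null sets must also pull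
  back to null sets, and they do because a null set times the whole other factor is null.\<close>

lemma measurable_fst_lebesgue [measurable]:
  "fst \<in> (lebesgue :: ('a::euclidean_space \<times> 'b::euclidean_space) measure) \<rightarrow>\<^sub>M lebesgue"
proof (rule completion.measurable_completion2)
  show f: "fst \<in> (lebesgue :: ('a \<times> 'b) measure) \<rightarrow>\<^sub>M lborel"
    by (rule measurable_completion) (simp add: borel_measurable_continuous_onI continuous_on_fst)
  show "null_sets lborel \<subseteq> null_sets (distr (lebesgue :: ('a \<times> 'b) measure) lborel fst)"
  proof
    fix A :: "'a set" assume A: "A \<in> null_sets lborel"
    then have [simp]: "A \<in> sets borel" "emeasure lborel A = 0" by auto
    have "emeasure (distr (lebesgue :: ('a \<times> 'b) measure) lborel fst) A = emeasure lebesgue (fst -` A :: ('a \<times> 'b) set)"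
      by (subst emeasure_distr[OF f]) simp_all
    also have "(fst -` A :: ('a \<times> 'b) set) = A \<times> UNIV" by auto
    also have "emeasure lebesgue (A \<times> UNIV :: ('a \<times> 'b) set) = 0"
      by (simp add: emeasure_lborel_Times borel_Times)
    finally show "A \<in> null_sets (distr (lebesgue :: ('a \<times> 'b) measure) lborel fst)" by auto
  qed
qed

lemma cylinder_sets:
  fixes S :: "'a::euclidean_space set"
  assumes "S \<in> sets lebesgue"
  shows "S \<times> {a<..<b::real} \<in> sets lebesgue"
proof -
  have "fst -` S \<inter> space lebesgue \<in> sets (lebesgue :: ('a \<times> real) measure)"
    using measurable_fst_lebesgue assms by (rule measurable_sets)
  moreover have "(UNIV \<times> {a<..<b} :: ('a \<times> real) set) \<in> sets lebesgue"
    by (simp add: borel_Times)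
  moreover have "S \<times> {a<..<b} = (fst -` S \<inter> space lebesgue) \<inter> (UNIV \<times> {a<..<b})" by auto
  ultimately show ?thesis by (metis sets.Int)
qed

lemma measurable_fst_cylinder:
  fixes S :: "'a::euclidean_space set"
  shows "fst \<in> lebesgue_on (S \<times> {a<..<b::real}) \<rightarrow>\<^sub>M lebesgue_on S"
  by (rule measurable_restrict_space3[OF measurable_fst_lebesgue]) auto

text \<open>Lebesgue measure on the product is a completion, not the product of the Lebesgue
  measures of the factors. Tonelli is therefore applied to a Borel function \<open>g\<close> that
  agrees almost everywhere with the extension \<open>h\<close> of \<open>f\<close> by zero.\<close>

lemma nn_integral_cylinder:
  fixes S :: "'a::euclidean_space set" and f :: "'a \<Rightarrow> ennreal"
  assumes S: "S \<in> sets lebesgue" and f: "f \<in> borel_measurable (lebesgue_on S)" and ab: "a \<le> b"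
  shows "(\<integral>\<^sup>+p. f (fst p) \<partial>lebesgue_on (S \<times> {a<..<b::real})) = ennreal (b - a) * (\<integral>\<^sup>+x. f x \<partial>lebesgue_on S)"
proof -
  let ?I = "{a<..<b}"
  define h where "h x = f x * indicator S x" for x
  have "h \<in> borel_measurable lebesgue"
    unfolding h_def using f S by (simp add: borel_measurable_restrict_space_iff_ennreal)
  then obtain g where g [measurable]: "g \<in> borel_measurable lborel" and hg: "AE x in lborel. h x = g x"
    using completion_ex_borel_measurable by blast
  from hg obtain N where N: "{x. h x \<noteq> g x} \<subseteq> N" "N \<in> null_sets lborel"
    by (auto elim!: AE_E simp: null_sets_def)
  have N': "N \<times> (UNIV::real set) \<in> null_sets lborel"
    using N(2) by (auto simp: null_sets_def emeasure_lborel_Times borel_Times)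
  have ae: "AE p in lborel. h (fst p) = g (fst (p :: 'a \<times> real))"
  proof (rule AE_I'[OF N'], rule subsetI)
    fix p assume "p \<in> {p \<in> space lborel. h (fst p) \<noteq> g (fst (p :: 'a \<times> real))}"
    then have "fst p \<in> N" using N(1) by blast
    then show "p \<in> N \<times> UNIV" by (simp add: mem_Times_iff)
  qed
  have "(\<integral>\<^sup>+p. f (fst p) \<partial>lebesgue_on (S \<times> ?I)) = (\<integral>\<^sup>+p. h (fst p) * indicator ?I (snd p) \<partial>lebesgue)"
    unfolding nn_integral_lebesgue_on[OF cylinder_sets[OF S]]
    by (intro nn_integral_cong) (auto simp: h_def indicator_def)
  also have "\<dots> = (\<integral>\<^sup>+p. h (fst p) * indicator ?I (snd p) \<partial>lborel)" by (rule nn_integral_completion)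
  also have "\<dots> = (\<integral>\<^sup>+p. g (fst p) * indicator ?I (snd p) \<partial>lborel)"
    using ae by (intro nn_integral_cong_AE) auto
  also have "\<dots> = (\<integral>\<^sup>+p. g (fst p) * indicator ?I (snd p) \<partial>(lborel \<Otimes>\<^sub>M lborel))" by (simp only: lborel_prod)
  also have "\<dots> = (\<integral>\<^sup>+x. \<integral>\<^sup>+t. g (fst (x, t)) * indicator ?I (snd (x, t)) \<partial>lborel \<partial>lborel)"
    by (rule lborel.nn_integral_fst[symmetric]) measurable
  also have "\<dots> = (\<integral>\<^sup>+x. g x * ennreal (b - a) \<partial>lborel)"
    using ab by (intro nn_integral_cong) (simp add: nn_integral_cmult_indicator)
  also have "\<dots> = ennreal (b - a) * (\<integral>\<^sup>+x. g x \<partial>lborel)"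
    by (subst nn_integral_multc) (simp_all add: mult.commute)
  also have "(\<integral>\<^sup>+x. g x \<partial>lborel) = (\<integral>\<^sup>+x. h x \<partial>lborel)"
    using hg by (intro nn_integral_cong_AE) auto
  also have "\<dots> = (\<integral>\<^sup>+x. f x \<partial>lebesgue_on S)"
    unfolding nn_integral_lebesgue_on[OF S] nn_integral_completion h_def ..
  finally show ?thesis .
qed

lemma L2_space_fst:
  fixes S :: "'a::euclidean_space set"
  assumes S: "S \<in> sets lebesgue" and u: "u \<in> L2_space S"
  shows "(\<lambda>p. u (fst p)) \<in> L2_space (S \<times> {a<..<b::real})"
proof -
  have um [measurable]: "u \<in> borel_measurable (lebesgue_on S)" and ui: "integrable (lebesgue_on S) (\<lambda>x. (u x)\<^sup>2)"
    using u by (auto simp: L2_space_def)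
  have m: "(\<lambda>p. u (fst p)) \<in> borel_measurable (lebesgue_on (S \<times> {a<..<b::real}))"
    by (rule measurable_compose[OF measurable_fst_cylinder um])
  have "(\<integral>\<^sup>+p. ennreal ((u (fst p))\<^sup>2) \<partial>lebesgue_on (S \<times> {a<..<b})) < \<infinity>"
  proof (cases "a \<le> b")
    case True
    have "(\<integral>\<^sup>+x. ennreal ((u x)\<^sup>2) \<partial>lebesgue_on S) < \<infinity>" using ui by (simp add: integrable_iff_bounded)
    then show ?thesis
      by (subst nn_integral_cylinder[OF S _ True]) (simp_all add: ennreal_mult_less_top)
  next
    case False
    then have "S \<times> {a<..<b} = {}" by auto
    then show ?thesis by (simp only:) (simp add: nn_integral_empty space_restrict_space)
  qed
  then have "integrable (lebesgue_on (S \<times> {a<..<b})) (\<lambda>p. (u (fst p))\<^sup>2)"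
    using m by (auto simp: integrable_iff_bounded)
  then show ?thesis using m by (simp add: L2_space_def)
qed

text \<open>Linear change of variables: only the last coordinate is scaled, so the determinant is
  \<open>\<epsilon>\<close>.\<close>

lemma nn_integral_thin_scaling:
  fixes S :: "'a::euclidean_space set" and f :: "'a \<times> real \<Rightarrow> ennreal"
  assumes S: "S \<in> sets lebesgue" and \<epsilon>: "0 < \<epsilon>"
    and f: "f \<in> borel_measurable (lebesgue_on (S \<times> {0<..<\<epsilon>}))"
  shows "(\<integral>\<^sup>+p. f p \<partial>lebesgue_on (S \<times> {0<..<\<epsilon>}))
    = ennreal \<epsilon> * (\<integral>\<^sup>+p. f (fst p, \<epsilon> * snd p) \<partial>lebesgue_on (S \<times> {0<..<1}))"
proof -
  let ?A = "S \<times> {0<..<\<epsilon>}" and ?B = "S \<times> {0<..<1::real}"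
  define c where "c j = (if j = (0, 1) then \<epsilon> else 1)" for j :: "'a \<times> real"
  \<comment> \<open>Expanded over the basis to match the shape of the affine change of variables for
    Lebesgue measure.\<close>
  define T where "T x = (0::'a \<times> real) + (\<Sum>j\<in>Basis. (c j * (x \<bullet> j)) *\<^sub>R j)" for x
  have b01: "(0, 1) \<in> (Basis :: ('a \<times> real) set)" by (simp add: Basis_prod_def)
  have T: "T p = (fst p, \<epsilon> * snd p)" for p
  proof -
    have "T p = (\<Sum>j\<in>Basis. (p \<bullet> j) *\<^sub>R j + (if j = (0, 1) then ((\<epsilon> - 1) * (p \<bullet> j)) *\<^sub>R j else 0))"
      unfolding T_def c_def by (simp add: algebra_simps) (rule sum.cong, auto simp: algebra_simps)
    also have "\<dots> = p + ((\<epsilon> - 1) * snd p) *\<^sub>R (0, 1)"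
      unfolding sum.distrib euclidean_representation using b01 by (simp add: sum.delta inner_prod_def)
    also have "\<dots> = (fst p, \<epsilon> * snd p)" by (simp add: prod_eq_iff algebra_simps)
    finally show ?thesis .
  qed
  have c0: "\<And>j. j \<in> Basis \<Longrightarrow> c j \<noteq> 0" using \<epsilon> by (simp add: c_def)
  have Tm [measurable]: "T \<in> lebesgue \<rightarrow>\<^sub>M lebesgue"
    unfolding T_def[abs_def] by (rule lebesgue_affine_measurable[OF c0])
  have prod: "(\<Prod>j\<in>Basis. \<bar>c j\<bar>) = \<epsilon>"
  proof -
    have abs_c: "\<bar>c j\<bar> = (if j = (0, 1) then \<epsilon> else 1)" for j using \<epsilon> by (simp add: c_def)
    have "(\<Prod>j\<in>Basis. \<bar>c j\<bar>) = (\<Prod>j\<in>(Basis :: ('a \<times> real) set). if j = (0::'a, 1::real) then \<epsilon> else 1)"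
      by (rule prod.cong[OF refl abs_c])
    also have "\<dots> = \<epsilon>" by (rule trans[OF prod.delta[OF finite_Basis] if_P[OF b01]])
    finally show ?thesis .
  qed
  have Teq: "T = (\<lambda>x. (0::'a \<times> real) + (\<Sum>j\<in>Basis. (c j * (x \<bullet> j)) *\<^sub>R j))"
    by (rule ext) (rule T_def)
  have "(lebesgue :: ('a \<times> real) measure) = density (distr lebesgue lebesgue T) (\<lambda>_. ennreal (\<Prod>j\<in>Basis. \<bar>c j\<bar>))"
    unfolding Teq by (rule lebesgue_affine_euclidean[OF c0])
  then have leb: "(lebesgue :: ('a \<times> real) measure) = density (distr lebesgue lebesgue T) (\<lambda>_. ennreal \<epsilon>)"
    by (rule trans) (simp only: prod)
  define h where "h p = f p * indicator ?A p" for p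
  have hm [measurable]: "h \<in> borel_measurable lebesgue"
    unfolding h_def using f cylinder_sets[OF S] by (simp add: borel_measurable_restrict_space_iff_ennreal)
  have "(\<integral>\<^sup>+p. f p \<partial>lebesgue_on ?A) = (\<integral>\<^sup>+p. h p \<partial>lebesgue)"
    unfolding nn_integral_lebesgue_on[OF cylinder_sets[OF S]] h_def ..
  also have "\<dots> = (\<integral>\<^sup>+p. h p \<partial>density (distr lebesgue lebesgue T) (\<lambda>_. ennreal \<epsilon>))" using leb by simp
  also have "\<dots> = (\<integral>\<^sup>+p. ennreal \<epsilon> * h p \<partial>distr lebesgue lebesgue T)"
    by (subst nn_integral_density) auto
  also have "\<dots> = (\<integral>\<^sup>+p. ennreal \<epsilon> * h (T p) \<partial>lebesgue)"
    by (subst nn_integral_distr) auto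
  also have "\<dots> = ennreal \<epsilon> * (\<integral>\<^sup>+p. h (T p) \<partial>lebesgue)"
    by (rule nn_integral_cmult) measurable
  also have "(\<integral>\<^sup>+p. h (T p) \<partial>lebesgue) = (\<integral>\<^sup>+p. f (fst p, \<epsilon> * snd p) \<partial>lebesgue_on ?B)"
    unfolding nn_integral_lebesgue_on[OF cylinder_sets[OF S]]
  proof (intro nn_integral_cong)
    fix p :: "'a \<times> real"
    have "T p \<in> ?A \<longleftrightarrow> p \<in> ?B"
      using \<epsilon> by (cases p) (auto simp: T zero_less_mult_iff mult_less_cancel_left1)
    then show "h (T p) = f (fst p, \<epsilon> * snd p) * indicator ?B p"
      by (auto simp: h_def T split: split_indicator)
  qed
  finally show ?thesis .
qed

subsection \<open>Weak convergence and lower semicontinuity\<close>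

lemma integrable_mult_L2:
  fixes f g :: "'a \<Rightarrow> real"
  assumes [measurable]: "f \<in> borel_measurable M" "g \<in> borel_measurable M"
    and "integrable M (\<lambda>x. (f x)\<^sup>2)" "integrable M (\<lambda>x. (g x)\<^sup>2)"
  shows "integrable M (\<lambda>x. f x * g x)"
proof (rule Bochner_Integration.integrable_bound)
  show "integrable M (\<lambda>x. (f x)\<^sup>2 + (g x)\<^sup>2)" using assms by simp
  have "\<bar>a * b\<bar> \<le> a\<^sup>2 + b\<^sup>2" for a b :: real
  proof -
    have "0 \<le> (\<bar>a\<bar> - \<bar>b\<bar>)\<^sup>2" by simp
    then have "2 * \<bar>a * b\<bar> \<le> a\<^sup>2 + b\<^sup>2" by (simp add: power2_diff abs_mult)
    then show ?thesis by linarith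
  qed
  then show "AE x in M. norm (f x * g x) \<le> norm ((f x)\<^sup>2 + (g x)\<^sup>2)" by simp
qed simp

lemma tendsto_0_of_ennreal_square:
  fixes g :: "'i \<Rightarrow> real"
  assumes "((\<lambda>i. ennreal ((g i)\<^sup>2)) \<longlongrightarrow> 0) F"
  shows "(g \<longlongrightarrow> 0) F"
proof -
  have "((\<lambda>i. ennreal ((g i)\<^sup>2)) \<longlongrightarrow> ennreal 0) F" using assms by simp
  then have "((\<lambda>i. (g i)\<^sup>2) \<longlongrightarrow> 0) F"
    by (subst (asm) tendsto_ennreal_iff) auto
  then have "((\<lambda>i. sqrt ((g i)\<^sup>2)) \<longlongrightarrow> sqrt 0) F" by (rule tendsto_real_sqrt)
  then show ?thesis by (simp add: tendsto_rabs_zero_iff)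
qed

text \<open>Cauchy-Schwarz against the test function. The recovery sequence converges strongly, and
  this brings it under the weak convergence of the theorem.\<close>

lemma strong_imp_weak_conv_L2:
  fixes v :: "'i \<Rightarrow> 'a::euclidean_space \<Rightarrow> real"
  assumes v: "\<And>i. v i \<in> L2_space A" and v0: "v0 \<in> L2_space A"
    and lim: "((\<lambda>i. \<integral>\<^sup>+x. ennreal ((v i x - v0 x)\<^sup>2) \<partial>lebesgue_on A) \<longlongrightarrow> 0) F"
  shows "weak_conv_L2 A v v0 F"
  unfolding weak_conv_L2_def
proof (intro conjI ballI)
  show "\<forall>\<^sub>F i in F. v i \<in> L2_space A" using v by simp
  show "v0 \<in> L2_space A" by (rule v0)
  fix \<phi> assume \<phi>: "\<phi> \<in> L2_space A"
  let ?M = "lebesgue_on A"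
  have [measurable]: "v i \<in> borel_measurable ?M" "v0 \<in> borel_measurable ?M" "\<phi> \<in> borel_measurable ?M" for i
    using v v0 \<phi> by (auto simp: L2_space_def)
  have int: "integrable ?M (\<lambda>x. v i x * \<phi> x)" "integrable ?M (\<lambda>x. v0 x * \<phi> x)" for i
    using v v0 \<phi> by (auto simp: L2_space_def intro!: integrable_mult_L2)
  define C where "C = (\<integral>x. (\<phi> x)\<^sup>2 \<partial>?M)"
  have C: "(\<integral>\<^sup>+x. ennreal ((\<phi> x)\<^sup>2) \<partial>?M) = ennreal C"
    unfolding C_def using \<phi> by (intro nn_integral_eq_integral) (auto simp: L2_space_def)
  have bound: "ennreal (((\<integral>x. v i x * \<phi> x \<partial>?M) - (\<integral>x. v0 x * \<phi> x \<partial>?M))\<^sup>2)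
      \<le> (\<integral>\<^sup>+x. ennreal ((v i x - v0 x)\<^sup>2) \<partial>?M) * ennreal C" for i
  proof -
    define D where "D = (\<integral>x. (v i x - v0 x) * \<phi> x \<partial>?M)"
    have iD: "integrable ?M (\<lambda>x. (v i x - v0 x) * \<phi> x)"
      using int by (simp add: left_diff_distrib)
    have D: "D = (\<integral>x. v i x * \<phi> x \<partial>?M) - (\<integral>x. v0 x * \<phi> x \<partial>?M)"
      unfolding D_def using int by (simp add: left_diff_distrib)
    have "ennreal \<bar>D\<bar> \<le> (\<integral>\<^sup>+x. ennreal \<bar>v i x - v0 x\<bar> * ennreal \<bar>\<phi> x\<bar> \<partial>?M)"
      using integral_norm_bound_ennreal[OF iD] by (simp add: D_def abs_mult ennreal_mult)
    then have "(ennreal \<bar>D\<bar>)\<^sup>2 \<le> (\<integral>\<^sup>+x. ennreal \<bar>v i x - v0 x\<bar> * ennreal \<bar>\<phi> x\<bar> \<partial>?M)\<^sup>2"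
      by (rule power_mono) simp
    also have "\<dots> \<le> (\<integral>\<^sup>+x. (ennreal \<bar>v i x - v0 x\<bar>)\<^sup>2 \<partial>?M) * (\<integral>\<^sup>+x. (ennreal \<bar>\<phi> x\<bar>)\<^sup>2 \<partial>?M)"
      by (rule Cauchy_Schwarz_nn_integral) measurable
    finally show ?thesis unfolding D[symmetric] by (simp add: ennreal_power C)
  qed
  have "((\<lambda>i. ennreal C * (\<integral>\<^sup>+x. ennreal ((v i x - v0 x)\<^sup>2) \<partial>?M)) \<longlongrightarrow> ennreal C * 0) F"
    by (rule ennreal_tendsto_cmult[OF _ lim]) simp
  then have lim0: "((\<lambda>i. (\<integral>\<^sup>+x. ennreal ((v i x - v0 x)\<^sup>2) \<partial>?M) * ennreal C) \<longlongrightarrow> 0) F"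
    by (simp only: mult.commute mult_zero_right mult_zero_left)
  have "((\<lambda>i. ennreal (((\<integral>x. v i x * \<phi> x \<partial>?M) - (\<integral>x. v0 x * \<phi> x \<partial>?M))\<^sup>2)) \<longlongrightarrow> 0) F"
    by (rule tendsto_sandwich[OF always_eventually always_eventually tendsto_const lim0]) (use bound in auto)
  then have "((\<lambda>i. (\<integral>x. v i x * \<phi> x \<partial>?M) - (\<integral>x. v0 x * \<phi> x \<partial>?M)) \<longlongrightarrow> 0) F"
    by (rule tendsto_0_of_ennreal_square)
  then show "((\<lambda>i. \<integral>x. v i x * \<phi> x \<partial>?M) \<longlongrightarrow> (\<integral>x. v0 x * \<phi> x \<partial>?M)) F"
    by (rule LIM_zero_cancel)
qed

section \<open>Quadratic forms with a bounded kernel\<close>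

text \<open>Models the kernel truncated near the diagonal; the bound \<open>K\<close> and the finite
  measure make the form finite on all of L2.\<close>

locale bounded_symmetric_kernel = finite_measure M for M :: "'a measure" +
  fixes k :: "'a \<Rightarrow> 'a \<Rightarrow> real" and K :: real
  assumes k_measurable [measurable]: "(\<lambda>p. k (fst p) (snd p)) \<in> borel_measurable (M \<Otimes>\<^sub>M M)"
    and k_bounds: "\<And>p q. 0 \<le> k p q" "\<And>p q. k p q \<le> K"
    and k_sym: "\<And>p q. k p q = k q p"
begin

sublocale pair: pair_sigma_finite M M ..

abbreviation "P \<equiv> M \<Otimes>\<^sub>M M"

lemma K_nonneg: "0 \<le> K" using k_bounds order_trans by blast

lemma integrable_fst_pair:
  fixes h :: "'a \<Rightarrow> real"
  assumes h: "integrable M h"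
  shows "integrable P (\<lambda>p. h (fst p))"
proof -
  have [measurable]: "h \<in> borel_measurable M" using h by simp
  have "(\<integral>\<^sup>+p. ennreal (norm (h (fst p))) \<partial>P) = (\<integral>\<^sup>+x. \<integral>\<^sup>+y. ennreal (norm (h (fst (x, y)))) \<partial>M \<partial>M)"
    by (rule nn_integral_fst[symmetric]) measurable
  also have "\<dots> = (\<integral>\<^sup>+x. ennreal (norm (h x)) \<partial>M) * emeasure M (space M)"
    by (simp add: nn_integral_multc)
  also have "\<dots> < \<infinity>"
    using h by (simp add: integrable_iff_bounded emeasure_eq_measure ennreal_mult_less_top)
  finally show ?thesis by (auto simp: integrable_iff_bounded)
qed

lemma integrable_snd_pair:
  fixes h :: "'a \<Rightarrow> real"
  assumes "integrable M h"
  shows "integrable P (\<lambda>p. h (snd p))"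
  using pair.integrable_product_swap[OF integrable_fst_pair[OF assms]] by (simp add: case_prod_beta')

lemma integrable_kernel_times:
  fixes f :: "'a \<times> 'a \<Rightarrow> real"
  assumes "integrable P f"
  shows "integrable P (\<lambda>p. k (fst p) (snd p) * f p)"
proof (rule Bochner_Integration.integrable_bound)
  show "integrable P (\<lambda>p. K * f p)" using assms by simp
  have [measurable]: "f \<in> borel_measurable P" using assms by simp
  show "(\<lambda>p. k (fst p) (snd p) * f p) \<in> borel_measurable P" by measurable
  have "k p q * \<bar>t\<bar> \<le> K * \<bar>t\<bar>" for p q t by (intro mult_right_mono k_bounds) simp
  then show "AE p in P. norm (k (fst p) (snd p) * f p) \<le> norm (K * f p)"
    using k_bounds(1) K_nonneg by (simp add: abs_mult)
qed

definition L2 :: "('a \<Rightarrow> real) set" where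
  "L2 = {f. f \<in> borel_measurable M \<and> integrable M (\<lambda>x. (f x)\<^sup>2)}"

text \<open>Up to a factor, the gradient of the quadratic form at \<open>v\<close>.\<close>

definition potential :: "('a \<Rightarrow> real) \<Rightarrow> 'a \<Rightarrow> real" where
  "potential v p = (\<integral>q. k p q * (v p - v q) \<partial>M)"

definition form :: "('a \<Rightarrow> real) \<Rightarrow> ('a \<Rightarrow> real) \<Rightarrow> real" where
  "form v f = (\<integral>p. k (fst p) (snd p) * ((v (fst p) - v (snd p)) * (f (fst p) - f (snd p))) \<partial>P)"

lemma L2_pair:
  assumes "v \<in> L2"
  shows "integrable P (\<lambda>p. (v (fst p))\<^sup>2)" "integrable P (\<lambda>p. (v (fst p) - v (snd p))\<^sup>2)"
proof -
  have vm [measurable]: "v \<in> borel_measurable M" and vi: "integrable M (\<lambda>x. (v x)\<^sup>2)"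
    using assms by (auto simp: L2_def)
  show 1: "integrable P (\<lambda>p. (v (fst p))\<^sup>2)" by (rule integrable_fst_pair[OF vi])
  have 2: "integrable P (\<lambda>p. (v (snd p))\<^sup>2)" by (rule integrable_snd_pair[OF vi])
  show "integrable P (\<lambda>p. (v (fst p) - v (snd p))\<^sup>2)"
  proof (rule Bochner_Integration.integrable_bound)
    show "integrable P (\<lambda>p. 2 * (v (fst p))\<^sup>2 + 2 * (v (snd p))\<^sup>2)" using 1 2 by simp
    show "AE p in P. norm ((v (fst p) - v (snd p))\<^sup>2) \<le> norm (2 * (v (fst p))\<^sup>2 + 2 * (v (snd p))\<^sup>2)"
      by (intro AE_I2) (simp add: square_diff_le)
  qed measurable
qed

lemma integrable_form:
  assumes v: "v \<in> L2" and f: "f \<in> L2"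
  shows "integrable P (\<lambda>p. k (fst p) (snd p) * ((v (fst p) - v (snd p)) * f (fst p)))"
    and "integrable P (\<lambda>p. k (fst p) (snd p) * ((v (fst p) - v (snd p)) * (f (fst p) - f (snd p))))"
proof -
  have [measurable]: "v \<in> borel_measurable M" "f \<in> borel_measurable M" using v f by (auto simp: L2_def)
  show "integrable P (\<lambda>p. k (fst p) (snd p) * ((v (fst p) - v (snd p)) * f (fst p)))"
    by (intro integrable_kernel_times integrable_mult_L2 L2_pair v f) measurable
  show "integrable P (\<lambda>p. k (fst p) (snd p) * ((v (fst p) - v (snd p)) * (f (fst p) - f (snd p))))"
    by (intro integrable_kernel_times integrable_mult_L2 L2_pair v f) measurable
qed

text \<open>Expanding \<open>f (fst p) - f (snd p)\<close> gives two terms, which the exchange of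
  the two points turns into each other because \<open>k\<close> is symmetric.\<close>

lemma form_eq_potential:
  assumes v: "v \<in> L2" and f: "f \<in> L2"
  shows "form v f = 2 * (\<integral>p. f p * potential v p \<partial>M)"
proof -
  have [measurable]: "v \<in> borel_measurable M" "f \<in> borel_measurable M" using v f by (auto simp: L2_def)
  define G where "G p = k (fst p) (snd p) * ((v (fst p) - v (snd p)) * f (fst p))" for p
  have Gi: "integrable P G" unfolding G_def[abs_def] by (rule integrable_form(1)[OF v f])
  then have [measurable]: "G \<in> borel_measurable P" by simp
  have Gs: "integrable P (\<lambda>(x, y). G (y, x))" by (rule pair.integrable_product_swap[OF Gi])
  have Gswap: "(\<integral>p. (case p of (x, y) \<Rightarrow> G (y, x)) \<partial>P) = (\<integral>p. G p \<partial>P)"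
    by (rule pair.integral_product_swap) measurable
  have "form v f = (\<integral>p. G p + (case p of (x, y) \<Rightarrow> G (y, x)) \<partial>P)"
    unfolding form_def G_def
    by (intro Bochner_Integration.integral_cong refl) (auto simp: case_prod_beta' k_sym algebra_simps)
  also have "\<dots> = 2 * (\<integral>p. G p \<partial>P)"
    using Gswap by (simp add: Bochner_Integration.integral_add[OF Gi Gs])
  also have "(\<integral>p. G p \<partial>P) = (\<integral>x. \<integral>y. G (x, y) \<partial>M \<partial>M)"
    by (rule pair.integral_fst'[OF Gi, symmetric])
  also have "\<dots> = (\<integral>p. f p * potential v p \<partial>M)"
  proof (rule Bochner_Integration.integral_cong[OF refl])
    fix x
    have "(\<integral>y. G (x, y) \<partial>M) = (\<integral>y. f x * (k x y * (v x - v y)) \<partial>M)"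
      by (intro Bochner_Integration.integral_cong) (simp_all add: G_def mult_ac)
    then show "(\<integral>y. G (x, y) \<partial>M) = f x * potential v x" by (simp add: potential_def)
  qed
  finally show ?thesis .
qed

text \<open>Makes \<open>potential v\<close> admissible as a test function for weak convergence.
  With bounded kernel and finite measure it is at most a multiple of \<open>\<bar>v\<bar>\<close>
  plus a constant.\<close>

lemma potential_L2:
  assumes v: "v \<in> L2"
  shows "potential v \<in> L2"
proof -
  have vm [measurable]: "v \<in> borel_measurable M" and v2: "integrable M (\<lambda>x. (v x)\<^sup>2)"
    using v by (auto simp: L2_def)
  have vi: "integrable M v" by (rule integrable_of_square_integrable[OF _ vm v2]) unfold_locales
  have pm [measurable]: "potential v \<in> borel_measurable M"
  proof -
    have "(\<lambda>p. \<integral>q. (\<lambda>r. k (fst r) (snd r) * (v (fst r) - v (snd r))) (p, q) \<partial>M) \<in> borel_measurable M"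
      by (rule borel_measurable_lebesgue_integral) (simp add: case_prod_beta')
    then show ?thesis by (simp add: potential_def[abs_def])
  qed
  define c where "c = (\<integral>q. \<bar>v q\<bar> \<partial>M)"
  define m where "m = measure M (space M)"
  have bound: "\<bar>potential v p\<bar> \<le> K * m * \<bar>v p\<bar> + K * c" for p
  proof -
    have "\<bar>potential v p\<bar> \<le> (\<integral>q. \<bar>k p q * (v p - v q)\<bar> \<partial>M)"
      unfolding potential_def by (rule integral_abs_bound)
    also have "\<dots> \<le> (\<integral>q. K * \<bar>v p\<bar> + K * \<bar>v q\<bar> \<partial>M)"
    proof (rule integral_mono')
      show "integrable M (\<lambda>q. K * \<bar>v p\<bar> + K * \<bar>v q\<bar>)" using vi by simp
      fix q
      have "\<bar>k p q * (v p - v q)\<bar> = k p q * \<bar>v p - v q\<bar>" using k_bounds(1) by (simp add: abs_mult)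
      also have "\<dots> \<le> K * (\<bar>v p\<bar> + \<bar>v q\<bar>)" by (intro mult_mono k_bounds K_nonneg) auto
      finally show "\<bar>k p q * (v p - v q)\<bar> \<le> K * \<bar>v p\<bar> + K * \<bar>v q\<bar>" by (simp add: distrib_left)
    qed (simp add: K_nonneg)
    also have "\<dots> = K * m * \<bar>v p\<bar> + K * c" using vi by (simp add: m_def c_def)
    finally show ?thesis .
  qed
  have "integrable M (\<lambda>p. (potential v p)\<^sup>2)"
  proof (rule Bochner_Integration.integrable_bound)
    show "integrable M (\<lambda>p. 2 * (K * m)\<^sup>2 * (v p)\<^sup>2 + 2 * (K * c)\<^sup>2)" using v2 by simp
    show "AE p in M. norm ((potential v p)\<^sup>2) \<le> norm (2 * (K * m)\<^sup>2 * (v p)\<^sup>2 + 2 * (K * c)\<^sup>2)"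
    proof (rule AE_I2)
      fix p
      have "\<bar>potential v p\<bar> \<le> \<bar>K * m * \<bar>v p\<bar> + K * c\<bar>" using bound[of p] by linarith
      then have "(potential v p)\<^sup>2 \<le> (K * m * \<bar>v p\<bar> - (- (K * c)))\<^sup>2" by (simp add: abs_le_square_iff)
      also have "\<dots> \<le> 2 * (K * m * \<bar>v p\<bar>)\<^sup>2 + 2 * (- (K * c))\<^sup>2" by (rule square_diff_le)
      finally show "norm ((potential v p)\<^sup>2) \<le> norm (2 * (K * m)\<^sup>2 * (v p)\<^sup>2 + 2 * (K * c)\<^sup>2)"
        by (simp add: power_mult_distrib)
    qed
  qed measurable
  then show ?thesis using pm by (simp add: L2_def)
qed

lemma nn_form:
  assumes v: "v \<in> L2"
  shows "(\<integral>\<^sup>+x. \<integral>\<^sup>+y. ennreal (k x y * (v x - v y)\<^sup>2) \<partial>M \<partial>M) = ennreal (form v v)"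
proof -
  have [measurable]: "v \<in> borel_measurable M" using v by (auto simp: L2_def)
  define G where "G p = k (fst p) (snd p) * ((v (fst p) - v (snd p)) * (v (fst p) - v (snd p)))" for p
  have Gi: "integrable P G" unfolding G_def[abs_def] by (rule integrable_form(2)[OF v v])
  then have [measurable]: "G \<in> borel_measurable P" by simp
  have "(\<integral>\<^sup>+x. \<integral>\<^sup>+y. ennreal (k x y * (v x - v y)\<^sup>2) \<partial>M \<partial>M) = (\<integral>\<^sup>+x. \<integral>\<^sup>+y. ennreal (G (x, y)) \<partial>M \<partial>M)"
    by (simp add: G_def power2_eq_square)
  also have "\<dots> = (\<integral>\<^sup>+p. ennreal (G p) \<partial>P)"
    by (rule nn_integral_fst) measurable
  also have "\<dots> = ennreal (\<integral>p. G p \<partial>P)"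
    by (rule nn_integral_eq_integral[OF Gi]) (simp add: G_def k_bounds)
  also have "(\<integral>p. G p \<partial>P) = form v v" unfolding form_def G_def ..
  finally show ?thesis .
qed

text \<open>The tangent inequality \<open>a\<^sup>2 \<ge> 2ab - b\<^sup>2\<close> bounds the form below by an affine functional, which
  passes to weak limits.\<close>

lemma form_ge_tangent:
  assumes v: "v \<in> L2" and f: "f \<in> L2"
  shows "2 * form v f - form v v \<le> form f f"
proof -
  have "2 * form v f - form v v = (\<integral>p. 2 * (k (fst p) (snd p) * ((v (fst p) - v (snd p)) * (f (fst p) - f (snd p))))
      - k (fst p) (snd p) * ((v (fst p) - v (snd p)) * (v (fst p) - v (snd p))) \<partial>P)"
    unfolding form_def using integrable_form(2)[OF v f] integrable_form(2)[OF v v] by simp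
  also have "\<dots> \<le> form f f" unfolding form_def
  proof (rule integral_mono)
    fix p
    have tangent: "2 * (c * (a * b)) - c * (a * a) \<le> c * (b * b)" if "0 \<le> c" for a b c :: real
    proof -
      have "0 \<le> c * (a - b)\<^sup>2" using that by simp
      then show ?thesis by (simp add: power2_eq_square algebra_simps)
    qed
    show "2 * (k (fst p) (snd p) * ((v (fst p) - v (snd p)) * (f (fst p) - f (snd p))))
      - k (fst p) (snd p) * ((v (fst p) - v (snd p)) * (v (fst p) - v (snd p)))
      \<le> k (fst p) (snd p) * ((f (fst p) - f (snd p)) * (f (fst p) - f (snd p)))"
      by (rule tangent[OF k_bounds(1)])
  qed (use integrable_form(2)[OF v f] integrable_form(2)[OF v v] integrable_form(2)[OF f f] in auto)
  finally show ?thesis .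
qed

text \<open>\<open>R i\<close> is \<open>2 * form v (w i) - form v v\<close>, rewritten through
  \<open>potential\<close>: affine in \<open>w i\<close>, hence convergent, and below the form by
  \<open>form_ge_tangent\<close>. A convergent minorant is more flexible than a bare liminf
  inequality, since it is later divided by a factor depending on the index.\<close>

lemma weak_lower_bound:
  assumes v: "v \<in> L2" and weak: "\<And>\<phi>. \<phi> \<in> L2 \<Longrightarrow> ((\<lambda>i. \<integral>x. w i x * \<phi> x \<partial>M) \<longlongrightarrow> (\<integral>x. v x * \<phi> x \<partial>M)) F"
  shows "\<exists>R. (R \<longlongrightarrow> form v v) F \<and> (\<forall>i. w i \<in> L2 \<longrightarrow> R i \<le> form (w i) (w i))"
proof (intro exI conjI allI impI)
  show "((\<lambda>i. 4 * (\<integral>x. w i x * potential v x \<partial>M) - form v v) \<longlongrightarrow> form v v) F"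
  proof (rule tendsto_eq_rhs)
    show "((\<lambda>i. 4 * (\<integral>x. w i x * potential v x \<partial>M) - form v v) \<longlongrightarrow> 4 * (\<integral>x. v x * potential v x \<partial>M) - form v v) F"
      by (intro tendsto_intros weak potential_L2 v)
    show "4 * (\<integral>x. v x * potential v x \<partial>M) - form v v = form v v"
      using form_eq_potential[OF v v] by simp
  qed
  show "4 * (\<integral>x. w i x * potential v x \<partial>M) - form v v \<le> form (w i) (w i)" if "w i \<in> L2" for i
    using form_ge_tangent[OF v that] form_eq_potential[OF v that] by simp
qed

end

subsection \<open>Thin domains\<close>

text \<open>Distances in the cylinder are at least those of the projections, so the kernel only
  decreases; the two thin variables contribute a factor \<open>\<epsilon>\<close> each.\<close>

lemma energy_cylinder_le:
  fixes w :: "'a::euclidean_space \<Rightarrow> real"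
  assumes S: "bounded S" "S \<in> sets lebesgue" and w [measurable]: "w \<in> borel_measurable (lebesgue_on S)"
    and \<epsilon>: "0 < \<epsilon>" and e: "0 \<le> e"
  shows "energy e (S \<times> {0<..<\<epsilon>}) (\<lambda>p. w (fst p)) \<le> ennreal (\<epsilon>\<^sup>2) * energy e S w"
proof -
  let ?C = "lebesgue_on (S \<times> {0<..<\<epsilon>})" and ?M = "lebesgue_on S"
  interpret finite_measure ?M by (rule finite_measure_lebesgue_on[OF S])
  define g where "g x y = ennreal ((w x - w y)\<^sup>2 / norm (x - y) powr e)" for x y
  have [measurable]: "g x \<in> borel_measurable ?M" for x unfolding g_def by measurable
  have [measurable]: "(\<lambda>x. \<integral>\<^sup>+y. g x y \<partial>?M) \<in> borel_measurable ?M" unfolding g_def by measurable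
  have "energy e (S \<times> {0<..<\<epsilon>}) (\<lambda>p. w (fst p)) \<le> (\<integral>\<^sup>+p. \<integral>\<^sup>+q. g (fst p) (fst q) \<partial>?C \<partial>?C)"
    unfolding energy_def
  proof (intro nn_integral_mono)
    fix p q :: "'a \<times> real"
    show "ennreal ((w (fst p) - w (fst q))\<^sup>2 / norm (p - q) powr e) \<le> g (fst p) (fst q)"
    proof (cases "fst p = fst q")
      case False
      have "norm (fst p - fst q) \<le> norm (p - q)" by (metis fst_diff norm_fst_le prod.collapse)
      then have le: "norm (fst p - fst q) powr e \<le> norm (p - q) powr e" using e by (intro powr_mono2) auto
      have pos: "0 < norm (fst p - fst q) powr e" using False by simp
      show ?thesis unfolding g_def by (rule ennreal_leI[OF frac_le[OF zero_le_power2 order_refl pos le]])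
    qed simp
  qed
  also have "\<dots> = (\<integral>\<^sup>+p. (\<lambda>x. ennreal \<epsilon> * (\<integral>\<^sup>+y. g x y \<partial>?M)) (fst p) \<partial>?C)"
  proof (rule nn_integral_cong)
    fix p :: "'a \<times> real"
    show "(\<integral>\<^sup>+q. g (fst p) (fst q) \<partial>?C) = (\<lambda>x. ennreal \<epsilon> * (\<integral>\<^sup>+y. g x y \<partial>?M)) (fst p)"
      using nn_integral_cylinder[OF S(2), of "g (fst p)" 0 \<epsilon>] \<epsilon> by simp
  qed
  also have "\<dots> = ennreal (\<epsilon> - 0) * (\<integral>\<^sup>+x. ennreal \<epsilon> * (\<integral>\<^sup>+y. g x y \<partial>?M) \<partial>?M)"
    by (rule nn_integral_cylinder[OF S(2)]) (use \<epsilon> in auto)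
  also have "\<dots> = ennreal \<epsilon> * (ennreal \<epsilon> * (\<integral>\<^sup>+x. (\<integral>\<^sup>+y. g x y \<partial>?M) \<partial>?M))"
    by (simp add: nn_integral_cmult)
  also have "\<dots> = ennreal (\<epsilon>\<^sup>2) * (\<integral>\<^sup>+x. (\<integral>\<^sup>+y. g x y \<partial>?M) \<partial>?M)"
    using \<epsilon> by (simp only: mult.assoc[symmetric] power2_eq_square ennreal_mult less_imp_le)
  finally show ?thesis unfolding energy_def g_def .
qed

text \<open>\<open>N \<epsilon>\<close> is the largest \<open>k\<close> with
  \<open>\<epsilon> < c k\<close>, for positive thresholds \<open>c\<close> that tend to 0 and stay
  below those up to which \<open>Q k\<close> holds.\<close>

lemma diagonal_at_right:
  fixes Q :: "nat \<Rightarrow> real \<Rightarrow> bool"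
  assumes "\<And>k. \<forall>\<^sub>F \<epsilon> in at_right 0. Q k \<epsilon>"
  obtains N :: "real \<Rightarrow> nat" where "filterlim N at_top (at_right 0)" "\<forall>\<^sub>F \<epsilon> in at_right 0. Q (N \<epsilon>) \<epsilon>"
proof -
  have "\<exists>b>0. \<forall>\<epsilon>. 0 < \<epsilon> \<and> \<epsilon> < b \<longrightarrow> Q k \<epsilon>" for k
    using assms[of k] by (auto simp: eventually_at_right_field)
  then obtain b where b: "\<And>k. 0 < b k" "\<And>k \<epsilon>. 0 < \<epsilon> \<Longrightarrow> \<epsilon> < b k \<Longrightarrow> Q k \<epsilon>" by metis
  \<comment> \<open>The minimum keeps \<open>c k\<close> below both \<open>b k\<close> and
    \<open>b 0\<close>; the division by \<open>Suc k\<close> then sends it to 0, so only finitely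
    many \<open>k\<close> compete for a given \<open>\<epsilon>\<close>.\<close>
  define c where "c k = Min (b ` {..k}) / real (Suc k)" for k
  have c0: "0 < c k" for k unfolding c_def using b(1) by simp
  have Mb: "0 < Min (b ` {..k})" for k using b(1) by simp
  have cb: "c k \<le> b k" for k
  proof -
    have "c k \<le> Min (b ` {..k}) / 1" unfolding c_def
      by (rule frac_le[OF less_imp_le[OF Mb] order_refl zero_less_one]) simp
    also have "\<dots> = Min (b ` {..k})" by (rule div_by_1)
    also have "\<dots> \<le> b k" by (rule Min_le) auto
    finally show ?thesis .
  qed
  have cmono: "c j \<le> c k" if "k \<le> j" for j k
  proof -
    have "Min (b ` {..j}) \<le> Min (b ` {..k})" using that by (intro Min_antimono) auto
    then show ?thesis unfolding c_def
      by (rule frac_le[OF less_imp_le[OF Mb]]) (use that in simp_all)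
  qed
  define A where "A \<epsilon> = {k. \<epsilon> < c k}" for \<epsilon>
  have fin: "finite (A \<epsilon>)" if "0 < \<epsilon>" for \<epsilon>
  proof -
    obtain n where n: "b 0 / \<epsilon> \<le> real n" using real_arch_simple by blast
    have "k \<le> n" if "k \<in> A \<epsilon>" for k
    proof -
      have "\<epsilon> < Min (b ` {..k}) / real (Suc k)" using that by (simp add: A_def c_def)
      also have "\<dots> \<le> b 0 / real (Suc k)" by (intro divide_right_mono Min_le) auto
      finally have "real (Suc k) < b 0 / \<epsilon>" using \<open>0 < \<epsilon>\<close> by (simp add: field_simps)
      then show ?thesis using n by simp
    qed
    then show ?thesis by (meson finite_nat_set_iff_bounded_le)
  qed
  define N where "N \<epsilon> = Max (A \<epsilon>)" for \<epsilon>
  have "\<forall>\<^sub>F \<epsilon> in at_right 0. Q (N \<epsilon>) \<epsilon>"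
    unfolding eventually_at_right_field
  proof (intro exI[of _ "c 0"] conjI allI impI)
    fix \<epsilon> assume \<epsilon>: "0 < \<epsilon>" "\<epsilon> < c 0"
    then have "A \<epsilon> \<noteq> {}" by (auto simp: A_def)
    then have "N \<epsilon> \<in> A \<epsilon>" unfolding N_def using fin[OF \<epsilon>(1)] by (rule Max_in[rotated])
    then have "\<epsilon> < b (N \<epsilon>)" using cb[of "N \<epsilon>"] by (simp add: A_def)
    then show "Q (N \<epsilon>) \<epsilon>" using b(2) \<epsilon> by blast
  qed (rule c0)
  moreover have "filterlim N at_top (at_right 0)"
    unfolding filterlim_at_top
  proof
    fix m
    show "\<forall>\<^sub>F \<epsilon> in at_right 0. m \<le> N \<epsilon>"
      unfolding eventually_at_right_field
    proof (intro exI[of _ "c m"] conjI allI impI)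
      fix \<epsilon> assume \<epsilon>: "0 < \<epsilon>" "\<epsilon> < c m"
      then have "m \<in> A \<epsilon>" by (simp add: A_def)
      then show "m \<le> N \<epsilon>" unfolding N_def using fin[OF \<epsilon>(1)] by (rule Max_ge[rotated])
    qed (rule c0)
  qed
  ultimately show ?thesis using that by blast
qed

text \<open>Each of the two integrals over the thin cylinder yields a factor
  \<open>\<epsilon>\<close>, which is the origin of the normalisation
  \<open>1 / \<epsilon>^2\<close>; what remains is an anisotropic kernel on a fixed
  cylinder.\<close>

lemma energy_thin_scaling:
  fixes S :: "'a::euclidean_space set" and U :: "'a \<times> real \<Rightarrow> real"
  assumes S: "bounded S" "S \<in> sets lebesgue" and \<epsilon>: "0 < \<epsilon>"
    and U [measurable]: "U \<in> borel_measurable (lebesgue_on (S \<times> {0<..<\<epsilon>}))"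
    and V [measurable]: "(\<lambda>p. U (fst p, \<epsilon> * snd p)) \<in> borel_measurable (lebesgue_on (S \<times> {0<..<1}))"
  shows "ennreal (1 / \<epsilon>\<^sup>2) * energy e (S \<times> {0<..<\<epsilon>}) U =
    (\<integral>\<^sup>+p. \<integral>\<^sup>+q. ennreal ((U (fst p, \<epsilon> * snd p) - U (fst q, \<epsilon> * snd q))\<^sup>2 /
        norm ((fst p, \<epsilon> * snd p) - (fst q, \<epsilon> * snd q)) powr e)
      \<partial>lebesgue_on (S \<times> {0<..<1}) \<partial>lebesgue_on (S \<times> {0<..<1}))"
proof -
  let ?C = "lebesgue_on (S \<times> {0<..<\<epsilon>})" and ?A = "lebesgue_on (S \<times> {0<..<1::real})"
  define T where "T p = (fst p, \<epsilon> * snd p)" for p :: "'a \<times> real"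
  interpret C: finite_measure ?C
    by (rule finite_measure_lebesgue_on) (use S in \<open>auto intro: bounded_Times cylinder_sets\<close>)
  interpret A: finite_measure ?A
    by (rule finite_measure_lebesgue_on) (use S in \<open>auto intro: bounded_Times cylinder_sets\<close>)
  define W where "W p = U (T p)" for p
  have [measurable]: "W \<in> borel_measurable ?A" unfolding W_def[abs_def] T_def using V .
  have "T \<in> borel_measurable borel"
    unfolding T_def by (intro borel_measurable_continuous_onI continuous_intros)
  then have [measurable]: "T \<in> borel_measurable ?A"
    using measurable_compose[OF measurable_ident_lebesgue_on] by simp
  define g where "g p q = ennreal ((U p - U q)\<^sup>2 / norm (p - q) powr e)" for p q
  have gm: "g p \<in> borel_measurable ?C" for p unfolding g_def by measurable
  have Gm: "(\<lambda>p. \<integral>\<^sup>+q. g p q \<partial>?C) \<in> borel_measurable ?C" unfolding g_def by measurable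
  have Hm: "(\<lambda>p. \<integral>\<^sup>+q. g (T p) (T q) \<partial>?A) \<in> borel_measurable ?A"
    unfolding g_def W_def[symmetric] by measurable
  have "energy e (S \<times> {0<..<\<epsilon>}) U = (\<integral>\<^sup>+p. \<integral>\<^sup>+q. g p q \<partial>?C \<partial>?C)" unfolding energy_def g_def ..
  also have "\<dots> = ennreal \<epsilon> * (\<integral>\<^sup>+p. \<integral>\<^sup>+q. g (T p) q \<partial>?C \<partial>?A)"
    unfolding T_def by (rule nn_integral_thin_scaling[OF S(2) \<epsilon> Gm])
  also have "(\<integral>\<^sup>+p. \<integral>\<^sup>+q. g (T p) q \<partial>?C \<partial>?A) = (\<integral>\<^sup>+p. ennreal \<epsilon> * (\<integral>\<^sup>+q. g (T p) (T q) \<partial>?A) \<partial>?A)"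
  proof (rule nn_integral_cong)
    fix p
    show "(\<integral>\<^sup>+q. g (T p) q \<partial>?C) = ennreal \<epsilon> * (\<integral>\<^sup>+q. g (T p) (T q) \<partial>?A)"
      using nn_integral_thin_scaling[OF S(2) \<epsilon> gm[of "T p"]] unfolding T_def .
  qed
  also have "\<dots> = ennreal \<epsilon> * (\<integral>\<^sup>+p. (\<integral>\<^sup>+q. g (T p) (T q) \<partial>?A) \<partial>?A)"
    by (rule nn_integral_cmult[OF Hm])
  finally have "ennreal (1 / \<epsilon>\<^sup>2) * energy e (S \<times> {0<..<\<epsilon>}) U
      = (ennreal (1 / \<epsilon>\<^sup>2) * (ennreal \<epsilon> * ennreal \<epsilon>)) * (\<integral>\<^sup>+p. (\<integral>\<^sup>+q. g (T p) (T q) \<partial>?A) \<partial>?A)"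
    by (simp only: mult.assoc)
  also have "ennreal (1 / \<epsilon>\<^sup>2) * (ennreal \<epsilon> * ennreal \<epsilon>) = ennreal (1 / \<epsilon>\<^sup>2 * (\<epsilon> * \<epsilon>))"
    using \<epsilon> by (simp only: ennreal_mult less_imp_le mult_nonneg_nonneg zero_le_power2 zero_le_divide_1_iff)
  also have "1 / \<epsilon>\<^sup>2 * (\<epsilon> * \<epsilon>) = 1" using \<epsilon> by (simp add: power2_eq_square)
  finally show ?thesis unfolding g_def T_def by simp
qed

section \<open>Liminf inequality for truncated energies\<close>

text \<open>For distances kept away from 0 and infinity, a change \<open>t\<close> of the exponent
  costs a factor that is uniform in the distance and tends to 1 with \<open>t\<close>.\<close>

lemma powr_le_powr_abs:
  fixes z B t :: real
  assumes "1 / B \<le> z" "z \<le> B" "1 \<le> B"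
  shows "z powr t \<le> B powr \<bar>t\<bar>"
proof -
  have z: "0 < z" using assms by (smt (verit) divide_pos_pos)
  show ?thesis
  proof (cases "0 \<le> t")
    case True
    then show ?thesis using z assms by (simp add: powr_mono2)
  next
    case False
    have "1 / z \<le> B" using assms z by (simp add: field_simps)
    then have "(1 / z) powr - t \<le> B powr - t" using False z by (intro powr_mono2) auto
    moreover have "(1 / z) powr - t = z powr t" using z by (simp add: powr_divide powr_minus)
    ultimately show ?thesis using False by simp
  qed
qed

text \<open>At distance more than \<open>\<delta>\<close> in the base, the thin kernel is comparable to the limit kernel with
  a constant that tends to \<open>1\<close> as \<open>\<epsilon> \<rightarrow> 0\<close> and \<open>s \<rightarrow> s0\<close>.\<close>

lemma thin_kernel_ge:
  fixes p q :: "'a::euclidean_space \<times> real"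
  assumes \<delta>: "0 < \<delta>" "\<delta> < norm (fst p - fst q)" and B: "1 \<le> B" "1 / B \<le> \<delta>" "norm (fst p - fst q) \<le> B"
    and \<epsilon>: "0 < \<epsilon>" and t: "\<bar>snd p - snd q\<bar> \<le> 1" and e: "0 \<le> e"
  shows "1 / (B powr \<bar>e - e0\<bar> * sqrt (1 + \<epsilon>\<^sup>2 / \<delta>\<^sup>2) powr e) * norm (fst p - fst q) powr - e0
     \<le> 1 / norm ((fst p, \<epsilon> * snd p) - (fst q, \<epsilon> * snd q)) powr e"
proof -
  define z where "z = norm (fst p - fst q)"
  define Q where "Q = sqrt (1 + \<epsilon>\<^sup>2 / \<delta>\<^sup>2)"
  define N where "N = norm ((fst p, \<epsilon> * snd p) - (fst q, \<epsilon> * snd q))"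
  have z: "0 < z" "\<delta> < z" using \<delta> by (auto simp: z_def)
  have Q: "0 < Q" unfolding Q_def by (intro real_sqrt_gt_zero add_pos_nonneg) auto
  have N2: "N\<^sup>2 = z\<^sup>2 + \<epsilon>\<^sup>2 * (snd p - snd q)\<^sup>2"
    unfolding N_def z_def by (simp add: norm_Pair power_mult_distrib right_diff_distrib[symmetric])
  have Npos: "0 < N"
  proof -
    have "0 < N\<^sup>2" unfolding N2 using z by (intro add_pos_nonneg) auto
    then show ?thesis unfolding N_def by simp
  qed
  \<comment> \<open>Since \<open>z\<close> exceeds \<open>\<delta>\<close>, the vertical part of the
    squared distance is at most \<open>\<epsilon>^2 / \<delta>^2\<close> times the horizontal part
    \<open>z^2\<close>.\<close>
  have "(snd p - snd q)\<^sup>2 \<le> 1" using t by (simp add: abs_square_le_1)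
  moreover have "1 \<le> z\<^sup>2 / \<delta>\<^sup>2" using z \<delta>(1) by (simp add: power_mono)
  ultimately have "\<epsilon>\<^sup>2 * (snd p - snd q)\<^sup>2 \<le> \<epsilon>\<^sup>2 * (z\<^sup>2 / \<delta>\<^sup>2)" by (intro mult_left_mono) auto
  then have "N\<^sup>2 \<le> (z * Q)\<^sup>2"
    unfolding N2 Q_def power_mult_distrib by (simp add: algebra_simps)
  then have "N \<le> z * Q" using z Q by (simp add: power2_le_iff_abs_le)
  then have "N powr e \<le> (z * Q) powr e" using e Npos by (intro powr_mono2) auto
  also have "\<dots> = z powr e0 * z powr (e - e0) * Q powr e"
    using z Q by (simp add: powr_mult flip: powr_add)
  also have "\<dots> \<le> z powr e0 * B powr \<bar>e - e0\<bar> * Q powr e"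
    using powr_le_powr_abs[of B z "e - e0"] B z
    by (intro mult_right_mono mult_left_mono) (auto simp: z_def)
  finally have le: "N powr e \<le> z powr e0 * B powr \<bar>e - e0\<bar> * Q powr e" .
  have "1 / (B powr \<bar>e - e0\<bar> * Q powr e) * z powr - e0 = 1 / (z powr e0 * B powr \<bar>e - e0\<bar> * Q powr e)"
    by (simp add: powr_minus_divide)
  also have "\<dots> \<le> 1 / N powr e"
  proof (rule frac_le[OF _ order_refl _ le])
    show "0 < N powr e" using Npos by simp
  qed simp
  finally show ?thesis unfolding z_def N_def Q_def .
qed

definition far_energy :: "real \<Rightarrow> real \<Rightarrow> 'a::euclidean_space set \<Rightarrow> ('a \<Rightarrow> real) \<Rightarrow> ennreal" where
  "far_energy e \<delta> S u = (\<integral>\<^sup>+x. \<integral>\<^sup>+y.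
     (if \<delta> < norm (x - y) then ennreal ((u x - u y)\<^sup>2 / norm (x - y) powr e) else 0)
       \<partial>lebesgue_on S \<partial>lebesgue_on S)"

text \<open>Fatou's lemma along the truncations at \<open>1 / real (Suc k)\<close>; on the diagonal
  the density and its truncations are all 0.\<close>

lemma energy_le_of_far_energy_le:
  fixes u :: "'a::euclidean_space \<Rightarrow> real"
  assumes S: "bounded S" "S \<in> sets lebesgue" and um [measurable]: "u \<in> borel_measurable (lebesgue_on S)"
    and far: "\<And>\<delta>. 0 < \<delta> \<Longrightarrow> far_energy e \<delta> S u \<le> X"
  shows "energy e S u \<le> X"
proof -
  let ?M = "lebesgue_on S"
  interpret finite_measure ?M by (rule finite_measure_lebesgue_on[OF S])
  define q where "q p = ennreal ((u (fst p) - u (snd p))\<^sup>2 / norm (fst p - snd p) powr e)" for p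
  define g where "g k p = (if 1 / real (Suc k) < norm (fst p - snd p) then q p else 0)" for k p
  have [measurable]: "q \<in> borel_measurable (?M \<Otimes>\<^sub>M ?M)" unfolding q_def by measurable
  have [measurable]: "g k \<in> borel_measurable (?M \<Otimes>\<^sub>M ?M)" for k unfolding g_def by measurable
  have lim: "liminf (\<lambda>k. g k p) = q p" for p
  proof (cases "norm (fst p - snd p) = 0")
    case True
    then have "g k p = 0" "q p = 0" for k by (simp_all add: g_def q_def)
    then show ?thesis by (simp add: Liminf_const)
  next
    case False
    then have "\<forall>\<^sub>F k in sequentially. 1 / real (Suc k) < norm (fst p - snd p)"
      by (intro eventually_inverse_Suc_less) simp
    then have "\<forall>\<^sub>F k in sequentially. g k p = q p"
      by eventually_elim (simp only: g_def if_True)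
    then have "(\<lambda>k. g k p) \<longlonglongrightarrow> q p" by (rule tendsto_eventually)
    then show ?thesis by (rule lim_imp_Liminf[OF sequentially_bot])
  qed
  have "energy e S u = (\<integral>\<^sup>+p. liminf (\<lambda>k. g k p) \<partial>(?M \<Otimes>\<^sub>M ?M))"
    unfolding energy_pair[OF S um] lim q_def ..
  also have "\<dots> \<le> liminf (\<lambda>k. \<integral>\<^sup>+p. g k p \<partial>(?M \<Otimes>\<^sub>M ?M))"
    by (rule nn_integral_liminf) measurable
  also have "\<dots> \<le> liminf (\<lambda>k. X)"
  proof (rule Liminf_mono, rule always_eventually, rule allI)
    fix k
    have "(\<integral>\<^sup>+p. g k p \<partial>(?M \<Otimes>\<^sub>M ?M)) = (\<integral>\<^sup>+x. \<integral>\<^sup>+y. g k (x, y) \<partial>?M \<partial>?M)"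
      by (rule nn_integral_fst[symmetric]) measurable
    also have "\<dots> = far_energy e (1 / real (Suc k)) S u"
      unfolding far_energy_def g_def q_def fst_conv snd_conv ..
    also have "\<dots> \<le> X" by (rule far) simp
    finally show "(\<integral>\<^sup>+p. g k p \<partial>(?M \<Otimes>\<^sub>M ?M)) \<le> X" .
  qed
  also have "\<dots> = X" by (simp add: Liminf_const)
  finally show ?thesis .
qed

text \<open>Extended constantly in the thin variable, \<open>u0\<close> has truncated energy
  \<open>form u u\<close> for a bounded kernel on a fixed cylinder, where
  \<open>weak_lower_bound\<close> supplies a minorant \<open>R\<close> converging to it. The
  rescaled functionals are at least \<open>R \<epsilon> / l \<epsilon>\<close>, with
  \<open>l\<close> the comparison factor of \<open>thin_kernel_ge\<close>, which tends to 1.\<close>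

lemma far_energy_le_Liminf:
  fixes \<omega> :: "(real ^ 'n::finite) set" and u0 :: "real ^ 'n \<Rightarrow> real"
  assumes S: "bounded \<omega>" "open \<omega>" and u0: "u0 \<in> L2_space \<omega>" and \<delta>: "0 < \<delta>"
    and s: "(s \<longlongrightarrow> s0) (at_right 0)" "\<And>\<epsilon>. 0 < \<epsilon> \<Longrightarrow> 0 < s \<epsilon>"
    and v: "\<And>\<epsilon>. 0 < \<epsilon> \<Longrightarrow> v \<epsilon> \<in> L2_space (\<omega> \<times> {0<..<\<epsilon>})" and conv: "dimred_conv \<omega> v u0"
  shows "far_energy (real DIM((real ^ 'n) \<times> real) + 2 * s0) \<delta> \<omega> u0 \<le>
    Liminf (at_right 0) (\<lambda>\<epsilon>. ennreal (1 / \<epsilon>\<^sup>2) *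
      energy (real DIM((real ^ 'n) \<times> real) + 2 * s \<epsilon>) (\<omega> \<times> {0<..<\<epsilon>}) (v \<epsilon>))"
proof -
  have Ss: "\<omega> \<in> sets lebesgue" using S(2) by simp
  define A where "A = \<omega> \<times> {0<..<1::real}"
  let ?M = "lebesgue_on A"
  define e where "e \<epsilon> = real DIM((real ^ 'n) \<times> real) + 2 * s \<epsilon>" for \<epsilon>
  define e0 where "e0 = real DIM((real ^ 'n) \<times> real) + 2 * s0"
  define V where "V \<epsilon> p = v \<epsilon> (fst p, \<epsilon> * snd p)" for \<epsilon> p
  define u where "u p = u0 (fst p)" for p :: "(real ^ 'n) \<times> real"
  have A: "bounded A" "A \<in> sets lebesgue"
    unfolding A_def using S(1) Ss by (auto intro: bounded_Times cylinder_sets)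
  have fst_meas [measurable]: "fst \<in> borel_measurable ?M"
    using measurable_compose[OF measurable_ident_lebesgue_on, of fst borel]
    by (simp add: borel_measurable_continuous_onI continuous_on_fst)
  define k where "k p q = (if \<delta> < norm (fst p - fst q) then norm (fst p - fst q) powr - e0 else 0)"
    for p q :: "(real ^ 'n) \<times> real"
  obtain b where b: "0 < b" "\<And>x. x \<in> \<omega> \<Longrightarrow> norm x \<le> b" using S(1) unfolding bounded_pos by blast
  \<comment> \<open>Places every distance that exceeds \<open>\<delta>\<close> and occurs in
    \<omega> inside \<open>[1 / B, B]\<close>.\<close>
  define B where "B = max 1 (max (1 / \<delta>) (2 * b))"
  have B: "1 \<le> B" "1 / B \<le> \<delta>"
  proof -
    show "1 \<le> B" by (simp add: B_def)
    have "1 / \<delta> \<le> B" by (simp add: B_def)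
    then show "1 / B \<le> \<delta>" using \<delta> \<open>1 \<le> B\<close> by (simp add: field_simps)
  qed
  have Bz: "norm (fst p - fst q) \<le> B" if "p \<in> A" "q \<in> A" for p q
  proof -
    have "norm (fst p) \<le> b" "norm (fst q) \<le> b" using that b(2) by (auto simp: A_def)
    then have "norm (fst p - fst q) \<le> 2 * b" using norm_triangle_ineq4[of "fst p" "fst q"] by linarith
    then show ?thesis by (simp add: B_def)
  qed
  interpret fM: finite_measure ?M by (rule finite_measure_lebesgue_on[OF A])
  have e0_pos: "0 \<le> e0"
  proof -
    have "\<forall>\<^sub>F \<epsilon> in at_right 0. 0 \<le> s \<epsilon>"
      using eventually_at_right_less[of "0::real"] by eventually_elim (use s(2) in force)
    then have "0 \<le> s0" by (rule tendsto_lowerbound[OF s(1)]) simp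
    then show ?thesis by (simp add: e0_def)
  qed
  interpret bounded_symmetric_kernel ?M k "\<delta> powr - e0"
  proof
    show "(\<lambda>p. k (fst p) (snd p)) \<in> borel_measurable (?M \<Otimes>\<^sub>M ?M)"
      unfolding k_def by measurable
    show "0 \<le> k p q" for p q by (simp add: k_def)
    show "k p q \<le> \<delta> powr - e0" for p q
      unfolding k_def using \<delta> e0_pos by (auto intro: powr_mono2')
    show "k p q = k q p" for p q by (simp add: k_def norm_minus_commute)
  qed
  have L2: "L2 = L2_space A" by (simp add: L2_def L2_space_def)
  have "weak_conv_L2 A V u (at_right 0)"
    using conv unfolding dimred_conv_def A_def V_def[abs_def] u_def[abs_def] case_prod_beta' .
  then have wc: "(\<forall>\<^sub>F \<epsilon> in at_right 0. V \<epsilon> \<in> L2) \<and> u \<in> L2 \<and>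
     (\<forall>\<phi>\<in>L2. ((\<lambda>\<epsilon>. \<integral>x. V \<epsilon> x * \<phi> x \<partial>?M) \<longlongrightarrow> (\<integral>x. u x * \<phi> x \<partial>?M)) (at_right 0))"
    unfolding weak_conv_L2_def L2 .
  note weak = wc[THEN conjunct1] wc[THEN conjunct2, THEN conjunct1]
    wc[THEN conjunct2, THEN conjunct2, THEN bspec]
  have "\<exists>R. (R \<longlongrightarrow> form u u) (at_right 0) \<and> (\<forall>\<epsilon>. V \<epsilon> \<in> L2 \<longrightarrow> R \<epsilon> \<le> form (V \<epsilon>) (V \<epsilon>))"
    by (rule weak_lower_bound[OF weak(2)]) (rule weak(3))
  then obtain R where R: "(R \<longlongrightarrow> form u u) (at_right 0)" "\<And>\<epsilon>. V \<epsilon> \<in> L2 \<Longrightarrow> R \<epsilon> \<le> form (V \<epsilon>) (V \<epsilon>)"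
    by iprover
  define l where "l \<epsilon> = B powr \<bar>e \<epsilon> - e0\<bar> * sqrt (1 + \<epsilon>\<^sup>2 / \<delta>\<^sup>2) powr e \<epsilon>" for \<epsilon>
  have l_pos: "0 < l \<epsilon>" for \<epsilon>
  proof -
    have "0 < 1 + \<epsilon>\<^sup>2 / \<delta>\<^sup>2" by (intro add_pos_nonneg) auto
    then show ?thesis unfolding l_def using B(1) by simp
  qed
  have l_lim: "(l \<longlongrightarrow> 1) (at_right 0)"
  proof -
    have e: "(e \<longlongrightarrow> e0) (at_right 0)" unfolding e_def[abs_def] e0_def by (intro tendsto_intros s(1))
    have 1: "((\<lambda>\<epsilon>. B powr \<bar>e \<epsilon> - e0\<bar>) \<longlongrightarrow> B powr \<bar>e0 - e0\<bar>) (at_right 0)"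
      using B(1) by (intro tendsto_intros e) auto
    have 2: "((\<lambda>\<epsilon>. sqrt (1 + \<epsilon>\<^sup>2 / \<delta>\<^sup>2)) \<longlongrightarrow> sqrt (1 + 0\<^sup>2 / \<delta>\<^sup>2)) (at_right 0)"
      using \<delta> by (intro tendsto_intros) auto
    have 3: "((\<lambda>\<epsilon>. sqrt (1 + \<epsilon>\<^sup>2 / \<delta>\<^sup>2) powr e \<epsilon>) \<longlongrightarrow> sqrt (1 + 0\<^sup>2 / \<delta>\<^sup>2) powr e0) (at_right 0)"
      by (rule tendsto_powr[OF 2 e]) simp
    from tendsto_mult[OF 1 3] show ?thesis using B(1) by (simp add: l_def[abs_def])
  qed
  \<comment> \<open>A negative \<open>R \<epsilon>\<close> is harmless, as \<open>ennreal\<close>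
    sends it to 0.\<close>
  have lower: "ennreal (R \<epsilon> / l \<epsilon>) \<le> ennreal (1 / \<epsilon>\<^sup>2) * energy (e \<epsilon>) (\<omega> \<times> {0<..<\<epsilon>}) (v \<epsilon>)"
    if \<epsilon>: "0 < \<epsilon>" and VL: "V \<epsilon> \<in> L2" for \<epsilon>
  proof -
    have Vm [measurable]: "V \<epsilon> \<in> borel_measurable ?M" using VL by (simp add: L2_def)
    define f where "f p q = ennreal (k p q * (V \<epsilon> p - V \<epsilon> q)\<^sup>2)" for p q
    have f1: "f p \<in> borel_measurable ?M" for p unfolding f_def k_def by measurable
    have f2: "(\<lambda>p. \<integral>\<^sup>+q. f p q \<partial>?M) \<in> borel_measurable ?M" unfolding f_def k_def by measurable
    have "ennreal (R \<epsilon> / l \<epsilon>) \<le> ennreal (1 / l \<epsilon> * form (V \<epsilon>) (V \<epsilon>))"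
      using divide_right_mono[OF R(2)[OF VL] less_imp_le[OF l_pos]] by (intro ennreal_leI) simp
    also have "\<dots> = ennreal (1 / l \<epsilon>) * ennreal (form (V \<epsilon>) (V \<epsilon>))"
      by (rule ennreal_mult') (simp add: less_imp_le[OF l_pos])
    also have "ennreal (form (V \<epsilon>) (V \<epsilon>)) = (\<integral>\<^sup>+p. \<integral>\<^sup>+q. f p q \<partial>?M \<partial>?M)"
      unfolding f_def by (rule nn_form[OF VL, symmetric])
    also have "ennreal (1 / l \<epsilon>) * (\<integral>\<^sup>+p. \<integral>\<^sup>+q. f p q \<partial>?M \<partial>?M) = (\<integral>\<^sup>+p. ennreal (1 / l \<epsilon>) * (\<integral>\<^sup>+q. f p q \<partial>?M) \<partial>?M)"
      by (rule nn_integral_cmult[OF f2, symmetric])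
    also have "\<dots> = (\<integral>\<^sup>+p. (\<integral>\<^sup>+q. ennreal (1 / l \<epsilon>) * f p q \<partial>?M) \<partial>?M)"
      by (rule nn_integral_cong) (rule nn_integral_cmult[OF f1, symmetric])
    also have "\<dots> \<le> (\<integral>\<^sup>+p. (\<integral>\<^sup>+q. ennreal ((V \<epsilon> p - V \<epsilon> q)\<^sup>2 /
        norm ((fst p, \<epsilon> * snd p) - (fst q, \<epsilon> * snd q)) powr e \<epsilon>) \<partial>?M) \<partial>?M)"
    proof (intro nn_integral_mono)
      fix p q assume "p \<in> space ?M" "q \<in> space ?M"
      then have pq: "p \<in> A" "q \<in> A" by (auto simp: space_restrict_space)
      define N where "N = norm ((fst p, \<epsilon> * snd p) - (fst q, \<epsilon> * snd q)) powr e \<epsilon>"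
      define c where "c = (V \<epsilon> p - V \<epsilon> q)\<^sup>2"
      have "1 / l \<epsilon> * k p q \<le> 1 / N"
      proof (cases "\<delta> < norm (fst p - fst q)")
        case True
        have "\<bar>snd p - snd q\<bar> \<le> 1" using pq by (auto simp: A_def)
        moreover have "0 \<le> e \<epsilon>" using s(2)[OF \<epsilon>] by (simp add: e_def)
        ultimately show ?thesis
          using thin_kernel_ge[OF \<delta> True B Bz[OF pq] \<epsilon>, of "e \<epsilon>" e0] True
          by (simp only: l_def N_def k_def if_True)
      next
        case False
        then show ?thesis by (simp add: k_def N_def)
      qed
      then have "1 / l \<epsilon> * k p q * c \<le> 1 / N * c" by (rule mult_right_mono) (simp add: c_def)
      then have "ennreal (1 / l \<epsilon> * (k p q * c)) \<le> ennreal (c / N)"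
        by (intro ennreal_leI) (simp only: mult.assoc times_divide_eq_left mult_1_left)
      moreover have "ennreal (1 / l \<epsilon> * (k p q * c)) = ennreal (1 / l \<epsilon>) * ennreal (k p q * c)"
        by (rule ennreal_mult') (simp add: less_imp_le[OF l_pos])
      ultimately show "ennreal (1 / l \<epsilon>) * f p q \<le> ennreal ((V \<epsilon> p - V \<epsilon> q)\<^sup>2 /
        norm ((fst p, \<epsilon> * snd p) - (fst q, \<epsilon> * snd q)) powr e \<epsilon>)"
        unfolding f_def N_def c_def by (simp only:)
    qed
    also have "\<dots> = ennreal (1 / \<epsilon>\<^sup>2) * energy (e \<epsilon>) (\<omega> \<times> {0<..<\<epsilon>}) (v \<epsilon>)"
    proof -
      have m1: "v \<epsilon> \<in> borel_measurable (lebesgue_on (\<omega> \<times> {0<..<\<epsilon>}))" using v[OF \<epsilon>] by (simp add: L2_space_def)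
      have m2: "(\<lambda>p. v \<epsilon> (fst p, \<epsilon> * snd p)) \<in> borel_measurable (lebesgue_on (\<omega> \<times> {0<..<1}))"
        using Vm unfolding V_def[abs_def] A_def .
      show ?thesis unfolding V_def A_def by (rule energy_thin_scaling[OF S(1) Ss \<epsilon> m1 m2, symmetric])
    qed
    finally show ?thesis .
  qed
  \<comment> \<open>Neither \<open>u\<close> nor \<open>k\<close> depends on the thin variables, and
    these range over an interval of length 1, so they integrate out with factor 1.\<close>
  have "far_energy e0 \<delta> \<omega> u0 = ennreal (form u u)"
  proof -
    define h where "h x y = (if \<delta> < norm (x - y) then ennreal ((u0 x - u0 y)\<^sup>2 / norm (x - y) powr e0) else 0)" for x y
    have [measurable]: "u0 \<in> borel_measurable (lebesgue_on \<omega>)" using u0 by (simp add: L2_space_def)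
    interpret W: finite_measure "lebesgue_on \<omega>" by (rule finite_measure_lebesgue_on[OF S(1) Ss])
    have h1: "h x \<in> borel_measurable (lebesgue_on \<omega>)" for x unfolding h_def by measurable
    have h2: "(\<lambda>x. \<integral>\<^sup>+y. h x y \<partial>lebesgue_on \<omega>) \<in> borel_measurable (lebesgue_on \<omega>)" unfolding h_def by measurable
    have kh: "ennreal (k p q * (u p - u q)\<^sup>2) = h (fst p) (fst q)" for p q
      by (simp add: k_def u_def h_def powr_minus_divide)
    have "ennreal (form u u) = (\<integral>\<^sup>+p. \<integral>\<^sup>+q. h (fst p) (fst q) \<partial>?M \<partial>?M)"
      unfolding kh[symmetric] by (rule nn_form[OF weak(2), symmetric])
    also have "\<dots> = (\<integral>\<^sup>+p. (\<lambda>x. \<integral>\<^sup>+y. h x y \<partial>lebesgue_on \<omega>) (fst p) \<partial>?M)"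
    proof (rule nn_integral_cong)
      fix p :: "(real ^ 'n) \<times> real"
      show "(\<integral>\<^sup>+q. h (fst p) (fst q) \<partial>?M) = (\<lambda>x. \<integral>\<^sup>+y. h x y \<partial>lebesgue_on \<omega>) (fst p)"
        using nn_integral_cylinder[OF Ss h1[of "fst p"], of 0 1] by (simp add: A_def)
    qed
    also have "\<dots> = (\<integral>\<^sup>+x. \<integral>\<^sup>+y. h x y \<partial>lebesgue_on \<omega> \<partial>lebesgue_on \<omega>)"
      using nn_integral_cylinder[OF Ss h2, of 0 1] by (simp add: A_def)
    finally show ?thesis unfolding far_energy_def h_def by (rule sym)
  qed
  also have "\<dots> = Liminf (at_right 0) (\<lambda>\<epsilon>. ennreal (R \<epsilon> / l \<epsilon>))"
  proof (rule lim_imp_Liminf[symmetric])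
    have "((\<lambda>\<epsilon>. R \<epsilon> / l \<epsilon>) \<longlongrightarrow> form u u / 1) (at_right 0)"
      by (rule tendsto_divide[OF R(1) l_lim]) simp
    then show "((\<lambda>\<epsilon>. ennreal (R \<epsilon> / l \<epsilon>)) \<longlongrightarrow> ennreal (form u u)) (at_right 0)"
      by (intro tendsto_ennrealI) simp
  qed simp
  also have "\<dots> \<le> Liminf (at_right 0) (\<lambda>\<epsilon>. ennreal (1 / \<epsilon>\<^sup>2) * energy (e \<epsilon>) (\<omega> \<times> {0<..<\<epsilon>}) (v \<epsilon>))"
  proof (rule Liminf_mono)
    show "\<forall>\<^sub>F \<epsilon> in at_right 0. ennreal (R \<epsilon> / l \<epsilon>) \<le> ennreal (1 / \<epsilon>\<^sup>2) * energy (e \<epsilon>) (\<omega> \<times> {0<..<\<epsilon>}) (v \<epsilon>)"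
      using weak(1) eventually_at_right_less[of "0::real"] by eventually_elim (rule lower)
  qed
  finally show ?thesis unfolding e_def e0_def .
qed

section \<open>Assembly of the Gamma-limit\<close>

lemma L2_space_perturb:
  assumes u: "u \<in> L2_space S" and w: "w \<in> borel_measurable (lebesgue_on S)"
    and fin: "(\<integral>\<^sup>+x. ennreal ((w x - u x)\<^sup>2) \<partial>lebesgue_on S) \<le> ennreal a" and a: "0 \<le> a"
  shows "w \<in> L2_space S"
proof -
  have um: "u \<in> borel_measurable (lebesgue_on S)" and ui: "integrable (lebesgue_on S) (\<lambda>x. (u x)\<^sup>2)"
    using u by (auto simp: L2_space_def)
  define b where "b = (\<integral>x. (u x)\<^sup>2 \<partial>lebesgue_on S)"
  have b: "(\<integral>\<^sup>+x. ennreal ((u x)\<^sup>2) \<partial>lebesgue_on S) = ennreal b" "0 \<le> b"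
    unfolding b_def by (rule nn_integral_eq_integral[OF ui]) simp_all
  have "(\<integral>\<^sup>+x. ennreal (((w x - u x) + u x)\<^sup>2) \<partial>lebesgue_on S) \<le> ennreal (2 * a + 2 * b)"
    by (rule nn_integral_square_sum_le[OF _ um fin _ a b(2)]) (use um w b(1) in simp_all)
  then have "(\<integral>\<^sup>+x. ennreal ((w x)\<^sup>2) \<partial>lebesgue_on S) \<le> ennreal (2 * a + 2 * b)"
    by (simp only: diff_add_cancel)
  then have "(\<integral>\<^sup>+x. ennreal ((w x)\<^sup>2) \<partial>lebesgue_on S) < \<infinity>"
    by (rule order.strict_trans1) simp
  then have "integrable (lebesgue_on S) (\<lambda>x. (w x)\<^sup>2)"
    using w by (simp add: integrable_iff_bounded)
  then show ?thesis using w by (simp add: L2_space_def)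
qed

lemma seminorm_sq_eq_energy:
  fixes A :: "'a::euclidean_space set"
  assumes "A \<in> sets lebesgue"
  shows "seminorm_sq s A u = energy (real DIM('a) + 2 * s) A u"
  unfolding seminorm_sq_def by (rule iterated_eq_energy[OF assms])

lemma energy_lipschitz_tendsto:
  fixes w :: "'a::euclidean_space \<Rightarrow> real"
  assumes S: "bounded S" "S \<in> sets lebesgue" and w: "L-lipschitz_on S w"
    and e: "(e \<longlongrightarrow> e0) F" "\<forall>\<^sub>F i in F. 2 \<le> e i" and e0: "2 \<le> e0" "e0 < real DIM('a) + 2"
  shows "((\<lambda>i. energy (e i) S w) \<longlongrightarrow> energy e0 S w) F"
proof -
  obtain e1 where e1: "e0 < e1" "e1 < real DIM('a) + 2" using dense[OF e0(2)] by blast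
  have cont: "continuous_on {2..e1} (\<lambda>e. energy e S w)"
    by (rule energy_lipschitz_continuous_on[OF S w]) (use e0 e1 in auto)
  have mem: "e0 \<in> {2..e1}" using e0 e1 by simp
  have "\<forall>\<^sub>F i in F. e i \<in> {2..e1}"
    using e(2) order_tendstoD(2)[OF e(1) e1(1)] by eventually_elim simp
  then show ?thesis by (rule continuous_on_tendsto_compose[OF cont e(1) mem])
qed

theorem theorem4p1:
  fixes \<omega> :: "(real ^ 'n::finite) set" and s :: "real \<Rightarrow> real" and s0 :: real
  assumes "bounded_lipschitz_set \<omega>"
    and "\<And>\<epsilon>. \<epsilon> > 0 \<Longrightarrow> 0 < s \<epsilon> \<and> s \<epsilon> < 1/2"
    and "0 \<le> s0" and "s0 < 1/2"
    and "(s \<longlongrightarrow> s0) (at_right 0)"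
  shows "gamma_limit
           (\<lambda>\<epsilon>. H_space (s \<epsilon>) (\<omega> \<times> {0<..<\<epsilon>}))
           (\<lambda>\<epsilon> u. ennreal (1 / \<epsilon>\<^sup>2) * seminorm_sq (s \<epsilon>) (\<omega> \<times> {0<..<\<epsilon>}) u)
           (dimred_conv \<omega>)
           (L2_space \<omega>)
           (\<lambda>u. \<integral>\<^sup>+x\<in>\<omega>. (\<integral>\<^sup>+y\<in>\<omega>. ennreal (\<bar>u x - u y\<bar>\<^sup>2 /
                   norm (x - y) powr (real DIM((real ^ 'n) \<times> real) + 2 * s0)) \<partial>lebesgue) \<partial>lebesgue)"
proof -
  have bd: "bounded \<omega>" "open \<omega>" using assms(1) by (auto simp: bounded_lipschitz_set_def)
  then have Ss: "\<omega> \<in> sets lebesgue" by simp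
  define e where "e \<epsilon> = real DIM((real ^ 'n) \<times> real) + 2 * s \<epsilon>" for \<epsilon>
  define e0 where "e0 = real DIM((real ^ 'n) \<times> real) + 2 * s0"
  have n: "1 \<le> real DIM(real ^ 'n)" "real DIM((real ^ 'n) \<times> real) = real DIM(real ^ 'n) + 1"
    using DIM_positive[where 'a = "real ^ 'n"] by (simp_all del: DIM_cart)
  \<comment> \<open>With n the dimension of \<omega>, \<open>e0 = n + 1 + 2 * s0\<close>. It is at
    least \<open>n + 1\<close>, hence at least 2, by \<open>s0 \<ge> 0\<close>, and below
    \<open>n + 2\<close> by \<open>s0 < 1/2\<close>: the window in which Lipschitz functions are
    dense in energy.\<close>
  have e0: "2 \<le> e0" "real DIM(real ^ 'n) < e0" "e0 < real DIM(real ^ 'n) + 2"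
    unfolding e0_def n(2) using n(1) assms(3,4) by linarith+
  have e: "2 \<le> e \<epsilon>" "e \<epsilon> < real DIM(real ^ 'n) + 2" if "0 < \<epsilon>" for \<epsilon>
    unfolding e_def n(2) using n(1) assms(2)[OF that] by linarith+
  have e_lim: "(e \<longlongrightarrow> e0) (at_right 0)" unfolding e_def[abs_def] e0_def by (intro tendsto_intros assms(5))
  have pos: "\<forall>\<^sub>F \<epsilon> in at_right 0. (0::real) < \<epsilon>" by (rule eventually_at_right_less)
  have sem: "seminorm_sq (s \<epsilon>) (\<omega> \<times> {0<..<\<epsilon>}) U = energy (e \<epsilon>) (\<omega> \<times> {0<..<\<epsilon>}) U" for \<epsilon> U
    unfolding e_def by (rule seminorm_sq_eq_energy[OF cylinder_sets[OF Ss]])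
  have limit: "(\<integral>\<^sup>+x\<in>\<omega>. (\<integral>\<^sup>+y\<in>\<omega>. ennreal (\<bar>u x - u y\<bar>\<^sup>2 /
                   norm (x - y) powr (real DIM((real ^ 'n) \<times> real) + 2 * s0)) \<partial>lebesgue) \<partial>lebesgue)
       = energy e0 \<omega> u" for u
    unfolding e0_def by (rule iterated_eq_energy[OF Ss])
  have lower: "energy e0 \<omega> u \<le> Liminf (at_right 0) (\<lambda>\<epsilon>. ennreal (1 / \<epsilon>\<^sup>2) * energy (e \<epsilon>) (\<omega> \<times> {0<..<\<epsilon>}) (v \<epsilon>))"
    if u: "u \<in> L2_space \<omega>" and v: "\<forall>\<epsilon>>0. v \<epsilon> \<in> H_space (s \<epsilon>) (\<omega> \<times> {0<..<\<epsilon>})" and conv: "dimred_conv \<omega> v u" for u v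
  proof (rule energy_le_of_far_energy_le[OF bd(1) Ss])
    show "u \<in> borel_measurable (lebesgue_on \<omega>)" using u by (simp add: L2_space_def)
    show "far_energy e0 \<delta> \<omega> u \<le> Liminf (at_right 0) (\<lambda>\<epsilon>. ennreal (1 / \<epsilon>\<^sup>2) * energy (e \<epsilon>) (\<omega> \<times> {0<..<\<epsilon>}) (v \<epsilon>))"
      if "0 < \<delta>" for \<delta>
      unfolding e_def e0_def
    proof (rule far_energy_le_Liminf[OF bd u that assms(5) _ _ conv])
      show "0 < s \<epsilon>" if "0 < \<epsilon>" for \<epsilon> using assms(2)[OF that] by simp
      show "v \<epsilon> \<in> L2_space (\<omega> \<times> {0<..<\<epsilon>})" if "0 < \<epsilon>" for \<epsilon> using v that by (simp add: H_space_def)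
    qed
  qed
  have upper: "\<exists>v. (\<forall>\<epsilon>>0. v \<epsilon> \<in> H_space (s \<epsilon>) (\<omega> \<times> {0<..<\<epsilon>})) \<and> dimred_conv \<omega> v u \<and>
      Limsup (at_right 0) (\<lambda>\<epsilon>. ennreal (1 / \<epsilon>\<^sup>2) * energy (e \<epsilon>) (\<omega> \<times> {0<..<\<epsilon>}) (v \<epsilon>)) \<le> energy e0 \<omega> u"
    if u: "u \<in> L2_space \<omega>" for u
  proof -
    have um: "u \<in> borel_measurable (lebesgue_on \<omega>)" using u by (simp add: L2_space_def)
    obtain w where w: "\<And>k. \<exists>L. L-lipschitz_on \<omega> (w k)"
       "\<And>k. (\<integral>\<^sup>+x. ennreal ((w k x - u x)\<^sup>2) \<partial>lebesgue_on \<omega>) \<le> ennreal (1 / real (Suc k))"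
       "\<And>k. energy e0 \<omega> (w k) \<le> energy e0 \<omega> u + ennreal (1 / real (Suc k))"
      using lipschitz_recovery_sequence[OF assms(1) u e0] by blast
    have wm: "w k \<in> borel_measurable (lebesgue_on \<omega>)" for k using w(1)[of k] lipschitz_on_measurable Ss by blast
    have wL2: "w k \<in> L2_space \<omega>" for k by (rule L2_space_perturb[OF u wm w(2)]) simp
    have scale: "ennreal (1 / \<epsilon>\<^sup>2) * energy (e \<epsilon>) (\<omega> \<times> {0<..<\<epsilon>}) (\<lambda>p. w k (fst p)) \<le> energy (e \<epsilon>) \<omega> (w k)"
      if \<epsilon>: "0 < \<epsilon>" for \<epsilon> k
    proof -
      have "energy (e \<epsilon>) (\<omega> \<times> {0<..<\<epsilon>}) (\<lambda>p. w k (fst p)) \<le> ennreal (\<epsilon>\<^sup>2) * energy (e \<epsilon>) \<omega> (w k)"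
        by (rule energy_cylinder_le[OF bd(1) Ss wm \<epsilon>]) (use e(1)[OF \<epsilon>] in simp)
      then have "ennreal (1 / \<epsilon>\<^sup>2) * energy (e \<epsilon>) (\<omega> \<times> {0<..<\<epsilon>}) (\<lambda>p. w k (fst p))
          \<le> ennreal (1 / \<epsilon>\<^sup>2) * (ennreal (\<epsilon>\<^sup>2) * energy (e \<epsilon>) \<omega> (w k))"
        by (rule mult_left_mono) simp
      also have "\<dots> = ennreal (1 / \<epsilon>\<^sup>2 * \<epsilon>\<^sup>2) * energy (e \<epsilon>) \<omega> (w k)"
        by (subst ennreal_mult) (simp_all only: mult.assoc zero_le_power2 zero_le_divide_1_iff)
      also have "1 / \<epsilon>\<^sup>2 * \<epsilon>\<^sup>2 = 1" using \<epsilon> by simp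
      finally show ?thesis by simp
    qed
    \<comment> \<open>Required at every positive \<open>\<epsilon>\<close>, not just eventually,
      since the recovery sequence must lie in \<open>H_space\<close> throughout; this is where
      \<open>s \<epsilon> < 1/2\<close> enters.\<close>
    have finite: "energy (e \<epsilon>) \<omega> (w k) < \<infinity>" if "0 < \<epsilon>" for \<epsilon> k
      using w(1)[of k] energy_lipschitz_finite[OF bd(1) Ss _ e[OF that]] by blast
    have finite0: "energy e0 \<omega> (w k) < \<infinity>" for k
      using w(1)[of k] energy_lipschitz_finite[OF bd(1) Ss _ e0(1,3)] by blast
    \<comment> \<open>For each \<open>k\<close> continuity in the exponent makes this hold
      eventually, \<open>energy e0 \<omega> (w k)\<close> being finite; the diagonal choice of
      \<open>N\<close> lets \<open>k\<close> grow slowly enough to preserve it.\<close>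
    define Q where "Q k \<epsilon> \<longleftrightarrow> energy (e \<epsilon>) \<omega> (w k) < energy e0 \<omega> (w k) + ennreal (1 / real (Suc k))" for k \<epsilon>
    have Q: "\<forall>\<^sub>F \<epsilon> in at_right 0. Q k \<epsilon>" for k
      unfolding Q_def
    proof (rule order_tendstoD(2))
      obtain L where L: "L-lipschitz_on \<omega> (w k)" using w(1) by blast
      have "\<forall>\<^sub>F \<epsilon> in at_right 0. 2 \<le> e \<epsilon>" using pos by eventually_elim (rule e(1))
      then show "((\<lambda>\<epsilon>. energy (e \<epsilon>) \<omega> (w k)) \<longlongrightarrow> energy e0 \<omega> (w k)) (at_right 0)"
        by (rule energy_lipschitz_tendsto[OF bd(1) Ss L e_lim _ e0(1,3)])
      show "energy e0 \<omega> (w k) < energy e0 \<omega> (w k) + ennreal (1 / real (Suc k))"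
      proof -
        obtain t where t: "0 \<le> t" "energy e0 \<omega> (w k) = ennreal t"
          using finite0[of k] by (cases "energy e0 \<omega> (w k)") auto
        have less: "ennreal a < ennreal a + ennreal d" if "0 \<le> a" "0 < d" for a d :: real
        proof -
          have "ennreal a < ennreal (a + d)" using that by (intro ennreal_lessI) auto
          also have "\<dots> = ennreal a + ennreal d" using that by (intro ennreal_plus) auto
          finally show ?thesis .
        qed
        show ?thesis unfolding t(2) by (rule less[OF t(1)]) simp
      qed
    qed
    obtain N where N: "filterlim N at_top (at_right 0)" "\<forall>\<^sub>F \<epsilon> in at_right 0. Q (N \<epsilon>) \<epsilon>"
      by (rule diagonal_at_right[OF Q])
    have N_lim: "((\<lambda>\<epsilon>. 1 / real (Suc (N \<epsilon>))) \<longlongrightarrow> 0) (at_right 0)"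
      using filterlim_compose[OF LIMSEQ_inverse_real_of_nat N(1)] by (simp only: inverse_eq_divide)
    define v where "v \<epsilon> p = w (N \<epsilon>) (fst p)" for \<epsilon> and p :: "(real ^ 'n) \<times> real"
    have vH: "v \<epsilon> \<in> H_space (s \<epsilon>) (\<omega> \<times> {0<..<\<epsilon>})" if \<epsilon>: "0 < \<epsilon>" for \<epsilon>
    proof -
      have "v \<epsilon> \<in> L2_space (\<omega> \<times> {0<..<\<epsilon>})" unfolding v_def[abs_def] by (rule L2_space_fst[OF Ss wL2])
      moreover have "energy (e \<epsilon>) (\<omega> \<times> {0<..<\<epsilon>}) (v \<epsilon>) < \<infinity>"
      proof -
        have "energy (e \<epsilon>) (\<omega> \<times> {0<..<\<epsilon>}) (v \<epsilon>) \<le> ennreal (\<epsilon>\<^sup>2) * energy (e \<epsilon>) \<omega> (w (N \<epsilon>))"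
          unfolding v_def[abs_def] by (rule energy_cylinder_le[OF bd(1) Ss wm \<epsilon>]) (use e(1)[OF \<epsilon>] in simp)
        also have "\<dots> < \<infinity>" using finite[OF \<epsilon>] by (simp add: ennreal_mult_less_top)
        finally show ?thesis .
      qed
      ultimately show ?thesis by (simp add: H_space_def sem)
    qed
    have "dimred_conv \<omega> v u"
    proof -
      let ?A = "\<omega> \<times> {0<..<1::real}"
      have "weak_conv_L2 ?A (\<lambda>\<epsilon> p. w (N \<epsilon>) (fst p)) (\<lambda>p. u (fst p)) (at_right 0)"
      proof (rule strong_imp_weak_conv_L2)
        show "(\<lambda>p. w (N \<epsilon>) (fst p)) \<in> L2_space ?A" for \<epsilon> by (rule L2_space_fst[OF Ss wL2])
        show "(\<lambda>p. u (fst p)) \<in> L2_space ?A" by (rule L2_space_fst[OF Ss u])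
        have "(\<integral>\<^sup>+p. ennreal ((w k (fst p) - u (fst p))\<^sup>2) \<partial>lebesgue_on ?A) \<le> ennreal (1 / real (Suc k))" for k
        proof -
          have "(\<lambda>x. ennreal ((w k x - u x)\<^sup>2)) \<in> borel_measurable (lebesgue_on \<omega>)" using wm um by measurable
          from nn_integral_cylinder[OF Ss this, of 0 1] w(2)[of k] show ?thesis by simp
        qed
        then have le: "(\<integral>\<^sup>+p. ennreal ((w (N \<epsilon>) (fst p) - u (fst p))\<^sup>2) \<partial>lebesgue_on ?A) \<le> ennreal (1 / real (Suc (N \<epsilon>)))" for \<epsilon>
          by blast
        have "((\<lambda>\<epsilon>. ennreal (1 / real (Suc (N \<epsilon>)))) \<longlongrightarrow> ennreal 0) (at_right 0)"
          by (rule tendsto_ennrealI[OF N_lim])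
        then have lim0: "((\<lambda>\<epsilon>. ennreal (1 / real (Suc (N \<epsilon>)))) \<longlongrightarrow> 0) (at_right 0)" by (simp only: ennreal_0)
        show "((\<lambda>\<epsilon>. \<integral>\<^sup>+p. ennreal ((w (N \<epsilon>) (fst p) - u (fst p))\<^sup>2) \<partial>lebesgue_on ?A) \<longlongrightarrow> 0) (at_right 0)"
          by (rule tendsto_sandwich[OF _ _ tendsto_const lim0])
            (rule always_eventually, rule allI, rule zero_le, rule always_eventually, rule allI, rule le)
      qed
      then show ?thesis unfolding dimred_conv_def v_def[abs_def] case_prod_beta' fst_conv .
    qed
    moreover have "Limsup (at_right 0) (\<lambda>\<epsilon>. ennreal (1 / \<epsilon>\<^sup>2) * energy (e \<epsilon>) (\<omega> \<times> {0<..<\<epsilon>}) (v \<epsilon>)) \<le> energy e0 \<omega> u"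
    proof (rule ennreal_le_epsilon)
      fix \<eta> :: real assume \<eta>: "0 < \<eta>"
      have "\<forall>\<^sub>F \<epsilon> in at_right 0. 1 / real (Suc (N \<epsilon>)) < \<eta> / 2" 
        by (rule order_tendstoD(2)[OF N_lim]) (use \<eta> in simp)
      then have "\<forall>\<^sub>F \<epsilon> in at_right 0. ennreal (1 / \<epsilon>\<^sup>2) * energy (e \<epsilon>) (\<omega> \<times> {0<..<\<epsilon>}) (v \<epsilon>) \<le> energy e0 \<omega> u + ennreal \<eta>"
        using N(2) pos
      proof eventually_elim
        case (elim \<epsilon>)
        \<comment> \<open>Two errors of this size add up: one from the change of exponent at fixed
          \<open>w (N \<epsilon>)\<close>, one from replacing \<open>u\<close> by
          \<open>w (N \<epsilon>)\<close>. Each is below \<open>\<eta> / 2\<close>.\<close>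
        let ?d = "1 / real (Suc (N \<epsilon>))"
        have "ennreal (1 / \<epsilon>\<^sup>2) * energy (e \<epsilon>) (\<omega> \<times> {0<..<\<epsilon>}) (v \<epsilon>) \<le> energy (e \<epsilon>) \<omega> (w (N \<epsilon>))"
          unfolding v_def[abs_def] by (rule scale[OF elim(3)])
        also have "\<dots> \<le> energy e0 \<omega> (w (N \<epsilon>)) + ennreal ?d" by (rule less_imp_le[OF elim(2)[unfolded Q_def]])
        also have "\<dots> \<le> energy e0 \<omega> u + ennreal ?d + ennreal ?d" by (intro add_right_mono w(3))
        also have "\<dots> = energy e0 \<omega> u + ennreal (?d + ?d)"
          unfolding add.assoc by (subst ennreal_plus) simp_all
        also have "\<dots> \<le> energy e0 \<omega> u + ennreal \<eta>"
          using add_mono[OF less_imp_le[OF elim(1)] less_imp_le[OF elim(1)]]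
          unfolding field_sum_of_halves by (intro add_left_mono ennreal_leI)
        finally show ?case .
      qed
      then show "Limsup (at_right 0) (\<lambda>\<epsilon>. ennreal (1 / \<epsilon>\<^sup>2) * energy (e \<epsilon>) (\<omega> \<times> {0<..<\<epsilon>}) (v \<epsilon>)) \<le> energy e0 \<omega> u + ennreal \<eta>"
        by (rule Limsup_bounded)
    qed
    ultimately show ?thesis using vH by blast
  qed
  show ?thesis
    unfolding gamma_limit_def limit sem
  proof (intro ballI conjI allI impI)
    fix u v
    assume "u \<in> L2_space \<omega>" "(\<forall>\<epsilon>>0. v \<epsilon> \<in> H_space (s \<epsilon>) (\<omega> \<times> {0<..<\<epsilon>})) \<and> dimred_conv \<omega> v u"
    then show "energy e0 \<omega> u \<le> Liminf (at_right 0) (\<lambda>\<epsilon>. ennreal (1 / \<epsilon>\<^sup>2) * energy (e \<epsilon>) (\<omega> \<times> {0<..<\<epsilon>}) (v \<epsilon>))"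
      by (elim conjE) (rule lower)
  next
    fix u assume "u \<in> L2_space \<omega>"
    then show "\<exists>v. (\<forall>\<epsilon>>0. v \<epsilon> \<in> H_space (s \<epsilon>) (\<omega> \<times> {0<..<\<epsilon>})) \<and> dimred_conv \<omega> v u \<and>
      Limsup (at_right 0) (\<lambda>\<epsilon>. ennreal (1 / \<epsilon>\<^sup>2) * energy (e \<epsilon>) (\<omega> \<times> {0<..<\<epsilon>}) (v \<epsilon>)) \<le> energy e0 \<omega> u"
      by (rule upper)
  qed
qed

end
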